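(* Let $T>0$, $p>1$ and $0\le q<1$. Let $a\colon\mathbb{R}\to\mathbb{R}$ be a sign-changing, continuous and $T$-periodic function, having a finite number of zeros in $[0,T]$ and satisfying $\int_0^T a(t)\,dt<0$. Then there exist $\lambda_*$ and $\lambda^*$, with $0<\lambda_*\le\lambda^*$, such that both the equation $$\left(\frac{u'}{\sqrt{1-(u')^2}}\right)'+\lambda a(t)u^p=0$$ and the equation $$\left(\frac{u'}{\sqrt{1-(u')^2}}\right)'+\lambda a(t)\frac{u^p}{1+u^{p-q}}=0$$ have no positive $T$-periodic solutions for $\lambda\in(0,\lambda_* )$ and two positive $T$-periodic solutions for $\lambda>\lambda^*$.
   Context: Set $\varphi(\xi)=\xi/\sqrt{1-\xi^2}$ for $\xi\in(-1,1)$. A solution of $(\varphi(u'))'+\lambda a(t)g(u)=0$ is a continuously differentiable function $u$ (with $|u'|<1$) such that $t\mapsto\varphi(u'(t))$ is locally absolutely continuous and the equation holds for almost every $t$. A $T$-periodic solution is a solution defined on $\mathbb{R}$ with $u(t+T)=u(t)$ for all $t$; it is positive if $u(t)>0$ for all $t\in\mathbb{R}$. Sign-changing means that $a$ takes both positive and negative values. *)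

theory Defs
  imports "HOL-Analysis.Analysis"
begin

definition phi :: "real \<Rightarrow> real" where
  "phi \<xi> = \<xi> / sqrt (1 - \<xi>\<^sup>2)"

(* Absolute continuity of a function; the constant absolutely_continuous of
   HOL-Analysis is the notion for measures. *)
definition absolutely_continuous_fun_on :: "(real \<Rightarrow> real) \<Rightarrow> real set \<Rightarrow> bool" where
  "absolutely_continuous_fun_on f S \<longleftrightarrow>
     (\<forall>\<epsilon>>0. \<exists>\<delta>>0. \<forall>(n::nat) (x::nat \<Rightarrow> real) (y::nat \<Rightarrow> real).
        (\<forall>i<n. x i \<le> y i \<and> {x i..y i} \<subseteq> S) \<and>
        disjoint_family_on (\<lambda>i. {x i<..<y i}) {..<n} \<and>
        (\<Sum>i<n. y i - x i) < \<delta>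
        \<longrightarrow> (\<Sum>i<n. \<bar>f (y i) - f (x i)\<bar>) < \<epsilon>)"

definition locally_absolutely_continuous :: "(real \<Rightarrow> real) \<Rightarrow> bool" where
  "locally_absolutely_continuous f \<longleftrightarrow> (\<forall>c d. absolutely_continuous_fun_on f {c..d})"

(* u is a solution, on the whole real line, of (phi(u'))' + lam * a(t) * g(u) = 0.
   Differentiability of phi(u') is stated explicitly because deriv is an
   unspecified value where the derivative does not exist. *)
definition is_solution ::
    "real \<Rightarrow> (real \<Rightarrow> real) \<Rightarrow> (real \<Rightarrow> real) \<Rightarrow> (real \<Rightarrow> real) \<Rightarrow> bool" where
  "is_solution lam a g u \<longleftrightarrow>
     u C1_differentiable_on UNIV \<and>
     (\<forall>t. \<bar>deriv u t\<bar> < 1) \<and>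
     locally_absolutely_continuous (\<lambda>t. phi (deriv u t)) \<and>
     (AE t in lebesgue.
        (\<lambda>s. phi (deriv u s)) differentiable (at t) \<and>
        deriv (\<lambda>s. phi (deriv u s)) t + lam * a t * g (u t) = 0)"

definition positive_periodic_solution ::
    "real \<Rightarrow> real \<Rightarrow> (real \<Rightarrow> real) \<Rightarrow> (real \<Rightarrow> real) \<Rightarrow> (real \<Rightarrow> real) \<Rightarrow> bool" where
  "positive_periodic_solution T lam a g u \<longleftrightarrow>
     is_solution lam a g u \<and> (\<forall>t. u (t + T) = u t) \<and> (\<forall>t. u t > 0)"

end

theory Submission
  imports Defs "HOL-Complex_Analysis.Great_Picard"
begin

text \<open>
The equation is the Euler-Lagrange equation of

  I(u) = \<integral>_0^T (1 - sqrt(1 - u'^2)) dt - \<lambda> \<integral>_0^T a(t) G(u) dt, where G' = g,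

on the T-periodic functions with slope bounded by 1. The slope bound confines the oscillation of
u to T, so the mean value is the only direction in which compactness can fail, and there
\<integral>_0^T a < 0 helps: I tends to infinity with the mean value, and, because g is superlinear
at 0, the level set max u = r carries energy at least some c > 0 for small r
(\<open>coercive\<close>, \<open>energy_barrier\<close>). If u is positive somewhere, but only where
a is positive, then \<integral> a G(u) > 0 for G vanishing on the negative axis
(\<open>test_trajectory\<close>), and the energy of u is negative once \<lambda> is large. So there are two critical points, told apart by their energies: one of negative
energy, and one of energy at least c by the mountain pass between 0 and the test function.

The functional is not smooth at the slopes 1 and -1, and critical points are found without
differentiating it. A state is a pair (x, w) standing for u(t) = x + \<integral>_0^t w. Freezing the
forcing along u leaves a convex minimisation problem whose solution is explicit, because
\<phi>(v) = c - \<integral>_0^t f(., u) can be solved for v. Moving a short way from w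
towards v, and shifting x by a multiple of \<integral>_0^T f(., u), lowers the energy by a
fixed multiple of the squared distance to stationarity (\<open>energy_step\<close>). This map is
Lipschitz for the uniform distance of (x, w), and all the v along an orbit share one
Lipschitz constant, so by Arzela-Ascoli an orbit whose energy stays above m accumulates at a
stationary state of energy at least m (\<open>orbit_limit\<close>). For the mountain pass the map is
applied k times to the segment from 0 to the test function. The image joins 0 to a point of
negative energy, so it crosses max u = r over some parameter s_k; a limit s of the s_k
starts an orbit that never drops below the barrier (\<open>mountain_pass\<close>).

Two modifications of g make this work: g is extended by a constant beyond a level R, which
makes the forcing globally Lipschitz, and a penalty is put on negative values, which restores
coercivity there. Neither is felt by the critical points found. At a negative minimum the penalty
would push u further down; a nonnegative solution touching 0 vanishes by uniqueness and has
energy 0 (\<open>periodic_system_positive\<close>); and \<integral>_0^T a g(u) = 0 is impossible when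
u is everywhere so large that g is nearly constant on its range
(\<open>min_below_threshold\<close>), which bounds every positive solution by R, independently of
\<lambda>.

The same a priori bound gives nonexistence. If u is a positive solution with maximum M, then
\<phi>(u'), and with it the oscillation of u, is of order \<lambda> g(M). On the bounded range
of u the function g is Lipschitz, so for small \<lambda> the value g(u) differs from g(M) by
a small multiple of g(M), and then \<integral>_0^T a g(u) has the sign of \<integral>_0^T a instead of being
zero (\<open>no_solution_small_parameter\<close>).
\<close>

section \<open>The curvature operator and its energy density\<close>

text \<open>The inverse of \<phi>; unlike \<phi> it is defined and Lipschitz on the whole line.\<close>

definition phi_inv :: "real \<Rightarrow> real" where
  "phi_inv y = y / sqrt (1 + y\<^sup>2)"

text \<open>The primitive of \<phi> that vanishes at 0.\<close>

definition psi :: "real \<Rightarrow> real" where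
  "psi w = 1 - sqrt (1 - w\<^sup>2)"

lemma one_plus_square_pos: "1 + (y::real)\<^sup>2 > 0"
  by (simp add: add_pos_nonneg)

lemma abs_phi_inv_less_1: "\<bar>phi_inv y\<bar> < 1"
proof -
  have "\<bar>y\<bar> < sqrt (1 + y\<^sup>2)"
    by (rule real_less_rsqrt) simp
  then show ?thesis
    by (simp add: phi_inv_def one_plus_square_pos)
qed

lemma one_minus_phi_inv_square: "1 - (phi_inv y)\<^sup>2 = 1 / (1 + y\<^sup>2)"
  using one_plus_square_pos[of y] by (simp add: phi_inv_def power_divide field_simps)

lemma phi_phi_inv [simp]: "phi (phi_inv y) = y"
  using one_plus_square_pos[of y]
  by (simp add: phi_def one_minus_phi_inv_square real_sqrt_divide) (simp add: phi_inv_def)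

lemma phi_inv_phi:
  assumes "\<bar>x\<bar> < 1"
  shows "phi_inv (phi x) = x"
proof -
  have "x\<^sup>2 < 1"
    using assms by (simp add: abs_square_less_1)
  then have "1 + (phi x)\<^sup>2 = 1 / (1 - x\<^sup>2)"
    by (simp add: phi_def power_divide field_simps)
  with \<open>x\<^sup>2 < 1\<close> show ?thesis
    by (simp add: phi_inv_def real_sqrt_divide) (simp add: phi_def)
qed

lemma phi_inv_deriv: "\<exists>d. 0 < d \<and> d \<le> 1 \<and> (phi_inv has_real_derivative d) (at y)"
proof -
  have p: "1 + y\<^sup>2 > 0" "1 + y * y > 0"
    using one_plus_square_pos[of y] by (auto simp: power2_eq_square)
  define d where "d = 1 / (sqrt (1 + y\<^sup>2) * (1 + y\<^sup>2))"
  have sq: "sqrt (1 + y * y) * sqrt (1 + y * y) = 1 + y * y"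
    using p by simp
  have "(phi_inv has_real_derivative d) (at y)"
    unfolding phi_inv_def d_def
    apply (rule derivative_eq_intros refl | use p in \<open>simp; fail\<close>)+
    using p sq by (simp add: field_simps power2_eq_square)
  moreover have "d \<le> 1" 
  proof -
    have "1 * 1 \<le> sqrt (1 + y\<^sup>2) * (1 + y\<^sup>2)"
      by (rule mult_mono) auto
    then show ?thesis
      unfolding d_def using p by simp
  qed
  moreover have "d > 0"
    unfolding d_def using p by simp
  ultimately show ?thesis
    by blast
qed

lemma phi_inv_strict_mono: "x < y \<Longrightarrow> phi_inv x < phi_inv y"
  by (rule DERIV_pos_imp_increasing[of x y]) (use phi_inv_deriv in blast)+

lemma phi_inv_mono: "x \<le> y \<Longrightarrow> phi_inv x \<le> phi_inv y"
  using phi_inv_strict_mono[of x y] by (cases "x = y") auto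

lemma phi_inv_0 [simp]: "phi_inv 0 = 0"
  by (simp add: phi_inv_def)

lemma phi_0 [simp]: "phi 0 = 0"
  by (simp add: phi_def)

lemma phi_inv_lipschitz: "\<bar>phi_inv x - phi_inv y\<bar> \<le> \<bar>x - y\<bar>"
proof -
  have *: "\<bar>phi_inv y - phi_inv x\<bar> \<le> \<bar>y - x\<bar>" if "x < y" for x y
  proof -
    define D where "D z = (SOME d. 0 < d \<and> d \<le> 1 \<and> (phi_inv has_real_derivative d) (at z))" for z
    have D: "0 < D z \<and> D z \<le> 1 \<and> (phi_inv has_real_derivative D z) (at z)" for z
      unfolding D_def by (rule someI_ex[OF phi_inv_deriv])
    have "\<exists>z>x. z < y \<and> phi_inv y - phi_inv x = (y - x) * D z"
      by (rule MVT2[OF that]) (use D in blast)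
    then obtain z where z: "phi_inv y - phi_inv x = (y - x) * D z"
      by blast
    have "(y - x) * D z \<le> y - x" "0 \<le> (y - x) * D z"
      using D[of z] that by (auto intro!: mult_left_le)
    then show ?thesis
      using that z by simp
  qed
  show ?thesis
    using *[of x y] *[of y x] by (cases x y rule: linorder_cases) auto
qed

lemma abs_phi_inv_le: "\<bar>phi_inv y\<bar> \<le> \<bar>y\<bar>"
  using phi_inv_lipschitz[of y 0] by simp

lemma continuous_on_phi_inv: "continuous_on S f \<Longrightarrow> continuous_on S (\<lambda>t. phi_inv (f t))"
  unfolding phi_inv_def
  by (intro continuous_intros) (auto intro!: less_imp_neq[THEN not_sym] one_plus_square_pos)

lemma continuous_on_psi: "continuous_on S f \<Longrightarrow> continuous_on S (\<lambda>t. psi (f t))"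
  unfolding psi_def by (intro continuous_intros)

lemma psi_0 [simp]: "psi 0 = 0"
  by (simp add: psi_def)

text \<open>With k = sqrt(1 - s^2) and q = sqrt(1 - w^2) the points (s, k) and (w, q) lie on the unit
circle, so 1 - kq - sw is half their squared distance and hence at least (w - s)^2/2. Dividing by
k \<le> 1 gives the tangent line inequality for \<open>psi\<close> at s with a quadratic gain. The base
point is written as \<phi>^-1(y) because its slope is then simply y; the other point may lie on
the boundary, where \<phi> is infinite.\<close>

lemma psi_strong_convex:
  assumes "\<bar>w\<bar> \<le> 1"
  shows "psi w \<ge> psi (phi_inv y) + y * (w - phi_inv y) + (w - phi_inv y)\<^sup>2 / 2"
proof -
  define s where "s = phi_inv y"
  define k where "k = sqrt (1 - s\<^sup>2)"
  define q where "q = sqrt (1 - w\<^sup>2)"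
  have "\<bar>s\<bar> < 1"
    by (simp add: s_def abs_phi_inv_less_1)
  then have s1: "s\<^sup>2 < 1"
    by (simp add: abs_square_less_1)
  have w1: "w\<^sup>2 \<le> 1"
    using assms by (simp add: abs_square_le_1)
  have k: "k > 0" "k \<le> 1" "k\<^sup>2 = 1 - s\<^sup>2"
    using s1 by (auto simp: k_def)
  have q: "q\<^sup>2 = 1 - w\<^sup>2"
    using w1 by (simp add: q_def)
  have y: "y = s / k"
    using phi_phi_inv[of y] by (simp add: phi_def s_def k_def)
  have "k * (w - s)\<^sup>2 \<le> 1 * (w - s)\<^sup>2"
    by (rule mult_right_mono) (use k in auto)
  also have "\<dots> \<le> (w - s)\<^sup>2 + (q - k)\<^sup>2"
    by simp
  also have "\<dots> = 2 * (1 - k * q - s * w)"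
    using k(3) q by (simp add: power2_eq_square algebra_simps)
  finally have "k * (w - s)\<^sup>2 / 2 \<le> (k\<^sup>2 - k * q) - (s * w - s\<^sup>2)"
    using k(3) by simp
  moreover have "k * (k - q - s / k * (w - s)) = (k\<^sup>2 - k * q) - (s * w - s\<^sup>2)"
    using k(1) by (simp add: field_simps power2_eq_square)
  ultimately have "k * ((w - s)\<^sup>2 / 2) \<le> k * (k - q - s / k * (w - s))"
    by simp
  then have "(w - s)\<^sup>2 / 2 \<le> k - q - s / k * (w - s)"
    using k(1) by simp
  then show ?thesis
    unfolding psi_def s_def[symmetric] k_def[symmetric] q_def[symmetric] y[symmetric] by simp
qed

lemma psi_ge_half_square: "\<bar>w\<bar> \<le> 1 \<Longrightarrow> w\<^sup>2 / 2 \<le> psi w"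
  using psi_strong_convex[of w 0] by simp

lemma abs_convex_combination_le:
  fixes a b :: real
  assumes "\<bar>a\<bar> \<le> c" "\<bar>b\<bar> \<le> c" "0 \<le> \<theta>" "\<theta> \<le> 1"
  shows "\<bar>a + \<theta> * (b - a)\<bar> \<le> c"
proof -
  have "\<bar>a + \<theta> * (b - a)\<bar> = \<bar>(1 - \<theta>) * a + \<theta> * b\<bar>"
    by (simp add: algebra_simps)
  also have "\<dots> \<le> (1 - \<theta>) * \<bar>a\<bar> + \<theta> * \<bar>b\<bar>"
    using abs_triangle_ineq[of "(1 - \<theta>) * a" "\<theta> * b"] assms by (simp add: abs_mult)
  also have "\<dots> \<le> (1 - \<theta>) * c + \<theta> * c"
    using assms by (intro add_mono mult_left_mono) auto
  finally show ?thesis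
    by (simp add: algebra_simps)
qed

lemma psi_convex:
  assumes "\<bar>w\<bar> \<le> 1" "\<bar>v\<bar> < 1" "0 \<le> \<theta>" "\<theta> \<le> 1"
  shows "psi (w + \<theta> * (v - w)) \<le> psi w + \<theta> * (psi v - psi w)"
proof (cases "\<theta> = 0")
  case False
  define s where "s = w + \<theta> * (v - w)"
  have "\<bar>s\<bar> < 1"
  proof -
    have "\<bar>s\<bar> = \<bar>(1 - \<theta>) * w + \<theta> * v\<bar>"
      by (simp add: s_def algebra_simps)
    also have "\<dots> \<le> (1 - \<theta>) * \<bar>w\<bar> + \<theta> * \<bar>v\<bar>"
      using abs_triangle_ineq[of "(1 - \<theta>) * w" "\<theta> * v"] assms by (simp add: abs_mult)
    also have "\<dots> < (1 - \<theta>) * 1 + \<theta> * 1"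
      using assms False by (intro add_le_less_mono mult_left_mono mult_strict_left_mono) auto
    finally show ?thesis
      by simp
  qed
  then have s: "s = phi_inv (phi s)"
    by (simp add: phi_inv_phi)
  have *: "psi s + phi s * (z - s) \<le> psi z" if "\<bar>z\<bar> \<le> 1" for z
    using psi_strong_convex[OF that, of "phi s", folded s] zero_le_power2[of "z - s"] by linarith
  have "(1 - \<theta>) * (psi s + phi s * (w - s)) + \<theta> * (psi s + phi s * (v - s))
     \<le> (1 - \<theta>) * psi w + \<theta> * psi v"
    using assms by (intro add_mono mult_left_mono *) auto
  moreover have "(1 - \<theta>) * (psi s + phi s * (w - s)) + \<theta> * (psi s + phi s * (v - s)) =
     psi s + phi s * (((1 - \<theta>) * w + \<theta> * v) - s)"
    by (simp add: algebra_simps)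
  moreover have "(1 - \<theta>) * w + \<theta> * v = s"
    by (simp add: s_def algebra_simps)
  ultimately show ?thesis
    by (simp add: s_def algebra_simps)
qed simp

text \<open>The variance of g on [s, t] is nonnegative.\<close>

lemma integral_square_le:
  fixes g :: "real \<Rightarrow> real"
  assumes "continuous_on {s..t} g" "s \<le> t"
  shows "(integral {s..t} g)\<^sup>2 \<le> (t - s) * integral {s..t} (\<lambda>r. (g r)\<^sup>2)"
proof (cases "s = t")
  case False
  with assms have st: "s < t"
    by simp
  define J where "J = integral {s..t} g"
  define m where "m = J / (t - s)"
  have i: "g integrable_on {s..t}" "(\<lambda>r. (g r)\<^sup>2) integrable_on {s..t}"
    using assms by (auto intro!: integrable_continuous_interval continuous_intros)
  have "0 \<le> integral {s..t} (\<lambda>r. (g r - m)\<^sup>2)"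
    using assms by (auto intro!: integral_nonneg integrable_continuous_interval continuous_intros)
  also have "integral {s..t} (\<lambda>r. (g r - m)\<^sup>2) = integral {s..t} (\<lambda>r. (g r)\<^sup>2 - (2 * m) * g r + m\<^sup>2)"
    by (rule integral_cong) (simp add: power2_diff)
  also have "\<dots> = integral {s..t} (\<lambda>r. (g r)\<^sup>2) - 2 * m * J + (t - s) * m\<^sup>2"
  proof (rule integral_unique)
    have "((\<lambda>r. m\<^sup>2) has_integral ((t - s) * m\<^sup>2)) {s..t}"
      using has_integral_const_real[of "m\<^sup>2" s t] st by simp
    with i show "((\<lambda>r. (g r)\<^sup>2 - (2 * m) * g r + m\<^sup>2) has_integral
        (integral {s..t} (\<lambda>r. (g r)\<^sup>2) - 2 * m * J + (t - s) * m\<^sup>2)) {s..t}"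
      unfolding J_def by (intro has_integral_add has_integral_diff has_integral_mult_right integrable_integral)
  qed
  finally have "0 \<le> (t - s) * (integral {s..t} (\<lambda>r. (g r)\<^sup>2) - 2 * m * J + (t - s) * m\<^sup>2)"
    using st by simp
  also have "\<dots> = (t - s) * integral {s..t} (\<lambda>r. (g r)\<^sup>2) - 2 * ((t - s) * m) * J + ((t - s) * m)\<^sup>2"
    by (simp add: algebra_simps power2_eq_square)
  also have "(t - s) * m = J"
    using st by (simp add: m_def)
  finally show ?thesis
    by (simp add: J_def power2_eq_square)
qed simp

lemma integral_square_le_interval:
  fixes g :: "real \<Rightarrow> real"
  assumes "continuous_on {a..b} g" "a \<le> s" "s \<le> t" "t \<le> b"
  shows "(integral {s..t} g)\<^sup>2 \<le> (b - a) * integral {a..b} (\<lambda>r. (g r)\<^sup>2)"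
proof -
  have sub: "{s..t} \<subseteq> {a..b}"
    using assms by auto
  have c: "continuous_on {s..t} g"
    using assms(1) sub by (rule continuous_on_subset)
  have "(integral {s..t} g)\<^sup>2 \<le> (t - s) * integral {s..t} (\<lambda>r. (g r)\<^sup>2)"
    by (rule integral_square_le[OF c assms(3)])
  also have "\<dots> \<le> (b - a) * integral {a..b} (\<lambda>r. (g r)\<^sup>2)"
  proof (intro mult_mono integral_subset_le sub)
    show "0 \<le> integral {s..t} (\<lambda>r. (g r)\<^sup>2)"
      using c by (intro integral_nonneg integrable_continuous_interval continuous_intros) auto
  qed (use assms c in \<open>auto intro!: integrable_continuous_interval continuous_intros\<close>)
  finally show ?thesis .
qed

lemma continuous_on_integral_upper:
  fixes h :: "real \<Rightarrow> real"
  assumes "continuous_on {a..b} h"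
  shows "continuous_on {a..b} (\<lambda>t. integral {a..t} h)"
  using assms by (intro indefinite_integral_continuous_1 integrable_continuous_interval)

text \<open>Both boundary terms of the integration by parts vanish because \<integral>_0^t d is zero at both ends.\<close>

lemma integral_by_parts_vanishing:
  fixes h D' :: "real \<Rightarrow> real"
  assumes "0 \<le> T" "continuous_on {0..T} h" "continuous_on {0..T} d" "integral {0..T} d = 0"
  shows "integral {0..T} (\<lambda>t. h t * integral {0..t} d) = - integral {0..T} (\<lambda>t. integral {0..t} h * d t)"
proof -
  let ?H = "\<lambda>t. integral {0..t} h" and ?D = "\<lambda>t. integral {0..t} d"
  have c: "continuous_on {0..T} ?H" "continuous_on {0..T} ?D"
    using assms by (auto intro!: continuous_on_integral_upper)
  have "((\<lambda>t. ?H t * d t + h t * ?D t) has_integral (?H T * ?D T - ?H 0 * ?D 0)) {0..T}"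
  proof (rule fundamental_theorem_of_calculus[OF assms(1)])
    fix t assume t: "t \<in> {0..T}"
    have "(?H has_vector_derivative h t) (at t within {0..T})" "(?D has_vector_derivative d t) (at t within {0..T})"
      using assms t by (auto intro!: integral_has_vector_derivative)
    then show "((\<lambda>t. ?H t * ?D t) has_vector_derivative (?H t * d t + h t * ?D t)) (at t within {0..T})"
      by (rule has_vector_derivative_mult)
  qed
  then have "integral {0..T} (\<lambda>t. ?H t * d t + h t * ?D t) = 0"
    using assms(4) by (simp add: integral_unique)
  moreover have "integral {0..T} (\<lambda>t. ?H t * d t + h t * ?D t) =
     integral {0..T} (\<lambda>t. ?H t * d t) + integral {0..T} (\<lambda>t. h t * ?D t)"
    using assms c by (intro integral_add integrable_continuous_interval continuous_intros) auto
  ultimately show ?thesis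
    by simp
qed

section \<open>The descent step\<close>

lemma abs_integral_diff_le:
  fixes g h :: "real \<Rightarrow> real"
  assumes "a \<le> b" "continuous_on {a..b} g" "continuous_on {a..b} h"
    and "\<And>t. t \<in> {a..b} \<Longrightarrow> \<bar>g t - h t\<bar> \<le> e"
  shows "\<bar>integral {a..b} g - integral {a..b} h\<bar> \<le> e * (b - a)"
proof -
  have "integral {a..b} g - integral {a..b} h = integral {a..b} (\<lambda>t. g t - h t)"
    using assms by (intro integral_diff[symmetric] integrable_continuous_interval)
  also have "\<bar>\<dots>\<bar> \<le> e * (b - a)"
    using integral_bound[OF assms(1), of "\<lambda>t. g t - h t" e] assms by (auto intro!: continuous_intros)
  finally show ?thesis .
qed

text \<open>The condition that \<phi>^-1(c - H) is the slope of a function with equal values at 0 and T.\<close>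

definition balanced :: "real \<Rightarrow> (real \<Rightarrow> real) \<Rightarrow> real \<Rightarrow> bool" where
  "balanced T H c \<longleftrightarrow> integral {0..T} (\<lambda>t. phi_inv (c - H t)) = 0"

lemma continuous_on_phi_inv_shift:
  "continuous_on {0..T} H \<Longrightarrow> continuous_on {0..T} (\<lambda>t. phi_inv (c - H t))"
  by (intro continuous_on_phi_inv continuous_intros)

text \<open>The integral in \<open>balanced\<close> is strictly increasing in c and decreasing in H. This
comparison yields uniqueness of the balancing constant, and its Lipschitz dependence on H.\<close>

lemma balanced_le:
  assumes "0 < T" "continuous_on {0..T} H" "continuous_on {0..T} H'"
    and "balanced T H c" "balanced T H' c'" "\<And>t. t \<in> {0..T} \<Longrightarrow> H t \<le> H' t + d"
  shows "c \<le> c' + d"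
proof (rule ccontr)
  assume less: "\<not> c \<le> c' + d"
  have "c' - H' t < c - H t" if "t \<in> {0<..<T}" for t
    using less assms(6)[of t] that by simp
  then have "integral {0..T} (\<lambda>t. phi_inv (c' - H' t)) < integral {0..T} (\<lambda>t. phi_inv (c - H t))"
    using assms(1) by (intro integral_less_real continuous_on_phi_inv_shift assms(2,3) phi_inv_strict_mono) auto
  then show False
    using assms(4,5) by (simp add: balanced_def)
qed

lemma balanced_exists:
  assumes "0 < T" "continuous_on {0..T} H"
  shows "\<exists>c. balanced T H c"
proof -
  define I where "I c = integral {0..T} (\<lambda>t. phi_inv (c - H t))" for c
  have "\<bar>I c' - I c\<bar> \<le> \<bar>c' - c\<bar> * (T - 0)" for c c'
    unfolding I_def
  proof (rule abs_integral_diff_le)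
    show "\<bar>phi_inv (c' - H t) - phi_inv (c - H t)\<bar> \<le> \<bar>c' - c\<bar>" for t
      using phi_inv_lipschitz[of "c' - H t" "c - H t"] by simp
  qed (use assms in \<open>auto intro!: continuous_on_phi_inv_shift\<close>)
  then have "T-lipschitz_on S I" for S
    using assms(1) by (intro lipschitz_onI) (auto simp: dist_real_def mult.commute)
  then have cont: "continuous_on S I" for S
    by (rule lipschitz_on_continuous_on)
  obtain M where M: "\<And>t. t \<in> {0..T} \<Longrightarrow> \<bar>H t\<bar> \<le> M"
    using compact_imp_bounded[OF compact_continuous_image[OF assms(2)]] that unfolding bounded_iff by force
  have "0 \<le> M"
    using M[of 0] assms(1) by simp
  have "integral {0..T} (\<lambda>t. phi_inv (-M - H t)) \<le> integral {0..T} (\<lambda>t. 0)"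
    using M phi_inv_mono[of "- M - H t" 0 for t]
    by (intro integral_le integrable_continuous_interval continuous_on_phi_inv_shift assms) (fastforce simp: abs_le_iff)+
  moreover have "integral {0..T} (\<lambda>t. 0) \<le> integral {0..T} (\<lambda>t. phi_inv (M - H t))"
    using M phi_inv_mono[of 0 "M - H t" for t]
    by (intro integral_le integrable_continuous_interval continuous_on_phi_inv_shift assms) (fastforce simp: abs_le_iff)+
  ultimately have "I (-M) \<le> 0" "0 \<le> I M"
    by (auto simp: I_def)
  from IVT'[OF this _ cont] \<open>0 \<le> M\<close> show ?thesis
    by (auto simp: balanced_def I_def)
qed

definition balance :: "real \<Rightarrow> (real \<Rightarrow> real) \<Rightarrow> real" where
  "balance T H = (SOME c. balanced T H c)"

lemma balanced_balance: "0 < T \<Longrightarrow> continuous_on {0..T} H \<Longrightarrow> balanced T H (balance T H)"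
  unfolding balance_def by (rule someI_ex) (rule balanced_exists)

lemma balance_lipschitz:
  assumes "0 < T" "continuous_on {0..T} H" "continuous_on {0..T} H'"
    and "\<And>t. t \<in> {0..T} \<Longrightarrow> \<bar>H t - H' t\<bar> \<le> d"
  shows "\<bar>balance T H - balance T H'\<bar> \<le> d"
proof -
  have "H t \<le> H' t + d" "H' t \<le> H t + d" if "t \<in> {0..T}" for t
    using assms(4)[OF that] by auto
  then have "balance T H \<le> balance T H' + d" "balance T H' \<le> balance T H + d"
    using assms balanced_balance by (auto intro: balanced_le)
  then show ?thesis
    by simp
qed

lemma abs_psi_diff_le:
  assumes "\<bar>a\<bar> \<le> 1" "\<bar>b\<bar> \<le> 1"
  shows "\<bar>psi a - psi b\<bar> \<le> sqrt (2 * \<bar>a - b\<bar>)"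
proof -
  have *: "sqrt x - sqrt y \<le> sqrt (x - y)" if "0 \<le> y" "y \<le> x" for x y
    using sqrt_add_le_add_sqrt[of y "x - y"] that by simp
  have sq: "0 \<le> 1 - a\<^sup>2" "0 \<le> 1 - b\<^sup>2"
    using assms by (auto simp: abs_square_le_1)
  have "\<bar>psi a - psi b\<bar> = \<bar>sqrt (1 - a\<^sup>2) - sqrt (1 - b\<^sup>2)\<bar>"
    by (simp add: psi_def)
  also have "\<dots> \<le> sqrt \<bar>(1 - a\<^sup>2) - (1 - b\<^sup>2)\<bar>"
    using *[of "1 - a\<^sup>2" "1 - b\<^sup>2"] *[of "1 - b\<^sup>2" "1 - a\<^sup>2"] sq
    by (cases "a\<^sup>2 \<le> b\<^sup>2") auto
  also have "\<bar>(1 - a\<^sup>2) - (1 - b\<^sup>2)\<bar> = \<bar>a + b\<bar> * \<bar>a - b\<bar>"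
    by (subst abs_mult[symmetric]) (simp add: power2_eq_square algebra_simps abs_minus_commute)
  also have "\<dots> \<le> 2 * \<bar>a - b\<bar>"
    using assms by (intro mult_right_mono) auto
  finally show ?thesis
    by simp
qed

text \<open>A forcing f with potential P for which u = 0 is stationary. Continuity is required along
continuous curves, the form in which it enters the integrals. The Lipschitz constant L makes the
potential energy quadratically close to its linearisation, and so determines how long a descent step may be.\<close>

locale forcing =
  fixes T L :: real and f P :: "real \<Rightarrow> real \<Rightarrow> real"
  assumes T_pos: "0 < T"
    and L_nonneg: "0 \<le> L"
    and continuous_f: "\<And>u. continuous_on {0..T} u \<Longrightarrow> continuous_on {0..T} (\<lambda>t. f t (u t))"
    and lipschitz_f: "\<And>t s s'. t \<in> {0..T} \<Longrightarrow> \<bar>f t s - f t s'\<bar> \<le> L * \<bar>s - s'\<bar>"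
    and f_0: "\<And>t. t \<in> {0..T} \<Longrightarrow> f t 0 = 0"
    and deriv_P: "\<And>t s. t \<in> {0..T} \<Longrightarrow> (P t has_real_derivative f t s) (at s)"
    and continuous_P: "\<And>u. continuous_on {0..T} u \<Longrightarrow> continuous_on {0..T} (\<lambda>t. P t (u t))"
    and P_0: "\<And>t. t \<in> {0..T} \<Longrightarrow> P t 0 = 0"
begin

text \<open>States are pairs (x, w) of an initial value and a slope on [0, T]. Mean value zero of w says
that u(t) = x + \<integral>_0^t w has equal values at 0 and T; its slopes need not match there, which
is why stationarity will include a separate condition.\<close>

definition admissible :: "real \<times> (real \<Rightarrow> real) \<Rightarrow> bool" where
  "admissible z \<longleftrightarrow> continuous_on {0..T} (snd z) \<and> (\<forall>t\<in>{0..T}. \<bar>snd z t\<bar> \<le> 1) \<and>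
     integral {0..T} (snd z) = 0"

definition traj :: "real \<times> (real \<Rightarrow> real) \<Rightarrow> real \<Rightarrow> real" where
  "traj z t = fst z + integral {0..t} (snd z)"

definition force :: "real \<times> (real \<Rightarrow> real) \<Rightarrow> real \<Rightarrow> real" where
  "force z t = f t (traj z t)"

definition impulse :: "real \<times> (real \<Rightarrow> real) \<Rightarrow> real \<Rightarrow> real" where
  "impulse z t = integral {0..t} (force z)"

text \<open>The slope v that minimises the convex functional obtained by freezing the forcing along the
current trajectory: it solves (\<phi>(v))' = - f(t, u), with the constant of
integration chosen so that the new trajectory has equal values at 0 and T.\<close>

definition slope :: "real \<times> (real \<Rightarrow> real) \<Rightarrow> real \<Rightarrow> real" where
  "slope z t = phi_inv (balance T (impulse z) - impulse z t)"

text \<open>Short enough for the quadratic error of the potential to eat up at most half of the first-order gain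
in \<open>energy_step\<close>.\<close>

definition rate :: real where
  "rate = 1 / (1 + 2 * L * T + 4 * L * T\<^sup>2)"

definition step :: "real \<times> (real \<Rightarrow> real) \<Rightarrow> real \<times> (real \<Rightarrow> real)" where
  "step z = (fst z + rate * impulse z T, \<lambda>t. snd z t + rate * (slope z t - snd z t))"

definition energy :: "real \<times> (real \<Rightarrow> real) \<Rightarrow> real" where
  "energy z = integral {0..T} (\<lambda>t. psi (snd z t)) - integral {0..T} (\<lambda>t. P t (traj z t))"

lemma rate_bounds: "0 < rate" "rate \<le> 1" "L * rate * T \<le> 1 / 2" "L * rate * T\<^sup>2 \<le> 1 / 4"
proof -
  have p: "0 \<le> L * T" "0 \<le> L * T\<^sup>2"
    using T_pos L_nonneg by auto
  then have q: "1 + 2 * L * T + 4 * L * T\<^sup>2 > 0"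
    by (simp add: mult.assoc add_pos_nonneg)
  with p show "0 < rate" "rate \<le> 1" "L * rate * T \<le> 1 / 2" "L * rate * T\<^sup>2 \<le> 1 / 4"
    by (auto simp: rate_def field_simps)
qed

text \<open>The derivative in e of the difference of the two sides has the sign of e.\<close>

lemma P_lower:
  assumes "t \<in> {0..T}"
  shows "P t s + f t s * e - L / 2 * e\<^sup>2 \<le> P t (s + e)"
proof -
  define q where "q e = P t (s + e) - P t s - f t s * e + L / 2 * e\<^sup>2" for e
  have q': "(q has_real_derivative (f t (s + e) - f t s + L * e)) (at e)" for e
    unfolding q_def
    by (rule derivative_eq_intros DERIV_chain2[OF deriv_P[OF assms]] refl)+ simp
  have "q 0 \<le> q e"
  proof (cases "0 \<le> e")
    case True
    show ?thesis
    proof (rule DERIV_nonneg_imp_nondecreasing[OF True])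
      fix x assume "0 \<le> x" "x \<le> e"
      then show "\<exists>y. (q has_real_derivative y) (at x) \<and> 0 \<le> y"
        using q'[of x] lipschitz_f[OF assms, of "s + x" s] by (intro exI[of _ "f t (s + x) - f t s + L * x"] conjI) auto
    qed
  next
    case False
    then have "e \<le> 0"
      by simp
    then show ?thesis
    proof (rule DERIV_nonpos_imp_nonincreasing)
      fix x assume "e \<le> x" "x \<le> 0"
      then show "\<exists>y. (q has_real_derivative y) (at x) \<and> y \<le> 0"
        using q'[of x] lipschitz_f[OF assms, of "s + x" s] by (intro exI[of _ "f t (s + x) - f t s + L * x"] conjI) auto
    qed
  qed
  then show ?thesis
    by (simp add: q_def)
qed

lemma abs_P_diff_le:
  assumes t: "t \<in> {0..T}" and "\<bar>s\<bar> \<le> M" "\<bar>s'\<bar> \<le> M"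
  shows "\<bar>P t s - P t s'\<bar> \<le> L * M * \<bar>s - s'\<bar>"
proof -
  have "norm (P t s - P t s') \<le> L * M * norm (s - s')"
  proof (rule field_differentiable_bound)
    show "convex {-M..M}"
      by (rule convex_real_interval)
    fix r assume "r \<in> {-M..M}"
    then have "\<bar>r\<bar> \<le> M"
      by (simp add: abs_le_iff)
    then have "L * \<bar>r\<bar> \<le> L * M"
      by (rule mult_left_mono[OF _ L_nonneg])
    then show "norm (f t r) \<le> L * M"
      using lipschitz_f[OF t, of r 0] f_0[OF t] by simp
    show "(P t has_field_derivative f t r) (at r within {-M..M})"
      using deriv_P[OF t] by (rule has_field_derivative_at_within)
  qed (use assms in auto)
  then show ?thesis
    by simp
qed

lemma continuous_traj: "admissible z \<Longrightarrow> continuous_on {0..T} (traj z)"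
  unfolding traj_def admissible_def
  by (intro continuous_intros continuous_on_integral_upper) auto

lemma continuous_force: "admissible z \<Longrightarrow> continuous_on {0..T} (force z)"
  unfolding force_def by (intro continuous_f continuous_traj)

lemma continuous_impulse: "admissible z \<Longrightarrow> continuous_on {0..T} (impulse z)"
  unfolding impulse_def by (intro continuous_on_integral_upper continuous_force)

lemma continuous_slope: "admissible z \<Longrightarrow> continuous_on {0..T} (slope z)"
  unfolding slope_def by (intro continuous_on_phi_inv_shift continuous_impulse)

lemma integral_slope: "admissible z \<Longrightarrow> integral {0..T} (slope z) = 0"
  using balanced_balance[OF T_pos continuous_impulse] unfolding slope_def balanced_def by blast

lemma continuous_admissible: "admissible z \<Longrightarrow> continuous_on {0..T} (snd z)"
  by (simp add: admissible_def)

lemma abs_slope_less_1: "\<bar>slope z t\<bar> < 1"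
  unfolding slope_def by (rule abs_phi_inv_less_1)

lemma abs_traj_le:
  assumes "admissible z" "t \<in> {0..T}"
  shows "\<bar>traj z t\<bar> \<le> \<bar>fst z\<bar> + T"
proof -
  have c: "continuous_on {0..t} (snd z)"
    using assms by (auto simp: admissible_def intro: continuous_on_subset)
  have "norm (integral {0..t} (snd z)) \<le> 1 * (t - 0)"
    by (rule integral_bound) (use assms c in \<open>auto simp: admissible_def\<close>)
  then show ?thesis
    using assms(2) by (auto simp: traj_def)
qed

lemma integral_traj_diff:
  assumes z: "admissible z" and "0 \<le> s" "s \<le> t" "t \<le> T"
  shows "traj z t - traj z s = integral {s..t} (snd z)"
proof -
  have "snd z integrable_on {0..t}"
    using continuous_admissible[OF z] assms(4)
    by (intro integrable_continuous_interval) (auto elim: continuous_on_subset)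
  from Henstock_Kurzweil_Integration.integral_combine[OF assms(2,3) this] show ?thesis
    by (simp add: traj_def)
qed

lemma admissible_step:
  assumes z: "admissible z"
  shows "admissible (step z)"
proof -
  note c = continuous_admissible[OF z] continuous_slope[OF z]
  have "integral {0..T} (\<lambda>t. snd z t + rate * (slope z t - snd z t)) = 
      integral {0..T} (snd z) + rate * (integral {0..T} (slope z) - integral {0..T} (snd z))"
    using c by (intro integral_unique has_integral_add has_integral_mult_right has_integral_diff
        integrable_integral integrable_continuous_interval)
  moreover have "\<bar>snd z t + rate * (slope z t - snd z t)\<bar> \<le> 1" if "t \<in> {0..T}" for t
    using z that rate_bounds abs_slope_less_1[of z t]
    by (intro abs_convex_combination_le) (auto simp: admissible_def)
  ultimately show ?thesis
    using c z integral_slope[OF z]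
    by (auto simp: admissible_def step_def intro!: continuous_intros)
qed

lemma traj_step:
  assumes z: "admissible z" and t: "t \<in> {0..T}"
  shows "traj (step z) t = traj z t + rate * (impulse z T + integral {0..t} (\<lambda>r. slope z r - snd z r))"
proof -
  have c: "continuous_on {0..t} (snd z)" "continuous_on {0..t} (slope z)"
    using continuous_admissible[OF z] continuous_slope[OF z] t by (auto elim: continuous_on_subset)
  then have "integral {0..t} (\<lambda>r. snd z r + rate * (slope z r - snd z r)) =
      integral {0..t} (snd z) + rate * integral {0..t} (\<lambda>r. slope z r - snd z r)"
    by (intro integral_unique has_integral_add has_integral_mult_right
        integrable_integral integrable_continuous_interval continuous_intros)
  then show ?thesis
    by (simp add: traj_def step_def algebra_simps)
qed

text \<open>Write d = v - w and H for the impulse. Convexity of the kinetic part, together with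
\<phi>(v) = c - H and \<integral> d = 0, gives a gain of at least
\<theta>(\<integral> H d + 1/2 \<integral> d^2). The displacement of the trajectory is \<theta> e with
e = H(T) + \<integral>_0^t d, so the potential contributes to first order
\<theta> \<integral> f e = \<theta> (H(T)^2 - \<integral> H d) after an integration by parts. The terms \<integral> H d
cancel, and what is left controls the distance to stationarity.\<close>

lemma energy_step:
  assumes z: "admissible z"
  shows "energy (step z) \<le> energy z -
     rate / 4 * ((impulse z T)\<^sup>2 + integral {0..T} (\<lambda>t. (slope z t - snd z t)\<^sup>2))"
proof -
  define w v where "w = snd z" and "v = slope z"
  define d where "d t = v t - w t" for t
  define h H D where "h = force z" and "H = impulse z" and "D t = integral {0..t} d" for t
  define c where "c = balance T H"
  define N where "N = integral {0..T} (\<lambda>t. (d t)\<^sup>2)"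
  have T0: "0 \<le> T"
    using T_pos by simp
  have cont: "continuous_on {0..T} w" "continuous_on {0..T} v" "continuous_on {0..T} h" "continuous_on {0..T} H"
    using z by (auto simp: w_def v_def h_def H_def intro: continuous_admissible continuous_slope continuous_force continuous_impulse)
  then have cd: "continuous_on {0..T} d"
    unfolding d_def by (intro continuous_intros)
  then have cD: "continuous_on {0..T} D"
    unfolding D_def by (rule continuous_on_integral_upper)
  have cu: "continuous_on {0..T} (traj z)" "continuous_on {0..T} (traj (step z))"
    using z admissible_step continuous_traj by auto
  note ici = integrable_continuous_interval
  have d0: "integral {0..T} d = 0"
    unfolding d_def using cont integral_slope[OF z] z
    by (subst integral_diff) (auto intro!: ici simp: v_def w_def admissible_def)
  have w1: "\<bar>w t\<bar> \<le> 1" if "t \<in> {0..T}" for t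
    using z that by (auto simp: w_def admissible_def)

  have "integral {0..T} (\<lambda>t. psi (snd (step z) t)) \<le>
    integral {0..T} (\<lambda>t. psi (w t) + rate * (c * d t - H t * d t - (d t)\<^sup>2 / 2))"
  proof (rule integral_le)
    fix t assume t: "t \<in> {0..T}"
    have v: "v t = phi_inv (c - H t)"
      by (simp add: v_def slope_def c_def H_def)
    have "psi (snd (step z) t) \<le> psi (w t) + rate * (psi (v t) - psi (w t))"
      using psi_convex[OF w1[OF t], of "v t" rate] rate_bounds abs_slope_less_1[of z t]
      by (simp add: step_def w_def v_def)
    also have "\<dots> \<le> psi (w t) + rate * (c * d t - H t * d t - (d t)\<^sup>2 / 2)"
      using psi_strong_convex[OF w1[OF t], of "c - H t"] rate_bounds(1)
      by (intro add_left_mono mult_left_mono) (auto simp: v[symmetric] d_def power2_commute algebra_simps)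
    finally show "psi (snd (step z) t) \<le> psi (w t) + rate * (c * d t - H t * d t - (d t)\<^sup>2 / 2)" .
  qed (use cont cd continuous_admissible[OF admissible_step[OF z]] in
        \<open>auto intro!: ici continuous_intros continuous_on_psi\<close>)
  also have "\<dots> = integral {0..T} (\<lambda>t. psi (w t)) +
      rate * (c * integral {0..T} d - integral {0..T} (\<lambda>t. H t * d t) - N / 2)"
    unfolding N_def using cont cd
    by (intro integral_unique has_integral_add has_integral_mult_right has_integral_diff has_integral_divide
        integrable_integral ici continuous_intros continuous_on_psi)
  finally have kinetic: "integral {0..T} (\<lambda>t. psi (snd (step z) t)) \<le> integral {0..T} (\<lambda>t. psi (w t)) +
      rate * (- integral {0..T} (\<lambda>t. H t * d t) - N / 2)"
    by (simp add: d0)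

  define K where "K = L * rate\<^sup>2 * ((H T)\<^sup>2 + T * N)"
  have hD: "integral {0..T} (\<lambda>t. h t * D t) = - integral {0..T} (\<lambda>t. H t * d t)"
    using integral_by_parts_vanishing[OF T0 cont(3) cd d0] by (simp add: D_def H_def impulse_def[abs_def] h_def)
  have "integral {0..T} (\<lambda>t. P t (traj z t) + rate * (H T * h t + h t * D t) - K) \<le>
    integral {0..T} (\<lambda>t. P t (traj (step z) t))"
  proof (rule integral_le)
    fix t assume t: "t \<in> {0..T}"
    define e where "e = H T + D t"
    have D2: "(D t)\<^sup>2 \<le> T * N"
      using integral_square_le_interval[OF cd, of 0 t] t by (simp add: D_def N_def)
    have "e\<^sup>2 \<le> 2 * (H T)\<^sup>2 + 2 * (D t)\<^sup>2"
      unfolding e_def using zero_le_power2[of "H T - D t"] by (simp add: power2_sum power2_diff)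
    also have "\<dots> \<le> 2 * ((H T)\<^sup>2 + T * N)"
      using D2 by simp
    finally have "L / 2 * rate\<^sup>2 * e\<^sup>2 \<le> L / 2 * rate\<^sup>2 * (2 * ((H T)\<^sup>2 + T * N))"
      using L_nonneg by (intro mult_left_mono) auto
    then have "L / 2 * (rate * e)\<^sup>2 \<le> K"
      by (simp add: K_def power_mult_distrib algebra_simps)
    moreover have "traj (step z) t = traj z t + rate * e"
      using traj_step[OF z t] by (simp add: e_def H_def D_def d_def[abs_def] v_def w_def)
    ultimately show "P t (traj z t) + rate * (H T * h t + h t * D t) - K \<le> P t (traj (step z) t)"
      using P_lower[OF t, of "traj z t" "rate * e"]
      by (simp add: h_def force_def e_def algebra_simps)
  qed (use cont cD cu in \<open>auto intro!: ici continuous_intros continuous_P\<close>)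
  also have "integral {0..T} (\<lambda>t. P t (traj z t) + rate * (H T * h t + h t * D t) - K) =
     integral {0..T} (\<lambda>t. P t (traj z t)) +
       rate * (H T * integral {0..T} h + integral {0..T} (\<lambda>t. h t * D t)) - T * K"
  proof (rule integral_unique)
    have "((\<lambda>t. K) has_integral T * K) {0..T}"
      using has_integral_const_real[of K 0 T] T0 by simp
    with cont cD cu show "((\<lambda>t. P t (traj z t) + rate * (H T * h t + h t * D t) - K) has_integral
       (integral {0..T} (\<lambda>t. P t (traj z t)) +
       rate * (H T * integral {0..T} h + integral {0..T} (\<lambda>t. h t * D t)) - T * K)) {0..T}"
      by (intro has_integral_add has_integral_mult_right has_integral_diff
        integrable_integral ici continuous_intros continuous_P)
  qed
  also have "integral {0..T} h = H T"
    by (simp add: H_def impulse_def h_def)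
  finally have potential: "integral {0..T} (\<lambda>t. P t (traj z t)) +
      rate * ((H T)\<^sup>2 - integral {0..T} (\<lambda>t. H t * d t)) - T * K \<le> integral {0..T} (\<lambda>t. P t (traj (step z) t))"
    by (simp add: hD power2_eq_square)

  have N: "0 \<le> N"
    unfolding N_def using cd by (intro integral_nonneg ici continuous_intros) auto
  have "T * K = rate * ((L * rate * T) * (H T)\<^sup>2 + (L * rate * T\<^sup>2) * N)"
    by (simp add: K_def power2_eq_square algebra_simps)
  also have "\<dots> \<le> rate * (1 / 2 * (H T)\<^sup>2 + 1 / 4 * N)"
    using rate_bounds N by (intro mult_left_mono add_mono mult_right_mono) auto
  finally have "T * K \<le> rate * (1 / 2 * (H T)\<^sup>2 + 1 / 4 * N)" .
  with kinetic potential have "energy (step z) \<le> energy z - rate * (1 / 2 * (H T)\<^sup>2 + 1 / 4 * N)"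
    by (simp add: energy_def w_def algebra_simps)
  also have "\<dots> \<le> energy z - rate * (1 / 4 * (H T)\<^sup>2 + 1 / 4 * N)"
    using rate_bounds by (intro diff_left_mono mult_left_mono add_right_mono mult_right_mono) auto
  finally show ?thesis
    by (simp add: N_def H_def d_def v_def w_def algebra_simps)
qed

end

section \<open>Limits of orbits of the descent step\<close>

context forcing
begin

text \<open>Closeness in the uniform distance of initial values and slopes. It ignores the values of the slopes
outside [0, T], which carry no meaning.\<close>

definition close :: "real \<Rightarrow> real \<times> (real \<Rightarrow> real) \<Rightarrow> real \<times> (real \<Rightarrow> real) \<Rightarrow> bool" where
  "close e z z' \<longleftrightarrow> \<bar>fst z - fst z'\<bar> \<le> e \<and> (\<forall>t\<in>{0..T}. \<bar>snd z t - snd z' t\<bar> \<le> e)"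

lemma close_nonneg: "close e z z' \<Longrightarrow> 0 \<le> e"
  unfolding close_def by (auto intro: order_trans[OF abs_ge_zero])

lemma close_mono: "close e z z' \<Longrightarrow> e \<le> e' \<Longrightarrow> close e' z z'"
  unfolding close_def by fastforce

lemma close_traj:
  assumes "close e z z'" "admissible z" "admissible z'" "t \<in> {0..T}"
  shows "\<bar>traj z t - traj z' t\<bar> \<le> (1 + T) * e"
proof -
  have "\<bar>integral {0..t} (snd z) - integral {0..t} (snd z')\<bar> \<le> e * (t - 0)"
    using assms continuous_admissible[of z] continuous_admissible[of z']
    by (intro abs_integral_diff_le) (auto simp: close_def elim: continuous_on_subset)
  also have "\<dots> \<le> e * T"
    using assms(4) close_nonneg[OF assms(1)] by (intro mult_left_mono) auto
  finally show ?thesis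
    using assms(1) by (simp add: traj_def close_def abs_le_iff algebra_simps)
qed

lemma close_impulse:
  assumes c: "close e z z'" and z: "admissible z" "admissible z'" and t: "t \<in> {0..T}"
  shows "\<bar>impulse z t - impulse z' t\<bar> \<le> T * L * (1 + T) * e"
proof -
  have "\<bar>integral {0..t} (force z) - integral {0..t} (force z')\<bar> \<le> L * ((1 + T) * e) * (t - 0)"
  proof (rule abs_integral_diff_le)
    fix r assume "r \<in> {0..t}"
    then have r: "r \<in> {0..T}"
      using t by auto
    have "\<bar>force z r - force z' r\<bar> \<le> L * \<bar>traj z r - traj z' r\<bar>"
      unfolding force_def by (rule lipschitz_f[OF r])
    also have "\<dots> \<le> L * ((1 + T) * e)"
      by (intro mult_left_mono close_traj c z r L_nonneg)
    finally show "\<bar>force z r - force z' r\<bar> \<le> L * ((1 + T) * e)" .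
  qed (use t continuous_force[OF z(1)] continuous_force[OF z(2)] in \<open>auto elim: continuous_on_subset\<close>)
  also have "\<dots> \<le> L * ((1 + T) * e) * T"
    using t L_nonneg T_pos close_nonneg[OF c] by (intro mult_left_mono) auto
  finally show ?thesis
    by (simp add: impulse_def mult_ac)
qed

definition step_const :: real where
  "step_const = 1 + 2 * (T * L * (1 + T))"

lemma step_const_pos: "0 < step_const"
  using T_pos L_nonneg by (auto simp: step_const_def intro!: add_pos_nonneg)

lemma close_step:
  assumes c: "close e z z'" and z: "admissible z" "admissible z'"
  shows "close (step_const * e) (step z) (step z')"
proof -
  define k where "k = T * L * (1 + T) * e"
  have k: "0 \<le> k" 
    using T_pos L_nonneg close_nonneg[OF c] by (simp add: k_def)
  have e: "step_const * e = e + 2 * k"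
    by (simp add: step_const_def k_def algebra_simps)
  have H: "\<bar>impulse z t - impulse z' t\<bar> \<le> k" if "t \<in> {0..T}" for t
    using close_impulse[OF c z that] by (simp add: k_def)
  have b: "\<bar>balance T (impulse z) - balance T (impulse z')\<bar> \<le> k"
    by (intro balance_lipschitz T_pos continuous_impulse z H)
  have v: "\<bar>slope z t - slope z' t\<bar> \<le> 2 * k" if "t \<in> {0..T}" for t
    using order_trans[OF phi_inv_lipschitz, of "balance T (impulse z) - impulse z t" "balance T (impulse z') - impulse z' t" "2 * k"]
      H[OF that] b by (auto simp: slope_def)
  show ?thesis
    unfolding close_def
  proof (intro conjI ballI)
    have "\<bar>fst (step z) - fst (step z')\<bar> = \<bar>(fst z - fst z') + rate * (impulse z T - impulse z' T)\<bar>"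
      by (simp add: step_def algebra_simps)
    also have "\<dots> \<le> \<bar>fst z - fst z'\<bar> + rate * \<bar>impulse z T - impulse z' T\<bar>"
      using rate_bounds abs_triangle_ineq[of "fst z - fst z'" "rate * (impulse z T - impulse z' T)"] by (simp add: abs_mult)
    also have "\<dots> \<le> e + 1 * k"
      using c H[of T] T_pos rate_bounds k by (intro add_mono mult_mono) (auto simp: close_def)
    finally show "\<bar>fst (step z) - fst (step z')\<bar> \<le> step_const * e"
      using e k by simp
  next
    fix t assume t: "t \<in> {0..T}"
    have "snd (step z) t - snd (step z') t = (snd z t - snd z' t) + rate * ((slope z t - slope z' t) - (snd z t - snd z' t))"
      by (simp add: step_def algebra_simps)
    moreover have "\<bar>snd z t - snd z' t\<bar> \<le> e + 2 * k" "\<bar>slope z t - slope z' t\<bar> \<le> e + 2 * k"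
      using c v[OF t] k close_nonneg[OF c] t by (force simp: close_def)+
    ultimately have "\<bar>snd (step z) t - snd (step z') t\<bar> \<le> e + 2 * k"
      using rate_bounds by (simp add: abs_convex_combination_le)
    then show "\<bar>snd (step z) t - snd (step z') t\<bar> \<le> step_const * e"
      by (simp add: e)
  qed
qed

text \<open>The square root comes from \<open>psi\<close>, which is only Hoelder continuous at the slopes 1 and -1.\<close>

lemma close_energy:
  assumes c: "close e z z'" and z: "admissible z" "admissible z'"
  shows "\<bar>energy z - energy z'\<bar> \<le> T * sqrt (2 * e) + T * (L * (\<bar>fst z\<bar> + e + T) * ((1 + T) * e))"
proof -
  note e = close_nonneg[OF c]
  have "\<bar>integral {0..T} (\<lambda>t. psi (snd z t)) - integral {0..T} (\<lambda>t. psi (snd z' t))\<bar> \<le> sqrt (2 * e) * (T - 0)"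
  proof (rule abs_integral_diff_le)
    fix t assume t: "t \<in> {0..T}"
    have "\<bar>psi (snd z t) - psi (snd z' t)\<bar> \<le> sqrt (2 * \<bar>snd z t - snd z' t\<bar>)"
      using z t by (intro abs_psi_diff_le) (auto simp: admissible_def)
    also have "\<dots> \<le> sqrt (2 * e)"
      using c t by (auto simp: close_def)
    finally show "\<bar>psi (snd z t) - psi (snd z' t)\<bar> \<le> sqrt (2 * e)" .
  qed (use T_pos z in \<open>auto intro!: continuous_on_psi continuous_admissible\<close>)
  moreover have "\<bar>integral {0..T} (\<lambda>t. P t (traj z t)) - integral {0..T} (\<lambda>t. P t (traj z' t))\<bar> \<le>
      L * (\<bar>fst z\<bar> + e + T) * ((1 + T) * e) * (T - 0)"
  proof (rule abs_integral_diff_le)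
    fix t assume t: "t \<in> {0..T}"
    have "\<bar>traj z t\<bar> \<le> \<bar>fst z\<bar> + e + T" "\<bar>traj z' t\<bar> \<le> \<bar>fst z\<bar> + e + T"
      using abs_traj_le[OF z(1) t] abs_traj_le[OF z(2) t] c e by (auto simp: close_def)
    then have "\<bar>P t (traj z t) - P t (traj z' t)\<bar> \<le> L * (\<bar>fst z\<bar> + e + T) * \<bar>traj z t - traj z' t\<bar>"
      by (intro abs_P_diff_le t)
    also have "\<dots> \<le> L * (\<bar>fst z\<bar> + e + T) * ((1 + T) * e)"
      using close_traj[OF c z t] L_nonneg T_pos e by (intro mult_left_mono) auto
    finally show "\<bar>P t (traj z t) - P t (traj z' t)\<bar> \<le> L * (\<bar>fst z\<bar> + e + T) * ((1 + T) * e)" .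
  qed (use T_pos z in \<open>auto intro!: continuous_P continuous_traj\<close>)
  ultimately show ?thesis
    by (simp add: energy_def algebra_simps)
qed

definition converges :: "(nat \<Rightarrow> real \<times> (real \<Rightarrow> real)) \<Rightarrow> real \<times> (real \<Rightarrow> real) \<Rightarrow> bool" where
  "converges X z \<longleftrightarrow> (\<forall>e>0. \<exists>N. \<forall>n\<ge>N. close e z (X n))"

lemma converges_step:
  assumes "converges X z" "admissible z" "\<And>n. admissible (X n)"
  shows "converges (\<lambda>n. step (X n)) (step z)"
  unfolding converges_def
proof (intro allI impI)
  fix e :: real assume "e > 0"
  then have "e / step_const > 0"
    using step_const_pos by simp
  with assms(1) obtain N where "\<And>n. n \<ge> N \<Longrightarrow> close (e / step_const) z (X n)"
    unfolding converges_def by blast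
  then have "close (step_const * (e / step_const)) (step z) (step (X n))" if "n \<ge> N" for n
    using that close_step assms(2,3) by blast
  then show "\<exists>N. \<forall>n\<ge>N. close e (step z) (step (X n))"
    using step_const_pos by auto
qed

lemma converges_energy:
  assumes "converges X z" "admissible z" "\<And>n. admissible (X n)"
  shows "(\<lambda>n. energy (X n)) \<longlonglongrightarrow> energy z"
proof (rule LIMSEQ_I)
  fix r :: real assume "r > 0"
  define b where "b e = T * sqrt (2 * e) + T * (L * (\<bar>fst z\<bar> + e + T) * ((1 + T) * e))" for e
  have "(\<lambda>n. b (inverse (real (Suc n)))) \<longlonglongrightarrow>
     T * sqrt (2 * 0) + T * (L * (\<bar>fst z\<bar> + 0 + T) * ((1 + T) * 0))"
    unfolding b_def by (intro tendsto_intros LIMSEQ_inverse_real_of_nat)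
  then have "(\<lambda>n. b (inverse (real (Suc n)))) \<longlonglongrightarrow> 0"
    by simp
  then have "\<forall>\<^sub>F n in sequentially. b (inverse (real (Suc n))) < r"
    by (rule order_tendstoD) (rule \<open>r > 0\<close>)
  then obtain k where k: "b (inverse (real (Suc k))) < r"
    using eventually_happens' sequentially_bot by blast
  have "inverse (real (Suc k)) > 0"
    by simp
  with assms(1) obtain N where N: "\<And>n. n \<ge> N \<Longrightarrow> close (inverse (real (Suc k))) z (X n)"
    unfolding converges_def by blast
  have "norm (energy (X n) - energy z) < r" if "n \<ge> N" for n
    using close_energy[OF N[OF that] assms(2,3)] k unfolding b_def[symmetric] by (simp add: abs_minus_commute)
  then show "\<exists>N. \<forall>n\<ge>N. norm (energy (X n) - energy z) < r"
    by blast
qed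

definition orbit :: "nat \<Rightarrow> real \<times> (real \<Rightarrow> real) \<Rightarrow> real \<times> (real \<Rightarrow> real)" where
  "orbit k = step ^^ k"

lemma orbit_0 [simp]: "orbit 0 z = z" and orbit_Suc [simp]: "orbit (Suc k) z = step (orbit k z)"
  by (auto simp: orbit_def)

lemma admissible_orbit: "admissible z \<Longrightarrow> admissible (orbit k z)"
  by (induction k) (auto intro: admissible_step)

lemma energy_step_le: "admissible z \<Longrightarrow> energy (step z) \<le> energy z"
proof -
  assume z: "admissible z"
  have "0 \<le> integral {0..T} (\<lambda>t. (slope z t - snd z t)\<^sup>2)"
    using z by (intro integral_nonneg integrable_continuous_interval continuous_intros continuous_slope continuous_admissible) auto
  then have "0 \<le> rate / 4 * ((impulse z T)\<^sup>2 + integral {0..T} (\<lambda>t. (slope z t - snd z t)\<^sup>2))"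
    using rate_bounds by (intro mult_nonneg_nonneg add_nonneg_nonneg) auto
  with energy_step[OF z] show ?thesis
    by linarith
qed

lemma energy_orbit_antimono: "admissible z \<Longrightarrow> j \<le> k \<Longrightarrow> energy (orbit k z) \<le> energy (orbit j z)"
  by (rule lift_Suc_antimono_le[of "\<lambda>k. energy (orbit k z)"]) (auto intro: energy_step_le admissible_orbit)

text \<open>The vanishing impulse makes \<phi>(w) = c - H take the same value at 0 and T, so that a
stationary trajectory extends to a periodic function that is continuously differentiable across the
endpoints.\<close>

definition stationary :: "real \<times> (real \<Rightarrow> real) \<Rightarrow> bool" where
  "stationary z \<longleftrightarrow> impulse z T = 0 \<and> (\<forall>t\<in>{0..T}. snd z t = slope z t)"

text \<open>Equality leaves no room for either of the two squares in \<open>energy_step\<close>.\<close>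

lemma stationary_if_energy_step_eq:
  assumes z: "admissible z" and eq: "energy (step z) = energy z"
  shows "stationary z"
proof -
  define N where "N = integral {0..T} (\<lambda>t. (slope z t - snd z t)\<^sup>2)"
  have c: "continuous_on {0..T} (\<lambda>t. (slope z t - snd z t)\<^sup>2)"
    using z by (intro continuous_intros continuous_slope continuous_admissible)
  have N: "0 \<le> N"
    unfolding N_def using c by (intro integral_nonneg integrable_continuous_interval) auto
  have "rate / 4 * ((impulse z T)\<^sup>2 + N) \<le> 0"
    using energy_step[OF z] eq by (simp add: N_def)
  then have "(impulse z T)\<^sup>2 + N \<le> 0"
    using rate_bounds(1) by (simp add: mult_le_0_iff)
  with N have "(impulse z T)\<^sup>2 = 0" "N = 0"
    using zero_le_power2[of "impulse z T"] by linarith+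
  then show ?thesis
    using integral_eq_0_iff[OF c T_pos] by (auto simp: stationary_def N_def)
qed

definition slope_lipschitz :: "real \<Rightarrow> real \<times> (real \<Rightarrow> real) \<Rightarrow> bool" where
  "slope_lipschitz \<Lambda> z \<longleftrightarrow> (\<forall>s\<in>{0..T}. \<forall>t\<in>{0..T}. \<bar>snd z s - snd z t\<bar> \<le> \<Lambda> * \<bar>s - t\<bar>)"

text \<open>The new slope v = \<phi>^-1(c - H) is as Lipschitz as H, whose derivative is the force, and
the step only forms a convex combination of w and v. So a bound on x along an orbit keeps all
slopes in one equicontinuous family.\<close>

lemma slope_lipschitz_step:
  assumes z: "admissible z" and \<Lambda>: "slope_lipschitz \<Lambda> z" and B: "L * (\<bar>fst z\<bar> + T) \<le> \<Lambda>"
  shows "slope_lipschitz \<Lambda> (step z)"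
proof -
  have imp: "\<bar>impulse z t - impulse z s\<bar> \<le> \<Lambda> * \<bar>s - t\<bar>" if st: "s \<in> {0..T}" "t \<in> {0..T}" "s \<le> t" for s t
  proof -
    have "force z integrable_on {0..t}"
      using continuous_force[OF z] st by (intro integrable_continuous_interval) (auto elim: continuous_on_subset)
    then have "impulse z t - impulse z s = integral {s..t} (force z)"
      using Henstock_Kurzweil_Integration.integral_combine[of 0 s t "force z"] st by (simp add: impulse_def)
    also have "norm \<dots> \<le> \<Lambda> * (t - s)"
    proof (rule integral_bound)
      fix r assume "r \<in> {s..t}"
      then have r: "r \<in> {0..T}"
        using st by auto
      have "\<bar>force z r\<bar> \<le> L * \<bar>traj z r\<bar>"
        using lipschitz_f[OF r, of "traj z r" 0] f_0[OF r] by (simp add: force_def)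
      also have "\<dots> \<le> L * (\<bar>fst z\<bar> + T)"
        by (intro mult_left_mono abs_traj_le z r L_nonneg)
      finally show "norm (force z r) \<le> \<Lambda>"
        using B by simp
    qed (use st continuous_force[OF z] in \<open>auto elim: continuous_on_subset\<close>)
    finally show ?thesis
      using st by simp
  qed
  have imp': "\<bar>impulse z t - impulse z s\<bar> \<le> \<Lambda> * \<bar>s - t\<bar>" if "s \<in> {0..T}" "t \<in> {0..T}" for s t
    using imp[of s t] imp[of t s] that by (cases "s \<le> t") (auto simp: abs_minus_commute)
  show ?thesis
    unfolding slope_lipschitz_def
  proof (intro ballI)
    fix s t assume st: "s \<in> {0..T}" "t \<in> {0..T}"
    have "snd (step z) s - snd (step z) t = (snd z s - snd z t) + rate * ((slope z s - slope z t) - (snd z s - snd z t))"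
      by (simp add: step_def algebra_simps)
    moreover have "\<bar>slope z s - slope z t\<bar> \<le> \<Lambda> * \<bar>s - t\<bar>"
      using order_trans[OF phi_inv_lipschitz, of "balance T (impulse z) - impulse z s" "balance T (impulse z) - impulse z t"]
        imp'[OF st] by (simp add: slope_def)
    ultimately show "\<bar>snd (step z) s - snd (step z) t\<bar> \<le> \<Lambda> * \<bar>s - t\<bar>"
      using \<Lambda> st rate_bounds by (simp add: abs_convex_combination_le slope_lipschitz_def)
  qed
qed

lemma admissible_compact:
  assumes X: "\<And>n. admissible (X n)" "\<And>n. slope_lipschitz \<Lambda> (X n)" "\<And>n. \<bar>fst (X n)\<bar> \<le> B"
  obtains z k where "admissible z" "strict_mono (k :: nat \<Rightarrow> nat)" "converges (\<lambda>n. X (k n)) z"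
proof -
  obtain g k1 where g: "continuous_on {0..T} g" and k1: "strict_mono (k1 :: nat \<Rightarrow> nat)"
    and lim: "\<And>e. 0 < e \<Longrightarrow> \<exists>N. \<forall>n x. n \<ge> N \<and> x \<in> {0..T} \<longrightarrow> norm (snd (X (k1 n)) x - g x) < e"
  proof (rule Arzela_Ascoli[of "{0..T}" "\<lambda>n. snd (X n)" 1])
    fix x e :: real assume x: "x \<in> {0..T}" "0 < e"
    show "\<exists>d>0. \<forall>n y. y \<in> {0..T} \<and> norm (x - y) < d \<longrightarrow> norm (snd (X n) x - snd (X n) y) < e"
    proof (intro exI[of _ "e / (\<bar>\<Lambda>\<bar> + 1)"] conjI allI impI)
      fix n y assume y: "y \<in> {0..T} \<and> norm (x - y) < e / (\<bar>\<Lambda>\<bar> + 1)"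
      have "\<bar>snd (X n) x - snd (X n) y\<bar> \<le> \<Lambda> * \<bar>x - y\<bar>"
        using X(2) x y by (auto simp: slope_lipschitz_def)
      also have "\<dots> \<le> (\<bar>\<Lambda>\<bar> + 1) * \<bar>x - y\<bar>"
        by (intro mult_right_mono) auto
      also have "\<dots> < e"
        using y by (simp add: field_simps add_pos_nonneg)
      finally show "norm (snd (X n) x - snd (X n) y) < e"
        by simp
    qed (use x in \<open>auto simp: add_nonneg_pos\<close>)
  qed (use X(1) in \<open>auto simp: admissible_def\<close>)
  have "bounded (range (\<lambda>n. fst (X (k1 n))))"
    using X(3) by (auto simp: bounded_iff)
  from bounded_imp_convergent_subsequence[OF this]
  obtain x k2 where k2: "strict_mono (k2 :: nat \<Rightarrow> nat)" and x: "((\<lambda>n. fst (X (k1 n))) \<circ> k2) \<longlonglongrightarrow> x"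
    by blast
  define Y where "Y n = X (k1 (k2 n))" for n
  have conv: "converges Y (x, g)"
    unfolding converges_def
  proof (intro allI impI)
    fix e :: real assume e: "e > 0"
    obtain N1 where N1: "\<And>n x. n \<ge> N1 \<Longrightarrow> x \<in> {0..T} \<Longrightarrow> norm (snd (X (k1 n)) x - g x) < e"
      using lim[OF e] by blast
    obtain N2 where N2: "\<And>n. n \<ge> N2 \<Longrightarrow> norm (fst (Y n) - x) < e"
      using LIMSEQ_D[OF x e] by (auto simp: Y_def)
    have "close e (x, g) (Y n)" if "n \<ge> max N1 N2" for n
    proof -
      have "n \<le> k2 n"
        by (rule seq_suble[OF k2])
      then have "N1 \<le> k2 n" "N2 \<le> n"
        using that by auto
      with N1 N2 show ?thesis
        unfolding close_def Y_def by (fastforce simp: abs_minus_commute less_imp_le)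
    qed
    then show "\<exists>N. \<forall>n\<ge>N. close e (x, g) (Y n)"
      by blast
  qed
  have Y: "admissible (Y n)" for n
    by (simp add: Y_def X)
  have "\<bar>g t\<bar> \<le> 1" if t: "t \<in> {0..T}" for t
  proof (rule field_le_epsilon)
    fix e :: real assume "0 < e"
    with conv obtain n where "close e (x, g) (Y n)"
      unfolding converges_def by blast
    then show "\<bar>g t\<bar> \<le> 1 + e"
      using Y[of n] t by (force simp: close_def admissible_def)
  qed
  moreover have "\<bar>integral {0..T} g\<bar> \<le> 0"
  proof (rule field_le_epsilon)
    fix e :: real assume "0 < e"
    then have "e / T > 0"
      using T_pos by simp
    with conv obtain n where n: "close (e / T) (x, g) (Y n)"
      unfolding converges_def by blast
    have "\<bar>integral {0..T} g - integral {0..T} (snd (Y n))\<bar> \<le> e / T * (T - 0)"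
      using n Y[of n] T_pos g by (intro abs_integral_diff_le) (auto simp: close_def admissible_def)
    then show "\<bar>integral {0..T} g\<bar> \<le> 0 + e"
      using Y[of n] T_pos by (simp add: admissible_def)
  qed
  ultimately have "admissible (x, g)"
    using g by (simp add: admissible_def)
  with conv strict_mono_o[OF k1 k2] show thesis
    by (intro that[of "(x, g)" "k1 \<circ> k2"]) (auto simp: Y_def[abs_def] o_def)
qed

definition coercive :: bool where
  "coercive \<longleftrightarrow> (\<forall>C. \<exists>B. \<forall>z. admissible z \<and> energy z \<le> C \<longrightarrow> \<bar>fst z\<bar> \<le> B)"

text \<open>The energy decreases along the orbit to some limit. Coercivity bounds the orbit, so a subsequence
converges; its limit and the image of its limit under the step both have the limiting energy, and
strict descent away from stationary states makes the limit stationary.\<close>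

lemma orbit_limit:
  assumes coer: coercive and z: "admissible z" and lip: "slope_lipschitz \<Lambda>0 z"
    and m: "\<And>k. m \<le> energy (orbit k z)"
  obtains z' where "admissible z'" "stationary z'" "m \<le> energy z'" "energy z' \<le> energy z"
proof -
  obtain B where "\<And>z'. admissible z' \<Longrightarrow> energy z' \<le> energy z \<Longrightarrow> \<bar>fst z'\<bar> \<le> B"
    using coer unfolding coercive_def by blast
  then have B: "\<bar>fst (orbit k z)\<bar> \<le> B" for k
    using energy_orbit_antimono[OF z, of 0 k] admissible_orbit[OF z] by simp
  define \<Lambda> where "\<Lambda> = max \<Lambda>0 (L * (B + T))"
  have lips: "slope_lipschitz \<Lambda> (orbit k z)" for k
  proof (induction k)
    case 0
    have "\<Lambda>0 * \<bar>s - t\<bar> \<le> \<Lambda> * \<bar>s - t\<bar>" for s t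
      by (intro mult_right_mono) (auto simp: \<Lambda>_def)
    with lip show ?case
      unfolding slope_lipschitz_def orbit_0 by (meson order_trans)
  next
    case (Suc k)
    have "L * (\<bar>fst (orbit k z)\<bar> + T) \<le> \<Lambda>"
      unfolding \<Lambda>_def using B[of k] L_nonneg by (intro max.coboundedI2 mult_left_mono) auto
    with Suc slope_lipschitz_step admissible_orbit[OF z] show ?case
      by simp
  qed
  obtain z' k where z': "admissible z'" and k: "strict_mono (k :: nat \<Rightarrow> nat)"
    and conv: "converges (\<lambda>n. orbit (k n) z) z'"
    using admissible_compact[of "\<lambda>n. orbit n z", OF admissible_orbit[OF z] lips B] by blast
  have "decseq (\<lambda>n. energy (orbit n z))"
    unfolding decseq_def using energy_orbit_antimono[OF z] by blast
  then obtain l where l: "(\<lambda>n. energy (orbit n z)) \<longlonglongrightarrow> l"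
    using decseq_convergent[of _ m] m by blast
  have "(\<lambda>n. energy (orbit (k n) z)) \<longlonglongrightarrow> l"
    using LIMSEQ_subseq_LIMSEQ[OF l k] by (simp add: o_def)
  moreover have "(\<lambda>n. energy (orbit (k n) z)) \<longlonglongrightarrow> energy z'"
    by (intro converges_energy conv z' admissible_orbit z)
  ultimately have E: "energy z' = l"
    using LIMSEQ_unique by blast
  have "strict_mono (\<lambda>n. Suc (k n))"
    using k by (simp add: strict_mono_def)
  from LIMSEQ_subseq_LIMSEQ[OF l this] have "(\<lambda>n. energy (step (orbit (k n) z))) \<longlonglongrightarrow> l"
    by (simp add: o_def)
  moreover have "(\<lambda>n. energy (step (orbit (k n) z))) \<longlonglongrightarrow> energy (step z')"
    by (intro converges_energy converges_step conv z' admissible_orbit z admissible_step)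
  ultimately have "energy (step z') = energy z'"
    using LIMSEQ_unique E by blast
  with z' have "stationary z'"
    by (rule stationary_if_energy_step_eq)
  moreover have "m \<le> energy z'"
    using m unfolding E by (intro LIMSEQ_le_const[OF l]) auto
  moreover have "energy z' \<le> energy z"
    unfolding E using energy_orbit_antimono[OF z, of 0] by (intro LIMSEQ_le_const2[OF l]) auto
  ultimately show thesis
    using z' that by blast
qed

end

section \<open>The mountain pass\<close>

context forcing
begin

definition peak :: "real \<times> (real \<Rightarrow> real) \<Rightarrow> real" where
  "peak z = Sup (traj z ` {0..T})"

lemma peak_attained:
  assumes "admissible z"
  obtains t where "t \<in> {0..T}" "traj z t = peak z" "\<And>s. s \<in> {0..T} \<Longrightarrow> traj z s \<le> peak z"
proof -
  obtain t where t: "t \<in> {0..T}" "\<And>s. s \<in> {0..T} \<Longrightarrow> traj z s \<le> traj z t"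
    using continuous_attains_sup[OF compact_Icc _ continuous_traj[OF assms]] T_pos by auto
  then have "peak z = traj z t"
    unfolding peak_def by (intro cSup_eq_maximum) auto
  with t that show thesis
    by simp
qed

lemma close_peak:
  assumes "close e z z'" "admissible z" "admissible z'"
  shows "\<bar>peak z - peak z'\<bar> \<le> (1 + T) * e"
proof -
  obtain t where t: "t \<in> {0..T}" "traj z t = peak z" "\<And>s. s \<in> {0..T} \<Longrightarrow> traj z s \<le> peak z"
    using assms by (auto elim: peak_attained)
  obtain t' where t': "t' \<in> {0..T}" "traj z' t' = peak z'" "\<And>s. s \<in> {0..T} \<Longrightarrow> traj z' s \<le> peak z'"
    using assms by (auto elim: peak_attained)
  show ?thesis
    using close_traj[OF assms t(1)] close_traj[OF assms t'(1)] t(2) t'(2) t(3)[OF t'(1)] t'(3)[OF t(1)] by linarith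
qed

definition ray :: "real \<times> (real \<Rightarrow> real) \<Rightarrow> real \<Rightarrow> real \<times> (real \<Rightarrow> real)" where
  "ray z s = (s * fst z, \<lambda>t. s * snd z t)"

lemma ray_1 [simp]: "ray z 1 = z"
  by (simp add: ray_def)

lemma admissible_ray:
  assumes "admissible z" "s \<in> {0..1}"
  shows "admissible (ray z s)"
proof -
  have "\<bar>s * snd z t\<bar> \<le> 1" if "t \<in> {0..T}" for t
    using assms that mult_mono[of s 1 "\<bar>snd z t\<bar>" 1] by (auto simp: admissible_def abs_mult)
  with assms show ?thesis
    by (auto simp: admissible_def ray_def intro!: continuous_intros)
qed

lemma slope_lipschitz_ray:
  assumes "slope_lipschitz \<Lambda> z" "s \<in> {0..1}"
  shows "slope_lipschitz \<Lambda> (ray z s)"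
  unfolding slope_lipschitz_def
proof (intro ballI)
  fix r t assume rt: "r \<in> {0..T}" "t \<in> {0..T}"
  have "\<bar>s * (snd z r - snd z t)\<bar> \<le> 1 * \<bar>snd z r - snd z t\<bar>"
    unfolding abs_mult using assms(2) by (intro mult_right_mono) auto
  also have "\<dots> \<le> \<Lambda> * \<bar>r - t\<bar>"
    using assms(1) rt by (simp add: slope_lipschitz_def)
  finally show "\<bar>snd (ray z s) r - snd (ray z s) t\<bar> \<le> \<Lambda> * \<bar>r - t\<bar>"
    by (simp add: ray_def algebra_simps)
qed

lemma close_ray:
  assumes "admissible z"
  shows "close ((1 + \<bar>fst z\<bar>) * \<bar>s - s'\<bar>) (ray z s) (ray z s')"
  unfolding close_def
proof (intro conjI ballI)
  have "\<bar>fst (ray z s) - fst (ray z s')\<bar> = \<bar>fst z\<bar> * \<bar>s - s'\<bar>"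
    unfolding abs_mult[symmetric] by (simp add: ray_def algebra_simps)
  also have "\<dots> \<le> (1 + \<bar>fst z\<bar>) * \<bar>s - s'\<bar>"
    by (intro mult_right_mono) auto
  finally show "\<bar>fst (ray z s) - fst (ray z s')\<bar> \<le> (1 + \<bar>fst z\<bar>) * \<bar>s - s'\<bar>" .
  fix t assume t: "t \<in> {0..T}"
  have "\<bar>snd z t\<bar> \<le> 1 + \<bar>fst z\<bar>"
    using assms t by (force simp: admissible_def)
  then have "\<bar>snd z t\<bar> * \<bar>s - s'\<bar> \<le> (1 + \<bar>fst z\<bar>) * \<bar>s - s'\<bar>"
    by (intro mult_right_mono) auto
  moreover have "\<bar>snd (ray z s) t - snd (ray z s') t\<bar> = \<bar>snd z t\<bar> * \<bar>s - s'\<bar>"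
    unfolding abs_mult[symmetric] by (simp add: ray_def algebra_simps)
  ultimately show "\<bar>snd (ray z s) t - snd (ray z s') t\<bar> \<le> (1 + \<bar>fst z\<bar>) * \<bar>s - s'\<bar>"
    by simp
qed

lemma close_orbit:
  assumes "close e z z'" "admissible z" "admissible z'"
  shows "close (step_const ^ k * e) (orbit k z) (orbit k z')"
proof (induction k)
  case (Suc k)
  from close_step[OF this] show ?case
    using assms by (simp add: admissible_orbit mult_ac)
qed (use assms in simp)

text \<open>The zero state is stationary, so its orbit stays at zero.\<close>

lemma peak_orbit_ray_0:
  assumes z: "admissible z"
  shows "peak (orbit k (ray z 0)) = 0"
proof -
  define o0 :: "real \<times> (real \<Rightarrow> real)" where "o0 = (0, \<lambda>t. 0)"
  have r0: "ray z 0 = o0"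
    by (simp add: ray_def o0_def)
  have adm: "admissible o0"
    using admissible_ray[OF z, of 0] by (simp add: r0)
  have tr: "traj o0 t = 0" for t
    by (simp add: traj_def o0_def)
  have imp: "impulse o0 t = 0" if "t \<in> {0..T}" for t
  proof -
    have "impulse o0 t = integral {0..t} (\<lambda>s. 0)"
      unfolding impulse_def using that by (intro integral_cong) (auto simp: force_def tr f_0)
    then show ?thesis
      by simp
  qed
  have "balanced T (impulse o0) 0"
  proof -
    have "integral {0..T} (\<lambda>t. phi_inv (0 - impulse o0 t)) = integral {0..T} (\<lambda>t. 0)"
      by (rule integral_cong) (simp add: imp)
    then show ?thesis
      by (simp add: balanced_def)
  qed
  moreover have "balanced T (impulse o0) (balance T (impulse o0))"
    by (intro balanced_balance T_pos continuous_impulse adm)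
  ultimately have "balance T (impulse o0) = 0"
    using balanced_le[OF T_pos continuous_impulse[OF adm] continuous_impulse[OF adm], of _ _ 0]
    by (metis add.right_neutral order_antisym order_refl)
  then have "slope o0 t = 0" if "t \<in> {0..T}" for t
    using imp[OF that] by (simp add: slope_def)
  then have fix0: "close 0 (step o0) o0"
    using imp[of T] T_pos by (simp add: close_def step_def o0_def)
  have "close 0 (orbit k o0) o0"
  proof (induction k)
    case (Suc k)
    have "close 0 (step (orbit k o0)) (step o0)"
      using close_step[OF Suc admissible_orbit[OF adm] adm] by simp
    with fix0 show ?case
      by (fastforce simp: close_def)
  qed (simp add: close_def)
  then have "\<bar>peak (orbit k o0) - peak o0\<bar> \<le> (1 + T) * 0"
    by (rule close_peak) (use adm admissible_orbit in auto)
  moreover have "peak o0 = 0"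
    using adm by (rule peak_attained) (simp add: tr)
  ultimately show ?thesis
    by (simp add: r0)
qed

text \<open>For each k the segment from 0 to z, moved k times by the step, contains a point on the level
\<open>peak = r\<close>. Energies decrease along orbits, so the orbit of the parameter \<sigma>_k
producing that point has energy at least c up to time k. Every accumulation point of the
\<sigma>_k therefore starts an orbit that stays above c forever, and \<open>orbit_limit\<close> applies.\<close>

lemma mountain_pass:
  assumes coer: coercive and z: "admissible z" and lip: "slope_lipschitz \<Lambda> z" and neg: "energy z < 0"
    and "0 < r"
    and low: "\<And>y. admissible y \<Longrightarrow> peak y \<le> r \<Longrightarrow> 0 \<le> energy y"
    and barrier: "\<And>y. admissible y \<Longrightarrow> peak y = r \<Longrightarrow> c \<le> energy y"
  obtains y where "admissible y" "stationary y" "c \<le> energy y"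
proof -
  define K where "K k = step_const ^ k * (1 + \<bar>fst z\<bar>)" for k
  have K: "K k \<ge> 0" for k
    unfolding K_def using step_const_pos by (intro mult_nonneg_nonneg) auto
  have adm: "admissible (orbit k (ray z s))" if "s \<in> {0..1}" for k s
    using admissible_ray[OF z that] by (rule admissible_orbit)
  have close: "close (K k * \<bar>s - s'\<bar>) (orbit k (ray z s)) (orbit k (ray z s'))"
    if "s \<in> {0..1}" "s' \<in> {0..1}" for k s s'
    using close_orbit[OF close_ray[OF z] admissible_ray[OF z that(1)] admissible_ray[OF z that(2)], of k]
    by (simp add: K_def mult.assoc)
  have "\<exists>s\<in>{0..1}. peak (orbit k (ray z s)) = r" for k
  proof -
    have "((1 + T) * K k)-lipschitz_on {0..1} (\<lambda>s. peak (orbit k (ray z s)))"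
      using close_peak[OF close adm adm] T_pos K
      by (intro lipschitz_onI) (auto simp: dist_real_def mult.assoc)
    then have "continuous_on {0..1} (\<lambda>s. peak (orbit k (ray z s)))"
      by (rule lipschitz_on_continuous_on)
    moreover have "peak (orbit k (ray z 0)) \<le> r"
      using peak_orbit_ray_0[OF z] \<open>0 < r\<close> by simp
    moreover have "r \<le> peak (orbit k (ray z 1))"
    proof (rule ccontr)
      assume "\<not> ?thesis"
      then have "0 \<le> energy (orbit k z)"
        using low[OF admissible_orbit[OF z]] by simp
      with neg energy_orbit_antimono[OF z, of 0 k] show False
        by simp
    qed
    ultimately show ?thesis
      using IVT'[of "\<lambda>s. peak (orbit k (ray z s))" 0 r 1] by auto
  qed
  then obtain \<sigma> where \<sigma>: "\<And>k. \<sigma> k \<in> {0..1}" "\<And>k. peak (orbit k (ray z (\<sigma> k))) = r"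
    by metis
  have high: "c \<le> energy (orbit j (ray z (\<sigma> k)))" if "j \<le> k" for j k
    using barrier[OF adm[OF \<sigma>(1)] \<sigma>(2)] energy_orbit_antimono[OF admissible_ray[OF z \<sigma>(1)] that]
    by (rule order_trans)
  obtain s k where s: "s \<in> {0..1}" and k: "strict_mono (k :: nat \<Rightarrow> nat)" and lim: "(\<sigma> \<circ> k) \<longlonglongrightarrow> s"
    using compact_imp_seq_compact[OF compact_Icc, THEN seq_compactE, of \<sigma> 0 1] \<sigma>(1) by metis
  have "c \<le> energy (orbit j (ray z s))" for j
  proof -
    have "converges (\<lambda>n. orbit j (ray z (\<sigma> (k n)))) (orbit j (ray z s))"
      unfolding converges_def
    proof (intro allI impI)
      fix e :: real assume "e > 0"
      then have "e / (K j + 1) > 0"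
        using K[of j] by (simp add: add_nonneg_pos)
      from LIMSEQ_D[OF lim this] obtain N where N: "\<And>n. n \<ge> N \<Longrightarrow> \<bar>\<sigma> (k n) - s\<bar> < e / (K j + 1)"
        by auto
      have "close e (orbit j (ray z s)) (orbit j (ray z (\<sigma> (k n))))" if "n \<ge> N" for n
      proof (rule close_mono[OF close[OF s \<sigma>(1)]])
        have "K j * \<bar>s - \<sigma> (k n)\<bar> \<le> (K j + 1) * (e / (K j + 1))"
          using N[OF that] K[of j] by (intro mult_mono) (auto simp: abs_minus_commute)
        also have "\<dots> = e"
          using K[of j] by (simp add: add_nonneg_eq_0_iff)
        finally show "K j * \<bar>s - \<sigma> (k n)\<bar> \<le> e" .
      qed
      then show "\<exists>N. \<forall>n\<ge>N. close e (orbit j (ray z s)) (orbit j (ray z (\<sigma> (k n))))"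
        by blast
    qed
    then have "(\<lambda>n. energy (orbit j (ray z (\<sigma> (k n))))) \<longlonglongrightarrow> energy (orbit j (ray z s))"
      by (intro converges_energy adm s \<sigma>)
    moreover have "c \<le> energy (orbit j (ray z (\<sigma> (k n))))" if "n \<ge> j" for n
      using high[of j "k n"] seq_suble[OF k, of n] that by simp
    ultimately show ?thesis
      by (intro LIMSEQ_le_const) auto
  qed
  with orbit_limit[OF coer admissible_ray[OF z s] slope_lipschitz_ray[OF lip s]] that show thesis
    by blast
qed

end

section \<open>Stationary states as periodic solutions of a planar system\<close>

lemma periodic_add_int:
  fixes u :: "real \<Rightarrow> 'a"
  assumes "\<And>t. u (t + T) = u t"
  shows "u (t + of_int n * T) = u t"
proof -
  have nat: "u (t + real k * T) = u t" for t k
  proof (induction k)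
    case (Suc k)
    have "u (t + real (Suc k) * T) = u (t + real k * T + T)"
      by (simp add: algebra_simps)
    with Suc assms show ?case
      by simp
  qed simp
  show ?thesis
  proof (cases "n \<ge> 0")
    case True
    then show ?thesis
      using nat[of t "nat n"] by simp
  next
    case False
    then show ?thesis
      using nat[of "t + of_int n * T" "nat (- n)"] by simp
  qed
qed

lemma reduce_mod_period:
  fixes T :: real
  assumes "0 < T"
  obtains n s where "t = s + of_int n * T" "0 \<le> s" "s < T"
proof (rule that[of "t - of_int \<lfloor>t / T\<rfloor> * T" "\<lfloor>t / T\<rfloor>"])
  have "of_int \<lfloor>t / T\<rfloor> * T \<le> t"
    using of_int_floor_le[of "t / T"] by (simp only: pos_le_divide_eq[OF assms])
  moreover have "t < (of_int \<lfloor>t / T\<rfloor> + 1) * T"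
    using floor_correct[of "t / T"] by (simp only: pos_divide_less_eq[OF assms] of_int_add of_int_1)
  ultimately show "0 \<le> t - of_int \<lfloor>t / T\<rfloor> * T" "t - of_int \<lfloor>t / T\<rfloor> * T < T"
    by (auto simp: algebra_simps)
qed simp

lemma periodic_extension:
  fixes u :: "real \<Rightarrow> real"
  assumes T: "0 < T" and u: "continuous_on {0..T} u" and eq: "u T = u 0"
  obtains U where "continuous_on UNIV U" "\<And>t. U (t + T) = U t" "\<And>t. t \<in> {0..T} \<Longrightarrow> U t = u t"
proof -
  define U where "U t = u (t - of_int \<lfloor>t / T\<rfloor> * T)" for t
  have per: "U (t + T) = U t" for t
  proof -
    have "(t + T) / T = t / T + 1"
      using T by (simp add: field_simps)
    then have "\<lfloor>(t + T) / T\<rfloor> = \<lfloor>t / T\<rfloor> + 1"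
      by simp
    then show ?thesis
      by (simp add: U_def algebra_simps)
  qed
  have U0: "U t = u t" if "t \<in> {0..T}" for t
  proof (cases "t = T")
    case True
    then show ?thesis
      using T eq by (simp add: U_def)
  next
    case False
    then have "\<lfloor>t / T\<rfloor> = 0"
      using that T by (intro floor_unique) auto
    then show ?thesis
      by (simp add: U_def)
  qed
  have Um: "U t = u (t + T)" if "t \<in> {-T..0}" for t
    using per[of t] U0[of "t + T"] that by simp
  have "continuous_on ({-T..0} \<union> {0..T}) U"
  proof (rule continuous_on_closed_Un)
    have "continuous_on {-T..0} (\<lambda>t. u (t + T))"
      by (rule continuous_on_compose2[OF u]) (auto intro!: continuous_intros)
    then show "continuous_on {-T..0} U"
      by (rule continuous_on_eq) (simp add: Um)
    show "continuous_on {0..T} U"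
      using u by (rule continuous_on_eq) (simp add: U0)
  qed auto
  then have "continuous_on {-T<..<T} U"
    by (rule continuous_on_subset) auto
  then have near: "isCont U s" if "0 \<le> s" "s < T" for s
    using that T by (intro continuous_on_interior[of "{-T<..<T}"]) (auto simp: interior_open)
  have "isCont U t" for t
  proof -
    obtain n s where s: "t = s + of_int n * T" "0 \<le> s" "s < T"
      by (rule reduce_mod_period[OF T])
    have "U = (\<lambda>r. U (r - of_int n * T))"
      using periodic_add_int[of U T _ "-n", OF per] by auto
    moreover have "isCont (\<lambda>r. U (r - of_int n * T)) t"
      using near[OF s(2,3)] s(1) by (intro isCont_o2[where f = "\<lambda>r. r - of_int n * T" and g = U]) auto
    ultimately show ?thesis
      by metis
  qed
  with per U0 that show thesis
    by (auto simp: continuous_on_eq_continuous_at)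
qed

lemma antiderivative_real:
  fixes h :: "real \<Rightarrow> real"
  assumes "continuous_on UNIV h"
  obtains H where "\<And>t. (H has_real_derivative h t) (at t)" "H 0 = 0"
proof -
  have "isCont h x" for x
    using assms by (simp add: continuous_on_eq_continuous_at)
  then obtain F where F: "\<And>x. (F has_vector_derivative h x) (at x)"
    using einterval_antiderivative[of "-\<infinity>" "\<infinity>" h] by auto
  show thesis
  proof (rule that[of "\<lambda>t. F t - F 0"])
    show "((\<lambda>t. F t - F 0) has_real_derivative h t) (at t)" for t
      using DERIV_diff[OF F[of t, folded has_real_derivative_iff_has_vector_derivative] DERIV_const[of "F 0"]] by simp
  qed simp
qed

lemma integral_of_derivative:
  fixes H h :: "real \<Rightarrow> real"
  assumes "a \<le> b" "\<And>t. t \<in> {a..b} \<Longrightarrow> (H has_real_derivative h t) (at t)"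
  shows "(h has_integral (H b - H a)) {a..b}"
  using assms by (intro fundamental_theorem_of_calculus)
    (auto simp: has_real_derivative_iff_has_vector_derivative[symmetric] intro: has_field_derivative_at_within)

text \<open>Used twice below: it recovers the momentum from a periodic force and the position from a periodic
velocity.\<close>

lemma periodic_antiderivative:
  fixes h :: "real \<Rightarrow> real"
  assumes T: "0 < T" and h: "continuous_on UNIV h" and per: "\<And>t. h (t + T) = h t" and int: "integral {0..T} h = 0"
  obtains H where "\<And>t. (H has_real_derivative h t) (at t)" "\<And>t. H (t + T) = H t"
    "\<And>t. 0 \<le> t \<Longrightarrow> H t = integral {0..t} h"
proof -
  obtain H where H: "\<And>t. (H has_real_derivative h t) (at t)" "H 0 = 0"
    using h by (rule antiderivative_real) blast
  have Hint: "H t = integral {0..t} h" if "0 \<le> t" for t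
    using integral_of_derivative[OF that H(1)] H(2) by (simp add: integral_unique)
  have "((\<lambda>t. H (t + T) - H t) has_real_derivative 0) (at t)" for t
    using DERIV_diff[OF DERIV_shift[THEN iffD1, OF H(1)[of "t + T"]] H(1)[of t]] per[of t] by simp
  then have "H (t + T) - H t = H (0 + T) - H 0" for t
    using DERIV_isconst_all[of "\<lambda>t. H (t + T) - H t" t 0] by blast
  moreover have "H T = 0"
    using Hint[of T] T int by simp
  ultimately have "H (t + T) = H t" for t
    using H(2) by simp
  with H Hint that show thesis
    by blast
qed

context forcing
begin

text \<open>The momentum y = c - H and the position v solve the planar system
v' = \<phi>^-1(y), y' = -f(t, v) on the whole line: on [0, T] this is stationarity, and
periodicity carries it over.\<close>

lemma stationary_imp_periodic_system:
  assumes z: "admissible z" and st: "stationary z"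
    and cont: "\<And>u. continuous_on UNIV u \<Longrightarrow> continuous_on UNIV (\<lambda>t. f t (u t))"
    and per: "\<And>t s. f (t + T) s = f t s"
  obtains v y where "\<And>t. (v has_real_derivative phi_inv (y t)) (at t)"
    "\<And>t. (y has_real_derivative - f t (v t)) (at t)"
    "\<And>t. v (t + T) = v t" "\<And>t. y (t + T) = y t"
    "\<And>t. t \<in> {0..T} \<Longrightarrow> v t = traj z t" "\<And>t. t \<in> {0..T} \<Longrightarrow> snd z t = phi_inv (y t)"
proof -
  have "traj z T = traj z 0"
    using z by (simp add: traj_def admissible_def)
  then obtain U where U: "continuous_on UNIV U" "\<And>t. U (t + T) = U t" "\<And>t. t \<in> {0..T} \<Longrightarrow> U t = traj z t"
    using periodic_extension[OF T_pos continuous_traj[OF z]] by metis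
  define h where "h t = f t (U t)" for t
  have h0: "integral {0..t} h = impulse z t" if "t \<in> {0..T}" for t
    unfolding impulse_def using that by (intro integral_cong) (auto simp: h_def force_def U(3))
  have "continuous_on UNIV h" "h (t + T) = h t" "integral {0..T} h = 0" for t
    using cont[OF U(1)] U(2) per st h0[of T] T_pos by (auto simp: h_def[abs_def] stationary_def)
  then obtain H where H: "\<And>t. (H has_real_derivative h t) (at t)" "\<And>t. H (t + T) = H t"
    "\<And>t. 0 \<le> t \<Longrightarrow> H t = integral {0..t} h"
    using periodic_antiderivative[OF T_pos, of h] by metis
  define y where "y t = balance T (impulse z) - H t" for t
  have y': "(y has_real_derivative - h t) (at t)" for t
    unfolding y_def using DERIV_diff[OF DERIV_const[of "balance T (impulse z)"] H(1)[of t]] by simp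
  define w where "w t = phi_inv (y t)" for t
  have cy: "continuous_on UNIV y"
    using y' by (intro DERIV_continuous_on) (auto intro: has_field_derivative_at_within)
  have w: "w t = snd z t" if "t \<in> {0..T}" for t
    using st that H(3)[of t] h0[OF that] by (simp add: w_def y_def stationary_def slope_def)
  then have w0: "integral {0..t} w = integral {0..t} (snd z)" if "t \<in> {0..T}" for t
    using that by (intro integral_cong) auto
  have "continuous_on UNIV w" "w (t + T) = w t" "integral {0..T} w = 0" for t
    using w0[of T] T_pos z H(2)
    by (auto simp: w_def[abs_def] y_def admissible_def intro!: continuous_on_phi_inv cy[unfolded y_def[abs_def]])
  then obtain W where W: "\<And>t. (W has_real_derivative w t) (at t)" "\<And>t. W (t + T) = W t"
    "\<And>t. 0 \<le> t \<Longrightarrow> W t = integral {0..t} w"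
    using periodic_antiderivative[OF T_pos, of w] by metis
  define v where "v t = fst z + W t" for t
  have v0: "v t = traj z t" if "t \<in> {0..T}" for t
    using that w0[OF that] W(3)[of t] by (simp add: v_def traj_def)
  have vper: "v (t + T) = v t" for t
    by (simp add: v_def W(2))
  have vU: "v t = U t" for t
  proof -
    obtain n s where s: "t = s + of_int n * T" "0 \<le> s" "s < T"
      by (rule reduce_mod_period[OF T_pos])
    then show ?thesis
      using periodic_add_int[of v T s n, OF vper] periodic_add_int[of U T s n, OF U(2)] v0[of s] U(3)[of s] by simp
  qed
  show thesis
  proof (rule that[OF _ _ vper _ v0])
    show "(v has_real_derivative phi_inv (y t)) (at t)" for t
      unfolding v_def using DERIV_add[OF DERIV_const[of "fst z"] W(1)[of t]] by (simp add: w_def)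
    show "(y has_real_derivative - f t (v t)) (at t)" for t
      using y'[of t] by (simp add: h_def vU)
    show "y (t + T) = y t" for t
      by (simp add: y_def H(2))
    show "snd z t = phi_inv (y t)" if "t \<in> {0..T}" for t
      using w[OF that] by (simp add: w_def)
  qed
qed

end

lemma periodic_attains_min:
  fixes v :: "real \<Rightarrow> real"
  assumes T: "0 < T" and v: "continuous_on UNIV v" and per: "\<And>t. v (t + T) = v t"
  obtains t0 where "t0 \<in> {0..T}" "\<And>t. v t0 \<le> v t"
proof -
  obtain t0 where t0: "t0 \<in> {0..T}" "\<And>t. t \<in> {0..T} \<Longrightarrow> v t0 \<le> v t"
    using continuous_attains_inf[of "{0..T}" v] continuous_on_subset[OF v, of "{0..T}"] T by auto
  have "v t0 \<le> v t" for t
  proof -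
    obtain n s where s: "t = s + of_int n * T" "0 \<le> s" "s < T"
      by (rule reduce_mod_period[OF T])
    then show ?thesis
      using periodic_add_int[of v T s n, OF per] t0(2)[of s] by simp
  qed
  with t0 that show thesis
    by blast
qed

text \<open>At a minimum of v the momentum is zero. If the minimum were negative, y would decrease just after
it, and then so would v. If the minimum is zero, both components vanish there, and uniqueness for
the Lipschitz system forces v to vanish identically.\<close>

lemma periodic_system_positive:
  fixes f :: "real \<Rightarrow> real \<Rightarrow> real"
  assumes T: "0 < T"
    and v': "\<And>t. (v has_real_derivative phi_inv (y t)) (at t)"
    and y': "\<And>t. (y has_real_derivative - f t (v t)) (at t)"
    and per: "\<And>t. v (t + T) = v t"
    and neg: "\<And>t s. s < 0 \<Longrightarrow> 0 < f t s"
    and lip: "\<And>t s. \<bar>f t s\<bar> \<le> K * \<bar>s\<bar>"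
    and nz: "\<exists>t. v t \<noteq> 0"
  shows "0 < v t"
proof -
  have cv: "continuous_on UNIV v"
    using v' by (intro DERIV_continuous_on) (auto intro: has_field_derivative_at_within)
  obtain t0 where t0: "\<And>t. v t0 \<le> v t"
    using periodic_attains_min[OF T cv per] by metis
  have "phi_inv (y t0) = 0"
    by (rule DERIV_local_min[OF v'[of t0], of 1]) (use t0 in auto)
  then have y0: "y t0 = 0"
    using phi_phi_inv[of "y t0"] by simp
  have nonneg: "0 \<le> v t0"
  proof (rule ccontr)
    assume "\<not> ?thesis"
    then have vneg: "v t0 < 0"
      by simp
    have "isCont v t0"
      using cv by (simp add: continuous_on_eq_continuous_at)
    then have "\<forall>\<^sub>F t in at t0. v t < 0"
      using order_tendstoD(2)[of v "v t0" "at t0" 0] vneg by (simp add: isCont_def)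
    then obtain d where d: "d > 0" "\<And>t. t \<noteq> t0 \<Longrightarrow> dist t t0 < d \<Longrightarrow> v t < 0"
      unfolding eventually_at by auto
    have vn: "v t < 0" if "t0 \<le> t" "t < t0 + d" for t
      using d(2)[of t] vneg that by (cases "t = t0") (auto simp: dist_real_def)
    have yneg: "y t < 0" if "t0 < t" "t < t0 + d" for t
    proof -
      have "y t < y t0"
      proof (rule DERIV_neg_imp_decreasing[OF that(1)])
        fix x assume x: "t0 \<le> x" "x \<le> t"
        then have "v x < 0"
          using vn that by simp
        then show "\<exists>z. (y has_real_derivative z) (at x) \<and> z < 0"
          using y'[of x] neg[of "v x" x] by (intro exI[of _ "- f x (v x)"]) auto
      qed
      then show ?thesis
        using y0 by simp
    qed
    have "v (t0 + d / 2) < v t0"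
    proof (rule DERIV_neg_imp_decreasing_open[of t0 "t0 + d / 2" v])
      show "t0 < t0 + d / 2"
        using d by simp
      show "\<exists>z. (v has_real_derivative z) (at x) \<and> z < 0" if "t0 < x" "x < t0 + d / 2" for x
        using v'[of x] phi_inv_strict_mono[of "y x" 0] yneg[of x] that d by (intro exI[of _ "phi_inv (y x)"]) auto
    qed (use cv in \<open>auto elim: continuous_on_subset\<close>)
    with t0[of "t0 + d / 2"] show False
      by simp
  qed
  moreover have "v t0 \<noteq> 0"
  proof
    assume v0: "v t0 = 0"
    have K: "0 \<le> K"
      using lip[of 0 1] by simp
    \<comment> \<open>Gronwall: the squared norm of (v, y) grows at most at rate 1 + K, so E does not increase.\<close>
    define E where "E t = ((v t)\<^sup>2 + (y t)\<^sup>2) * exp (- (1 + K) * t)" for t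
    have E: "E t \<le> 0" if "t0 \<le> t" for t
    proof -
      have "E t \<le> E t0"
      proof (rule DERIV_nonpos_imp_nonincreasing[OF that])
        fix x
        define e where "e = 2 * v x * phi_inv (y x) - 2 * y x * f x (v x) - (1 + K) * ((v x)\<^sup>2 + (y x)\<^sup>2)"
        have "(E has_real_derivative e * exp (- (1 + K) * x)) (at x)"
          unfolding E_def e_def
          by (rule derivative_eq_intros v' y' refl)+ (simp add: algebra_simps)
        moreover have "e \<le> 0"
        proof -
          have a: "2 * (\<bar>v x\<bar> * \<bar>y x\<bar>) \<le> (v x)\<^sup>2 + (y x)\<^sup>2"
            using sum_squares_bound[of "\<bar>v x\<bar>" "\<bar>y x\<bar>"] by simp
          have "v x * phi_inv (y x) \<le> \<bar>v x\<bar> * \<bar>y x\<bar>"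
            using abs_ge_self[of "v x * phi_inv (y x)"] mult_left_mono[OF abs_phi_inv_le[of "y x"], of "\<bar>v x\<bar>"]
            by (simp add: abs_mult)
          moreover have "- (y x * f x (v x)) \<le> K * (\<bar>v x\<bar> * \<bar>y x\<bar>)"
            using abs_ge_minus_self[of "y x * f x (v x)"] mult_left_mono[OF lip[of x "v x"], of "\<bar>y x\<bar>"]
            by (simp add: abs_mult mult_ac)
          moreover have "K * (2 * (\<bar>v x\<bar> * \<bar>y x\<bar>)) \<le> K * ((v x)\<^sup>2 + (y x)\<^sup>2)"
            by (rule mult_left_mono[OF a K])
          ultimately show ?thesis
            using a by (simp add: e_def algebra_simps)
        qed
        ultimately show "\<exists>z. (E has_real_derivative z) (at x) \<and> z \<le> 0"
          by (intro exI[of _ "e * exp (- (1 + K) * x)"]) (auto intro: mult_nonpos_nonneg)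
      qed
      then show ?thesis
        by (simp add: E_def v0 y0)
    qed
    have after: "v t = 0" if "t0 \<le> t" for t
    proof -
      have "(v t)\<^sup>2 + (y t)\<^sup>2 \<le> 0"
        using E[OF that] by (simp add: E_def mult_le_0_iff not_le[symmetric])
      then have "(v t)\<^sup>2 = 0"
        using zero_le_power2[of "v t"] zero_le_power2[of "y t"] by linarith
      then show ?thesis
        by simp
    qed
    have "v t = 0" for t
    proof -
      obtain n :: nat where "(t0 - t) / T \<le> real n"
        using real_arch_simple by blast
      then have "t0 \<le> t + of_int (int n) * T"
        using T by (simp add: field_simps)
      then show ?thesis
        using after periodic_add_int[of v T t "int n", OF per] by metis
    qed
    with nz show False
      by blast
  qed
  ultimately show ?thesis
    using t0[of t] by linarith
qed

section \<open>Absolutely continuous functions\<close>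

text \<open>A gauge argument. Off the null set N the derivative makes every short tagged interval contribute an
error proportional to its length. Intervals tagged in N are forced into an open set of small measure,
where absolute continuity bounds the total variation of y over them.\<close>

lemma fundamental_theorem_of_calculus_absolutely_continuous:
  fixes y k :: "real \<Rightarrow> real"
  assumes ac: "absolutely_continuous_fun_on y {c..d}" and cd: "c \<le> d" and N: "negligible N"
    and deriv: "\<And>t. t \<in> {c..d} - N \<Longrightarrow> (y has_real_derivative k t) (at t)"
  shows "(k has_integral (y d - y c)) {c..d}"
proof -
  define k' where "k' t = (if t \<in> N then 0 else k t)" for t
  have "(k' has_integral (y d - y c)) {c..d}"
    unfolding has_integral_real
  proof (intro allI impI)
    fix e :: real assume e: "e > 0"
    define \<epsilon> where "\<epsilon> = e / (2 * (d - c + 1))"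
    have \<epsilon>: "\<epsilon> > 0" "\<epsilon> * (d - c) < e / 2"
      using e cd by (auto simp: \<epsilon>_def field_simps)
    obtain \<delta> where \<delta>: "\<delta> > 0" and small: "\<And>(n::nat) (x::nat \<Rightarrow> real) y'. \<lbrakk>\<forall>i<n. x i \<le> y' i \<and> {x i..y' i} \<subseteq> {c..d};
        disjoint_family_on (\<lambda>i. {x i<..<y' i}) {..<n}; (\<Sum>i<n. y' i - x i) < \<delta>\<rbrakk>
        \<Longrightarrow> (\<Sum>i<n. \<bar>y (y' i) - y (x i)\<bar>) < e / 2"
      using ac[unfolded absolutely_continuous_fun_on_def, rule_format, of "e / 2"] e by auto
    obtain U where U: "open U" "N \<subseteq> U" "U - N \<in> lmeasurable" "emeasure lebesgue (U - N) < ennreal \<delta>"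
      using sets_lebesgue_outer_open[of N \<delta>] \<delta> N by (auto simp: negligible_iff_null_sets)
    have null: "N \<in> null_sets lebesgue"
      using N by (simp add: negligible_iff_null_sets)
    have "emeasure lebesgue U = emeasure lebesgue (U - N)"
      using emeasure_Diff_null_set[OF null, of U] U(1) by (simp add: borel_open)
    then have mU: "U \<in> lmeasurable" "measure lebesgue U < \<delta>"
      using U \<delta> by (auto simp: fmeasurable_def measure_def enn2real_less_iff borel_open)
    have "\<exists>r>0. \<forall>s. \<bar>s - t\<bar> < r \<longrightarrow> \<bar>y s - y t - k' t * (s - t)\<bar> \<le> \<epsilon> * \<bar>s - t\<bar>"
      if "t \<in> {c..d} - N" for t
    proof -
      have "(y has_derivative (*) (k' t)) (at t)"
        using deriv[OF that] that by (simp add: k'_def has_field_derivative_def)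
      with \<epsilon>(1) show ?thesis
        unfolding has_derivative_at_alt by (auto simp: mult.commute)
    qed
    then obtain r where r: "\<And>t. t \<in> {c..d} - N \<Longrightarrow> r t > 0"
        "\<And>t s. \<lbrakk>t \<in> {c..d} - N; \<bar>s - t\<bar> < r t\<rbrakk> \<Longrightarrow> \<bar>y s - y t - k' t * (s - t)\<bar> \<le> \<epsilon> * \<bar>s - t\<bar>"
      by metis
    \<comment> \<open>On N the gauge is all of U: an interval tagged there only has to stay inside U.\<close>
    define \<gamma> where "\<gamma> t = (if t \<in> N then U else if t \<in> {c..d} then ball t (r t) else UNIV)" for t
    have "gauge \<gamma>"
      using U r(1) by (auto simp: gauge_def \<gamma>_def)
    moreover have "norm ((\<Sum>(x, K)\<in>D. measure lborel K *\<^sub>R k' x) - (y d - y c)) < e"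
      if D: "D tagged_division_of {c..d} \<and> \<gamma> fine D" for D
    proof -
      have tD: "D tagged_division_of {c..d}" and fine: "\<gamma> fine D" and fin: "finite D"
        using D by (auto dest: tagged_division_of_finite)
      define err where "err K x = measure lborel K * k' x - (y (Sup K) - y (Inf K))" for K x
      have ivl: "\<exists>a b. K = {a..b} \<and> a \<le> b \<and> Inf K = a \<and> Sup K = b \<and> measure lborel K = b - a \<and> x \<in> K \<and> {a..b} \<subseteq> {c..d}"
        if "(x, K) \<in> D" for x K
        using tagged_division_ofD(2-4)[OF tD that] by fastforce
      have "(\<Sum>(x, K)\<in>D. measure lborel K *\<^sub>R k' x) - (y d - y c) = (\<Sum>(x, K)\<in>D. err K x)"
        using additive_tagged_division_1[OF cd tD, of y]
        by (simp add: err_def sum_subtractf case_prod_unfold)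
      also have "\<bar>\<dots>\<bar> \<le> (\<Sum>(x, K)\<in>D. \<bar>err K x\<bar>)"
        using sum_abs[of "\<lambda>p. err (snd p) (fst p)" D] by (simp add: case_prod_unfold)
      also have "\<dots> = (\<Sum>(x, K)\<in>{p \<in> D. fst p \<notin> N}. \<bar>err K x\<bar>) + (\<Sum>(x, K)\<in>{p \<in> D. fst p \<in> N}. \<bar>err K x\<bar>)"
        using fin by (subst sum.union_disjoint[symmetric]) (auto intro!: sum.cong)
      also have "(\<Sum>(x, K)\<in>{p \<in> D. fst p \<notin> N}. \<bar>err K x\<bar>) \<le> (\<Sum>(x, K)\<in>{p \<in> D. fst p \<notin> N}. \<epsilon> * measure lborel K)"
      proof (rule sum_mono, clarify, simp)
        fix x K assume xK: "(x, K) \<in> D" and x: "x \<notin> N"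
        obtain a b where ab: "K = {a..b}" "a \<le> b" "Inf K = a" "Sup K = b" "measure lborel K = b - a" "x \<in> K" "{a..b} \<subseteq> {c..d}"
          using ivl[OF xK] by blast
        have xcd: "x \<in> {c..d} - N"
          using ab x by auto
        have "K \<subseteq> ball x (r x)"
          using fineD[OF fine xK] xcd by (simp add: \<gamma>_def)
        then have "a \<in> ball x (r x)" "b \<in> ball x (r x)"
          using ab(1,2) by auto
        then have "\<bar>y a - y x - k' x * (a - x)\<bar> \<le> \<epsilon> * \<bar>a - x\<bar>" "\<bar>y b - y x - k' x * (b - x)\<bar> \<le> \<epsilon> * \<bar>b - x\<bar>"
          using r(2)[OF xcd] by (auto simp: dist_real_def abs_minus_commute)
        moreover have "err K x = (y a - y x - k' x * (a - x)) - (y b - y x - k' x * (b - x))"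
          using ab by (simp add: err_def algebra_simps)
        moreover have "\<epsilon> * \<bar>a - x\<bar> + \<epsilon> * \<bar>b - x\<bar> = \<epsilon> * measure lborel K"
          using ab by (simp add: algebra_simps)
        ultimately show "\<bar>err K x\<bar> \<le> \<epsilon> * measure lborel K"
          by linarith
      qed
      also have "(\<Sum>(x, K)\<in>{p \<in> D. fst p \<notin> N}. \<epsilon> * measure lborel K) \<le> (\<Sum>(x, K)\<in>D. \<epsilon> * measure lborel K)"
        using fin \<epsilon>(1) by (intro sum_mono2) auto
      also have "(\<Sum>(x, K)\<in>D. \<epsilon> * measure lborel K) = \<epsilon> * (d - c)"
        using additive_content_tagged_division[of D c d] tD cd
        by (simp add: case_prod_unfold sum_distrib_left[symmetric])
      also have "(\<Sum>(x, K)\<in>{p \<in> D. fst p \<in> N}. \<bar>err K x\<bar>) < e / 2"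
      proof -
        define E where "E = {p \<in> D. fst p \<in> N}"
        have "finite E"
          using fin by (simp add: E_def)
        then obtain h where h: "bij_betw h {..<card E} E"
          using ex_bij_betw_nat_finite[of E] by (auto simp: atLeast0LessThan)
        let ?a = "\<lambda>i. Inf (snd (h i))" and ?b = "\<lambda>i. Sup (snd (h i))"
        have hE: "h i \<in> E" if "i < card E" for i
          using h that by (auto simp: bij_betw_def)
        have K: "snd (h i) = {?a i..?b i}" "?a i \<le> ?b i" "{?a i..?b i} \<subseteq> {c..d}" "fst (h i) \<in> N"
           "(fst (h i), snd (h i)) \<in> D" if "i < card E" for i
        proof -
          have D: "(fst (h i), snd (h i)) \<in> D" and N': "fst (h i) \<in> N"
            using hE[OF that] by (auto simp: E_def)
          show "(fst (h i), snd (h i)) \<in> D" "fst (h i) \<in> N"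
            by (fact D N')+
          from ivl[OF D] show "snd (h i) = {?a i..?b i}" "?a i \<le> ?b i" "{?a i..?b i} \<subseteq> {c..d}"
            by metis+
        qed
        have disj: "disjoint_family_on (\<lambda>i. {?a i<..<?b i}) {..<card E}"
          unfolding disjoint_family_on_def
        proof (intro ballI impI)
          fix i j assume ij: "i \<in> {..<card E}" "j \<in> {..<card E}" "i \<noteq> j"
          then have "h i \<noteq> h j"
            using h by (auto simp: bij_betw_def inj_on_def)
          then have "interior (snd (h i)) \<inter> interior (snd (h j)) = {}"
            using tagged_division_ofD(5)[OF tD, of "fst (h i)" "snd (h i)" "fst (h j)" "snd (h j)"] K(5) ij
            by (auto simp: prod_eq_iff)
          moreover have "interior (snd (h i)) = {?a i<..<?b i}" "interior (snd (h j)) = {?a j<..<?b j}"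
            using K(1) ij interior_atLeastAtMost_real by (metis lessThan_iff)+
          ultimately show "{?a i<..<?b i} \<inter> {?a j<..<?b j} = {}"
            by simp
        qed
        have "(\<Sum>i<card E. ?b i - ?a i) = (\<Sum>i<card E. measure lebesgue {?a i<..<?b i})"
          using K(2) by (intro sum.cong) auto
        also have "\<dots> = measure lebesgue (\<Union>i<card E. {?a i<..<?b i})"
          by (rule measure_finite_Union[symmetric]) (use disj K(2) in \<open>auto simp: emeasure_lborel_Ioo\<close>)
        also have "\<dots> \<le> measure lebesgue U"
        proof (rule measure_mono_fmeasurable)
          show "(\<Union>i<card E. {?a i<..<?b i}) \<subseteq> U"
          proof
            fix t assume "t \<in> (\<Union>i<card E. {?a i<..<?b i})"
            then obtain i where i: "i < card E" "t \<in> {?a i<..<?b i}"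
              by auto
            then have "t \<in> snd (h i)"
              using K(1)[OF i(1)] by (metis atLeastAtMost_iff greaterThanLessThan_iff less_imp_le)
            moreover have "snd (h i) \<subseteq> U"
              using fineD[OF fine K(5)[OF i(1)]] K(4)[OF i(1)] by (simp add: \<gamma>_def)
            ultimately show "t \<in> U"
              by blast
          qed
        qed (use mU in auto)
        finally have "(\<Sum>i<card E. ?b i - ?a i) < \<delta>"
          using mU(2) by simp
        with small[of "card E" ?a ?b] K(2,3) disj have "(\<Sum>i<card E. \<bar>y (?b i) - y (?a i)\<bar>) < e / 2"
          by blast
        also have "(\<Sum>i<card E. \<bar>y (?b i) - y (?a i)\<bar>) = (\<Sum>p\<in>E. \<bar>y (Sup (snd p)) - y (Inf (snd p))\<bar>)"
          by (rule sum.reindex_bij_betw[OF h])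
        also have "\<dots> = (\<Sum>(x, K)\<in>E. \<bar>err K x\<bar>)"
          by (intro sum.cong) (auto simp: E_def err_def k'_def)
        finally show ?thesis
          by (simp add: E_def)
      qed
      finally show ?thesis
        using \<epsilon>(2) by simp
    qed
    ultimately show "\<exists>\<gamma>. gauge \<gamma> \<and> (\<forall>D. D tagged_division_of {c..d} \<and> \<gamma> fine D \<longrightarrow>
        norm ((\<Sum>(x, K)\<in>D. measure lborel K *\<^sub>R k' x) - (y d - y c)) < e)"
      by blast
  qed
  then show ?thesis
    by (rule has_integral_spike[OF N, rotated]) (simp add: k'_def)
qed

lemma lipschitz_imp_locally_absolutely_continuous:
  fixes y :: "real \<Rightarrow> real"
  assumes "\<And>s t. \<bar>y s - y t\<bar> \<le> M * \<bar>s - t\<bar>"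
  shows "locally_absolutely_continuous y"
  unfolding locally_absolutely_continuous_def absolutely_continuous_fun_on_def
proof (intro allI impI)
  fix c d e :: real assume e: "0 < e"
  have M: "0 \<le> M"
    using assms[of 1 0] by simp
  have main: "(\<Sum>i<n. \<bar>y (b i) - y (a i)\<bar>) < e"
    if "\<forall>i<n. a i \<le> b i \<and> {a i..b i} \<subseteq> {c..d}" "(\<Sum>i<n. b i - a i) < e / (M + 1)" for n :: nat and a b
  proof -
    have "(\<Sum>i<n. \<bar>y (b i) - y (a i)\<bar>) \<le> (\<Sum>i<n. M * (b i - a i))"
      using that(1) assms[of "b i" "a i" for i] by (intro sum_mono) (metis abs_of_nonneg diff_ge_0_iff_ge lessThan_iff)
    also have "\<dots> = M * (\<Sum>i<n. b i - a i)"
      by (simp add: sum_distrib_left)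
    also have "\<dots> \<le> M * (e / (M + 1))"
      using that(2) M by (intro mult_left_mono) auto
    also have "\<dots> < e"
      using M e by (simp add: field_simps)
    finally show ?thesis .
  qed
  show "\<exists>\<delta>>0. \<forall>(n::nat) x y'. (\<forall>i<n. x i \<le> y' i \<and> {x i..y' i} \<subseteq> {c..d}) \<and>
        disjoint_family_on (\<lambda>i. {x i<..<y' i}) {..<n} \<and> (\<Sum>i<n. y' i - x i) < \<delta> \<longrightarrow>
        (\<Sum>i<n. \<bar>y (y' i) - y (x i)\<bar>) < e"
  proof (intro exI[of _ "e / (M + 1)"] conjI allI impI)
    show "0 < e / (M + 1)"
      using e M by simp
  next
    fix n :: nat and x y'
    assume "(\<forall>i<n. x i \<le> y' i \<and> {x i..y' i} \<subseteq> {c..d}) \<and>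
        disjoint_family_on (\<lambda>i. {x i<..<y' i}) {..<n} \<and> (\<Sum>i<n. y' i - x i) < e / (M + 1)"
    then show "(\<Sum>i<n. \<bar>y (y' i) - y (x i)\<bar>) < e"
      using main[of n x y'] by blast
  qed
qed

section \<open>Indefinite nonlinearities and small parameters\<close>

lemma C1_imp_has_derivative:
  assumes "u C1_differentiable_on UNIV"
  shows "(u has_real_derivative deriv u t) (at t)" "continuous_on UNIV (deriv u)"
proof -
  obtain D where D: "\<And>x. (u has_vector_derivative D x) (at x)" "continuous_on UNIV D"
    using assms unfolding C1_differentiable_on_def by auto
  have d: "(u has_real_derivative D x) (at x)" for x
    using D(1) by (simp add: has_real_derivative_iff_has_vector_derivative)
  then have "deriv u = D"
    by (auto intro!: DERIV_imp_deriv)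
  with d D(2) show "(u has_real_derivative deriv u t) (at t)" "continuous_on UNIV (deriv u)"
    by auto
qed

lemma abs_diff_le_if_deriv_bounded:
  fixes u :: "real \<Rightarrow> real"
  assumes "\<And>t. (u has_real_derivative u' t) (at t)" "\<And>t. \<bar>u' t\<bar> \<le> M"
  shows "\<bar>u s - u t\<bar> \<le> M * \<bar>s - t\<bar>"
proof -
  have "norm (u s - u t) \<le> M * norm (s - t)"
    by (rule field_differentiable_bound[of UNIV u u' M]) (use assms in auto)
  then show ?thesis
    by simp
qed

lemma solution_integral:
  assumes sol: "is_solution lam a g u" and "c \<le> d"
  shows "((\<lambda>t. - (lam * a t * g (u t))) has_integral (phi (deriv u d) - phi (deriv u c))) {c..d}"
proof -
  let ?y = "\<lambda>t. phi (deriv u t)"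
  have "AE t in lebesgue. ?y differentiable (at t) \<and> deriv ?y t + lam * a t * g (u t) = 0"
    using sol unfolding is_solution_def by blast
  then obtain N where N: "N \<in> null_sets lebesgue"
    "{t \<in> space lebesgue. \<not> (?y differentiable (at t) \<and> deriv ?y t + lam * a t * g (u t) = 0)} \<subseteq> N"
    unfolding eventually_ae_filter by blast
  show ?thesis
  proof (rule fundamental_theorem_of_calculus_absolutely_continuous[OF _ assms(2)])
    show "absolutely_continuous_fun_on ?y {c..d}"
      using sol by (simp add: is_solution_def locally_absolutely_continuous_def)
    show "negligible N"
      using N(1) by (simp add: negligible_iff_null_sets)
    fix t assume "t \<in> {c..d} - N"
    then have "?y differentiable (at t)" "deriv ?y t + lam * a t * g (u t) = 0"
      using N(2) by auto
    then have t: "?y differentiable (at t)" "deriv ?y t = - (lam * a t * g (u t))"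
      by linarith+
    then show "(?y has_real_derivative - (lam * a t * g (u t))) (at t)"
      by (metis DERIV_deriv_iff_real_differentiable)
  qed
qed

lemma system_imp_solution:
  assumes v': "\<And>t. (v has_real_derivative phi_inv (y t)) (at t)"
    and y': "\<And>t. (y has_real_derivative - (lam * a t * g (v t))) (at t)"
    and bound: "\<And>t. \<bar>lam * a t * g (v t)\<bar> \<le> M"
  shows "is_solution lam a g v"
proof -
  have dv: "deriv v = (\<lambda>t. phi_inv (y t))"
    using v' by (auto intro!: DERIV_imp_deriv)
  have cy: "continuous_on UNIV y"
    using y' by (intro DERIV_continuous_on) (auto intro: has_field_derivative_at_within)
  have "v C1_differentiable_on UNIV"
    unfolding C1_differentiable_on_def
    using v' continuous_on_phi_inv[OF cy]
    by (intro exI[of _ "\<lambda>t. phi_inv (y t)"]) (auto simp: has_real_derivative_iff_has_vector_derivative)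
  moreover have "locally_absolutely_continuous y"
    by (rule lipschitz_imp_locally_absolutely_continuous[of _ M])
      (rule abs_diff_le_if_deriv_bounded[OF y'], simp add: bound)
  moreover have "y differentiable (at t)" "deriv y t = - (lam * a t * g (v t))" for t
    using y'[of t] by (auto simp: real_differentiable_def intro: DERIV_imp_deriv)
  ultimately show ?thesis
    by (auto simp: is_solution_def dv abs_phi_inv_less_1)
qed

text \<open>The hypotheses on g say that it is nondecreasing and of the form g(s) = s^p k(s) with k
nonincreasing and at most 1. They cover both model nonlinearities and give all that is used: a local
Lipschitz constant that tends to zero at the origin, and growth slow enough that g(s + T)/g(s)
tends to 1.\<close>

locale indefinite_problem =
  fixes T p :: real and a g :: "real \<Rightarrow> real"
  assumes T_pos: "0 < T" and p_gt_1: "1 < p"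
    and a_cont: "continuous_on UNIV a" and a_periodic: "\<And>t. a (t + T) = a t"
    and a_mean: "integral {0..T} a < 0"
    and g_0: "g 0 = 0" and g_pos: "\<And>s. 0 < s \<Longrightarrow> 0 < g s"
    and g_mono: "\<And>r s. 0 \<le> r \<Longrightarrow> r \<le> s \<Longrightarrow> g r \<le> g s"
    and g_le: "\<And>s. 0 < s \<Longrightarrow> g s \<le> s powr p"
    and g_ratio: "\<And>r s. 0 < r \<Longrightarrow> r \<le> s \<Longrightarrow> g s / s powr p \<le> g r / r powr p"
begin

lemma g_nonneg: "0 \<le> s \<Longrightarrow> 0 \<le> g s"
  using g_mono[of 0 s] g_0 by simp

lemma g_le_ratio: "0 < r \<Longrightarrow> r \<le> s \<Longrightarrow> g s \<le> (s / r) powr p * g r"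
  using g_ratio[of r s] by (simp add: field_simps powr_divide)

text \<open>For 0 < r the monotonicity of g(s)/s^p gives
g(s) - g(r) \<le> (g(r)/r^p)(s^p - r^p) \<le> s^p - r^p.\<close>

lemma g_lipschitz:
  assumes "0 \<le> r" "r \<le> s" "s \<le> B"
  shows "g s - g r \<le> p * B powr (p - 1) * (s - r)"
proof (cases "r = 0")
  case True
  show ?thesis
  proof (cases "s = 0")
    case False
    with assms have s: "0 < s"
      by simp
    have "g s \<le> s powr p"
      using s by (rule g_le)
    also have "\<dots> = 1 * s powr (p - 1) * s"
      using s by (simp add: powr_diff)
    also have "\<dots> \<le> p * B powr (p - 1) * s"
      using s assms p_gt_1 by (intro mult_right_mono mult_mono powr_mono2) auto
    finally show ?thesis
      using True g_0 by simp
  qed (use True in simp)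
next
  case False
  with assms have r: "0 < r"
    by simp
  show ?thesis
  proof (cases "r = s")
    case False
    with assms have rs: "r < s"
      by simp
    have "\<exists>z>r. z < s \<and> s powr p - r powr p = (s - r) * (p * z powr (p - 1))"
      by (rule MVT2[OF rs]) (use r in \<open>auto intro!: derivative_eq_intros simp: powr_diff\<close>)
    then obtain z where z: "r < z" "z < s" "s powr p - r powr p = (s - r) * (p * z powr (p - 1))"
      by blast
    have rp: "0 < r powr p" "r powr p \<le> s powr p"
      using r rs p_gt_1 by (auto intro: powr_mono2)
    have "g s - g r \<le> (g r / r powr p) * (s powr p - r powr p)"
      using g_ratio[OF r assms(2)] r rs by (simp add: field_simps)
    also have "\<dots> \<le> 1 * (s powr p - r powr p)"
      using g_le[OF r] rp by (intro mult_right_mono) (auto simp: field_simps)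
    also have "\<dots> = p * z powr (p - 1) * (s - r)"
      by (simp add: z(3))
    also have "\<dots> \<le> p * B powr (p - 1) * (s - r)"
      using r z rs assms p_gt_1 by (intro mult_right_mono mult_left_mono powr_mono2) auto
    finally show ?thesis .
  qed simp
qed

lemma g_slow_growth:
  assumes "0 < e"
  obtains m where "0 < m" "\<And>s. m \<le> s \<Longrightarrow> g (s + T) \<le> (1 + e) * g s"
proof -
  have "((\<lambda>s. (1 + T / s) powr p) \<longlongrightarrow> (1 + 0) powr p) at_top"
    by (intro tendsto_powr tendsto_add tendsto_const tendsto_divide_0[OF tendsto_const] filterlim_at_top_imp_at_infinity filterlim_ident) auto
  then have "\<forall>\<^sub>F s in at_top. (1 + T / s) powr p < 1 + e"
    by (rule order_tendstoD(2)) (use assms in simp)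
  then obtain m where m: "\<And>s. m \<le> s \<Longrightarrow> (1 + T / s) powr p < 1 + e"
    by (auto simp: eventually_at_top_linorder)
  show thesis
  proof (rule that[of "max m 1"])
    fix s assume s: "max m 1 \<le> s"
    have "g (s + T) \<le> ((s + T) / s) powr p * g s"
      using s T_pos by (intro g_le_ratio) auto
    also have "(s + T) / s = 1 + T / s"
      using s by (simp add: field_simps)
    also have "(1 + T / s) powr p * g s \<le> (1 + e) * g s"
      using m[of s] s g_nonneg[of s] by (intro mult_right_mono) auto
    finally show "g (s + T) \<le> (1 + e) * g s" .
  qed simp
qed

lemma a_bounded: "\<exists>A>0. \<forall>t. \<bar>a t\<bar> \<le> A"
proof -
  have "compact (a ` {0..T})"
    using a_cont by (intro compact_continuous_image) (auto elim: continuous_on_subset)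
  then have "bounded (a ` {0..T})"
    by (rule compact_imp_bounded)
  then obtain B where B: "\<And>t. t \<in> {0..T} \<Longrightarrow> \<bar>a t\<bar> \<le> B"
    by (force simp: bounded_iff)
  have "\<bar>a t\<bar> \<le> \<bar>B\<bar> + 1" for t
  proof -
    obtain n s where "t = s + of_int n * T" "0 \<le> s" "s < T"
      by (rule reduce_mod_period[OF T_pos])
    then show ?thesis
      using periodic_add_int[of a T s n, OF a_periodic] B[of s] by simp
  qed
  then show ?thesis
    by (intro exI[of _ "\<bar>B\<bar> + 1"]) auto
qed

text \<open>A bound for |a|, positive so that one can divide by it.\<close>

definition A where "A = (SOME A. A > 0 \<and> (\<forall>t. \<bar>a t\<bar> \<le> A))"

lemma A_pos: "0 < A" and a_le: "\<bar>a t\<bar> \<le> A"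
  using someI_ex[OF a_bounded] unfolding A_def by auto

text \<open>The amount by which the negative part of the weight outweighs the positive one; it decides the sign of
\<integral> a W for every nearly constant W.\<close>

definition deficit where "deficit = - integral {0..T} a"

lemma deficit_pos: "0 < deficit"
  using a_mean by (simp add: deficit_def)

lemma a_cont_on: "continuous_on S a"
  using a_cont by (rule continuous_on_subset) simp

lemma weighted_integral_le:
  assumes W: "continuous_on {0..T} W" and near: "\<And>t. t \<in> {0..T} \<Longrightarrow> \<bar>W t - w\<bar> \<le> e"
  shows "integral {0..T} (\<lambda>t. a t * W t) \<le> - deficit * w + A * T * e"
proof -
  have "\<bar>integral {0..T} (\<lambda>t. a t * W t) - integral {0..T} (\<lambda>t. a t * w)\<bar> \<le> A * e * (T - 0)"
  proof (rule abs_integral_diff_le)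
    fix t assume "t \<in> {0..T}"
    then have "\<bar>a t\<bar> * \<bar>W t - w\<bar> \<le> A * e"
      using near a_le A_pos by (intro mult_mono) auto
    then show "\<bar>a t * W t - a t * w\<bar> \<le> A * e"
      by (simp add: abs_mult[symmetric] algebra_simps)
  qed (use T_pos W in \<open>auto intro!: continuous_intros a_cont_on\<close>)
  moreover have "integral {0..T} (\<lambda>t. a t * w) = - deficit * w"
    by (simp add: deficit_def)
  ultimately show ?thesis
    by (simp add: abs_le_iff algebra_simps)
qed

lemma weighted_integral_negative:
  assumes "continuous_on {0..T} W" "\<And>t. t \<in> {0..T} \<Longrightarrow> \<bar>W t - w\<bar> \<le> e * w" "0 < w" "A * T * e < deficit"
  shows "integral {0..T} (\<lambda>t. a t * W t) < 0"
proof -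
  have "integral {0..T} (\<lambda>t. a t * W t) \<le> - deficit * w + A * T * (e * w)"
    by (rule weighted_integral_le[OF assms(1,2)])
  also have "\<dots> = (A * T * e - deficit) * w"
    by (simp add: algebra_simps)
  also have "\<dots> < 0"
    using assms(3,4) by (simp add: mult_neg_pos)
  finally show ?thesis .
qed

text \<open>From here on g varies so little over distance T that \<integral> a g(u) is negative for every u
with oscillation at most T (\<open>min_below_threshold\<close>).\<close>

definition threshold where
  "threshold = (SOME m. 0 < m \<and> (\<forall>s\<ge>m. g (s + T) \<le> (1 + deficit / (2 * A * T)) * g s))"

lemma threshold: "0 < threshold" "\<And>s. threshold \<le> s \<Longrightarrow> g (s + T) \<le> (1 + deficit / (2 * A * T)) * g s"
proof -
  have "0 < deficit / (2 * A * T)"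
    using deficit_pos A_pos T_pos by simp
  then have "\<exists>m>0. \<forall>s\<ge>m. g (s + T) \<le> (1 + deficit / (2 * A * T)) * g s"
    using g_slow_growth by metis
  from someI_ex[OF this] show "0 < threshold" "\<And>s. threshold \<le> s \<Longrightarrow> g (s + T) \<le> (1 + deficit / (2 * A * T)) * g s"
    unfolding threshold_def by auto
qed

text \<open>An upper bound for all positive periodic solutions, whatever the positive parameter: their minimum lies below
the threshold, and their oscillation is at most T.\<close>

definition R where "R = threshold + T"

lemma R_pos: "0 < R"
  using threshold(1) T_pos by (simp add: R_def)

text \<open>A vanishing weighted integral is a necessary condition for periodicity. It fails when k(u) is within
a small factor of a positive constant. The function k stands for g and for its truncation.\<close>

lemma min_below_threshold:
  assumes k: "\<And>r s. threshold \<le> r \<Longrightarrow> r \<le> s \<Longrightarrow> k r \<le> k s" "0 < k m"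
    "threshold \<le> m \<Longrightarrow> k (m + T) \<le> (1 + deficit / (2 * A * T)) * k m"
    and u: "continuous_on {0..T} (\<lambda>t. k (u t))" "\<And>t. t \<in> {0..T} \<Longrightarrow> m \<le> u t \<and> u t \<le> m + T"
    and int: "integral {0..T} (\<lambda>t. a t * k (u t)) = 0"
  shows "m < threshold"
proof (rule ccontr)
  assume "\<not> m < threshold"
  then have m: "threshold \<le> m"
    by simp
  have "integral {0..T} (\<lambda>t. a t * k (u t)) < 0"
  proof (rule weighted_integral_negative[OF u(1) _ k(2)])
    fix t assume "t \<in> {0..T}"
    from u(2)[OF this] have "k m \<le> k (u t)" "k (u t) \<le> k (m + T)"
      using k(1) m by auto
    then show "\<bar>k (u t) - k m\<bar> \<le> deficit / (2 * A * T) * k m"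
      using k(3)[OF m] by (simp add: algebra_simps)
  next
    show "A * T * (deficit / (2 * A * T)) < deficit"
      using A_pos T_pos deficit_pos by simp
  qed
  with int show False
    by simp
qed

text \<open>The Lipschitz constant of g on [0, R].\<close>

definition ell where "ell = p * R powr (p - 1)"

lemma ell_pos: "0 < ell"
  using p_gt_1 R_pos by (simp add: ell_def)

lemma g_continuous: "continuous_on {0..} g"
  unfolding continuous_on_iff
proof (intro ballI allI impI)
  fix x e :: real assume x: "x \<in> {0..}" and e: "0 < e"
  define K where "K = p * (x + 1) powr (p - 1)"
  have K: "0 < K"
    using x p_gt_1 by (simp add: K_def)
  show "\<exists>d>0. \<forall>y\<in>{0..}. dist y x < d \<longrightarrow> dist (g y) (g x) < e"
  proof (intro exI[of _ "min 1 (e / K)"] conjI ballI impI)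
    fix y assume y: "y \<in> {0..}" "dist y x < min 1 (e / K)"
    have "\<bar>g y - g x\<bar> \<le> K * \<bar>y - x\<bar>"
    proof (cases "x \<le> y")
      case True
      then show ?thesis
        using g_lipschitz[of x y "x + 1"] g_mono[of x y] x y by (simp add: K_def dist_real_def)
    next
      case False
      then show ?thesis
        using g_lipschitz[of y x "x + 1"] g_mono[of y x] x y by (simp add: K_def dist_real_def)
    qed
    also have "\<dots> < e"
      using y K by (simp add: dist_real_def field_simps)
    finally show "dist (g y) (g x) < e"
      by (simp add: dist_real_def)
  qed (use e K in simp)
qed

lemma continuous_on_g: "continuous_on S u \<Longrightarrow> (\<And>t. t \<in> S \<Longrightarrow> 0 \<le> u t) \<Longrightarrow> continuous_on S (\<lambda>t. g (u t))"
  by (rule continuous_on_compose2[OF g_continuous]) auto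

text \<open>The oscillation of a solution is at most \<lambda> A T^2 g(M), where M is its maximum, so g(u) stays
within the factor ell \<lambda> A T^2 of g(M). The stated bound on \<lambda> is exactly what makes
this too close to a constant for \<integral> a g(u) = 0.\<close>

lemma no_solution_small_parameter:
  assumes lam: "0 < lam" "lam < deficit / (ell * A\<^sup>2 * T ^ 3)"
  shows "\<not> positive_periodic_solution T lam a g u"
proof
  assume pps: "positive_periodic_solution T lam a g u"
  then have sol: "is_solution lam a g u" and per: "\<And>t. u (t + T) = u t" and pos: "\<And>t. 0 < u t"
    by (auto simp: positive_periodic_solution_def)
  have C1: "u C1_differentiable_on UNIV" and less1: "\<And>t. \<bar>deriv u t\<bar> < 1"
    using sol by (auto simp: is_solution_def)
  note u' = C1_imp_has_derivative(1)[OF C1]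
  have cu: "continuous_on UNIV u"
    using u' by (intro DERIV_continuous_on) (auto intro: has_field_derivative_at_within)
  define y where "y t = phi (deriv u t)" for t
  have du: "deriv u t = phi_inv (y t)" for t
    using less1 by (simp add: y_def phi_inv_phi)
  have yint: "((\<lambda>t. - (lam * a t * g (u t))) has_integral (y d - y c)) {c..d}" if "c \<le> d" for c d
    unfolding y_def by (rule solution_integral[OF sol that])
  have "deriv u (t + T) = deriv u t" for t
  proof -
    have "((\<lambda>s. u (s + T)) has_real_derivative deriv u (t + T)) (at t)"
      using u'[of "t + T"] by (simp add: DERIV_shift)
    then show ?thesis
      using u'[of t] per DERIV_unique by simp
  qed
  then have "y T = y 0"
    by (metis add_0 y_def)
  then have "((\<lambda>t. - (lam * a t * g (u t))) has_integral 0) {0..T}"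
    using yint[of 0 T] T_pos by simp
  also have "(\<lambda>t. - (lam * a t * g (u t))) = (\<lambda>t. (- lam) * (a t * g (u t)))"
    by (simp add: mult.assoc)
  finally have "integral {0..T} (\<lambda>t. (- lam) * (a t * g (u t))) = 0"
    by (rule integral_unique)
  then have "(- lam) * integral {0..T} (\<lambda>t. a t * g (u t)) = 0"
    by (simp only: integral_mult_right)
  then have int0: "integral {0..T} (\<lambda>t. a t * g (u t)) = 0"
    using lam by simp

  obtain t0 where t0: "t0 \<in> {0..T}" "\<And>t. u t0 \<le> u t"
    using periodic_attains_min[OF T_pos cu per] by metis
  have "continuous_on UNIV (\<lambda>t. - u t)"
    using cu by (intro continuous_intros)
  then have "\<exists>t1. \<forall>t. - u t1 \<le> - u t"
    by (rule periodic_attains_min[OF T_pos]) (use per in auto)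
  then obtain t1 where "\<And>t. - u t1 \<le> - u t"
    by blast
  then have t1: "u t \<le> u t1" for t
    by simp
  \<comment> \<open>A translate of the maximum point lies within one period after the minimum point.\<close>
  obtain n s where s: "t1 - t0 = s + of_int n * T" "0 \<le> s" "s < T"
    by (rule reduce_mod_period[OF T_pos])
  define m M where "m = u t0" and "M = u t1"
  have M: "u (t0 + s) = M"
  proof -
    have "t1 = (t0 + s) + of_int n * T"
      using s(1) by simp
    then show ?thesis
      using periodic_add_int[of u T "t0 + s" n, OF per] by (simp add: M_def)
  qed
  have range: "m \<le> u t" "u t \<le> M" for t
    using t0(2) t1 by (auto simp: m_def M_def)
  have mpos: "0 < m"
    using pos by (simp add: m_def)
  have "\<bar>u (t0 + s) - u t0\<bar> \<le> 1 * \<bar>(t0 + s) - t0\<bar>"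
    using u' less_imp_le[OF less1] by (rule abs_diff_le_if_deriv_bounded)
  then have MT: "M \<le> m + T"
    using s M by (simp add: m_def)
  have cgu: "continuous_on S (\<lambda>t. g (u t))" for S
    using cu pos by (intro continuous_on_g) (auto elim: continuous_on_subset intro: less_imp_le)
  have "m < threshold"
  proof (rule min_below_threshold[of g])
    show "\<And>t. t \<in> {0..T} \<Longrightarrow> m \<le> u t \<and> u t \<le> m + T"
      using range MT by (meson order_trans)
  qed (use threshold mpos int0 cgu in \<open>auto intro: g_mono g_pos\<close>)
  then have MR: "M \<le> R"
    using MT by (simp add: R_def)

  have "deriv u t0 = 0"
    by (rule DERIV_local_min[OF u'[of t0], of 1]) (use t0 in auto)
  then have y0: "y t0 = 0"
    by (simp add: y_def)
  define D where "D = lam * A * g M * T"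
  have gM: "0 < g M"
    using mpos range(1)[of t1] by (intro g_pos) (simp add: M_def)
  have yD: "\<bar>y t\<bar> \<le> D" if "t0 \<le> t" "t \<le> t0 + T" for t
  proof -
    have "\<bar>lam * a r * g (u r)\<bar> \<le> lam * A * g M" for r
    proof -
      have "\<bar>lam * a r * g (u r)\<bar> = lam * \<bar>a r\<bar> * g (u r)"
        using lam g_nonneg[of "u r"] pos[of r] by (simp add: abs_mult)
      also have "\<dots> \<le> lam * A * g M"
        using lam a_le A_pos range pos g_nonneg[of "u r"] by (intro mult_mono g_mono) (auto simp: less_imp_le)
      finally show ?thesis .
    qed
    then have "norm (y t - y t0) \<le> lam * A * g M * measure lborel {t0..t}"
      using lam A_pos gM by (intro has_integral_bound_real[OF _ _ yint[OF that(1)], of _ "{}"]) auto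
    then have "\<bar>y t - y t0\<bar> \<le> lam * A * g M * (t - t0)"
      using that by simp
    also have "\<dots> \<le> D"
      unfolding D_def using lam A_pos gM that by (intro mult_left_mono) auto
    finally show ?thesis
      using y0 by simp
  qed
  have "M - m \<le> D * T"
  proof (cases "s = 0")
    case True
    then show ?thesis
      using M lam A_pos gM T_pos by (simp add: m_def D_def)
  next
    case False
    then have "t0 < t0 + s"
      using s by simp
    then obtain z where z: "t0 < z" "z < t0 + s" "u (t0 + s) - u t0 = (t0 + s - t0) * deriv u z"
      using MVT2[of t0 "t0 + s" u "deriv u"] u' by blast
    have "deriv u z \<le> D"
      using abs_phi_inv_le[of "y z"] yD[of z] z s by (simp add: du)
    then have "s * deriv u z \<le> s * D"
      using s by (intro mult_left_mono) auto
    also have "\<dots> \<le> T * D"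
      using s lam A_pos gM T_pos by (intro mult_right_mono) (auto simp: D_def)
    finally show ?thesis
      using z(3) M by (simp add: m_def mult.commute)
  qed
  moreover have "\<bar>g (u t) - g M\<bar> \<le> ell * (M - m)" for t
  proof -
    have "g M - g (u t) \<le> ell * (M - u t)"
      unfolding ell_def using range[of t] pos[of t] MR by (intro g_lipschitz) auto
    also have "\<dots> \<le> ell * (M - m)"
      using range[of t] ell_pos by (intro mult_left_mono) auto
    finally show ?thesis
      using g_mono[of "u t" M] range[of t] pos[of t] by simp
  qed
  ultimately have "\<bar>g (u t) - g M\<bar> \<le> (ell * lam * A * T\<^sup>2) * g M" for t
  proof -
    note \<open>\<bar>g (u t) - g M\<bar> \<le> ell * (M - m)\<close>
    also have "ell * (M - m) \<le> ell * (D * T)"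
      using \<open>M - m \<le> D * T\<close> ell_pos by (intro mult_left_mono) auto
    also have "\<dots> = (ell * lam * A * T\<^sup>2) * g M"
      by (simp only: D_def power2_eq_square mult_ac)
    finally show ?thesis .
  qed
  moreover have "A * T * (ell * lam * A * T\<^sup>2) < deficit"
  proof -
    have "0 < ell * A\<^sup>2 * T ^ 3"
      using ell_pos A_pos T_pos by simp
    from lam(2)[unfolded pos_less_divide_eq[OF this]] have "lam * (ell * A\<^sup>2 * T ^ 3) < deficit" .
    moreover have "lam * (ell * A\<^sup>2 * T ^ 3) = A * T * (ell * lam * A * T\<^sup>2)"
      by (simp only: power2_eq_square power3_eq_cube mult_ac)
    ultimately show ?thesis
      by simp
  qed
  ultimately have "integral {0..T} (\<lambda>t. a t * g (u t)) < 0"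
    using gM by (intro weighted_integral_negative[OF cgu, of "g M" "ell * lam * A * T\<^sup>2"]) auto
  with int0 show False
    by simp
qed

end

section \<open>The truncated forcing\<close>

lemma negative_part_square_deriv:
  fixes s :: real
  shows "((\<lambda>s. - (min s 0)\<^sup>2 / 2) has_real_derivative max (- s) 0) (at s)"
proof -
  let ?F = "\<lambda>s::real. - (min s 0)\<^sup>2 / 2"
  have "(\<lambda>h. (?F (s + h) - ?F s) / h - max (- s) 0) \<midarrow>0\<rightarrow> 0"
  proof (rule Lim_null_comparison)
    show "\<forall>\<^sub>F h in at 0. norm ((?F (s + h) - ?F s) / h - max (- s) 0) \<le> \<bar>h\<bar>"
    proof (rule eventually_at_topological[THEN iffD2], intro exI[of _ UNIV] conjI ballI impI)
      fix h :: real assume h: "h \<noteq> 0"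
      have "\<bar>?F (s + h) - ?F s - max (- s) 0 * h\<bar> \<le> h\<^sup>2"
      proof -
        consider "0 \<le> s" "0 \<le> s + h" | "0 \<le> s" "s + h < 0" | "s < 0" "s + h \<le> 0" | "s < 0" "0 < s + h"
          by linarith
        then show ?thesis
        proof cases
          case 2
          then have "(s + h)\<^sup>2 \<le> h\<^sup>2"
            by (simp add: abs_le_square_iff[symmetric])
          then have "(s + h)\<^sup>2 \<le> h\<^sup>2 * 2"
            using zero_le_power2[of h] by linarith
          then show ?thesis
            using 2 by simp
        next
          case 3
          then have "?F (s + h) - ?F s - max (- s) 0 * h = - (h\<^sup>2) / 2"
            by (simp add: power2_sum field_simps)
          then show ?thesis
            by simp
        next
          case 4
          then have "\<bar>s\<bar> \<le> \<bar>h\<bar>"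
            by simp
          then have "s\<^sup>2 \<le> h\<^sup>2"
            by (simp add: abs_le_square_iff)
          moreover have "0 \<le> (s + h)\<^sup>2"
            by simp
          moreover have "s * h \<le> 0"
            using 4 by (intro mult_nonpos_nonneg) auto
          moreover have "?F (s + h) - ?F s - max (- s) 0 * h = s\<^sup>2 / 2 + s * h"
            using 4 by simp
          ultimately show ?thesis
            using zero_le_power2[of s] zero_le_power2[of h] by (simp only: power2_sum abs_le_iff) linarith
        qed simp
      qed
      moreover have "(?F (s + h) - ?F s) / h - max (- s) 0 = (?F (s + h) - ?F s - max (- s) 0 * h) / h"
        using h by (simp add: field_simps)
      ultimately show "norm ((?F (s + h) - ?F s) / h - max (- s) 0) \<le> \<bar>h\<bar>"
        using h by (simp add: abs_divide divide_le_eq power2_eq_square abs_mult[symmetric])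
    qed auto
  qed (auto intro!: tendsto_eq_intros)
  then show ?thesis
    unfolding DERIV_def by (simp add: LIM_zero_iff)
qed

context indefinite_problem
begin

text \<open>The truncation of g: zero on the negative axis and constant beyond R, which makes it globally
Lipschitz while leaving it unchanged on the range of the positive periodic solutions.\<close>

definition gR where "gR s = g (min (max s 0) R)"

lemma gR_eq: "0 \<le> s \<Longrightarrow> s \<le> R \<Longrightarrow> gR s = g s"
  by (simp add: gR_def)

lemma gR_mono: "r \<le> s \<Longrightarrow> gR r \<le> gR s"
  unfolding gR_def using R_pos by (intro g_mono) auto

lemma gR_nonpos: "s \<le> 0 \<Longrightarrow> gR s = 0"
  using R_pos g_0 by (simp add: gR_def)

lemma gR_nonneg: "0 \<le> gR s"
  unfolding gR_def using R_pos by (intro g_nonneg) auto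

lemma gR_pos: "0 < s \<Longrightarrow> 0 < gR s"
  unfolding gR_def using R_pos by (intro g_pos) auto

lemma gR_le: "gR s \<le> g R"
  unfolding gR_def using R_pos by (intro g_mono) auto

lemma gR_slow_growth:
  assumes "threshold \<le> s"
  shows "gR (s + T) \<le> (1 + deficit / (2 * A * T)) * gR s"
proof (cases "s \<le> R")
  case True
  have "gR (s + T) \<le> g (s + T)"
    unfolding gR_def using assms threshold(1) T_pos R_pos by (intro g_mono) auto
  also have "\<dots> \<le> (1 + deficit / (2 * A * T)) * g s"
    using assms by (rule threshold(2))
  finally show ?thesis
    using True assms threshold(1) by (simp add: gR_eq)
next
  case False
  then have "gR (s + T) = gR s"
    using T_pos R_pos by (simp add: gR_def)
  moreover have "1 * gR s \<le> (1 + deficit / (2 * A * T)) * gR s"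
    using gR_nonneg deficit_pos A_pos T_pos by (intro mult_right_mono) auto
  ultimately show ?thesis
    by simp
qed

lemma gR_lipschitz: "\<bar>gR r - gR s\<bar> \<le> ell * \<bar>r - s\<bar>"
proof -
  have *: "gR s - gR r \<le> ell * (s - r)" if "r \<le> s" for r s
  proof -
    have "gR s - gR r \<le> ell * (min (max s 0) R - min (max r 0) R)"
      unfolding gR_def ell_def using R_pos that by (intro g_lipschitz) auto
    also have "\<dots> \<le> ell * (s - r)"
      using that ell_pos by (intro mult_left_mono) auto
    finally show ?thesis .
  qed
  show ?thesis
    using *[of r s] *[of s r] gR_mono[of r s] gR_mono[of s r] by (cases "r \<le> s") auto
qed

lemma gR_continuous: "continuous_on S gR"
proof -
  have "ell-lipschitz_on S gR"
    using gR_lipschitz ell_pos by (intro lipschitz_onI) (auto simp: dist_real_def)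
  then show ?thesis
    by (rule lipschitz_on_continuous_on)
qed

lemma continuous_on_gR: "continuous_on S u \<Longrightarrow> continuous_on S (\<lambda>t. gR (u t))"
  by (rule continuous_on_compose2[OF gR_continuous[of UNIV]]) auto

definition GR where "GR = (SOME G. (\<forall>s. (G has_real_derivative gR s) (at s)) \<and> G 0 = 0)"

lemma GR_deriv: "(GR has_real_derivative gR s) (at s)" and GR_0: "GR 0 = 0"
proof -
  have "\<exists>G. (\<forall>s. (G has_real_derivative gR s) (at s)) \<and> G 0 = 0"
    by (rule antiderivative_real[OF gR_continuous]) blast
  from someI_ex[OF this] show "(GR has_real_derivative gR s) (at s)" "GR 0 = 0"
    unfolding GR_def by auto
qed

lemma continuous_on_GR: "continuous_on S u \<Longrightarrow> continuous_on S (\<lambda>t. GR (u t))"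
  by (rule continuous_on_compose2[of UNIV GR])
    (auto intro!: DERIV_continuous_on intro: has_field_derivative_at_within GR_deriv)

lemma GR_mono: "r \<le> s \<Longrightarrow> GR r \<le> GR s"
  by (rule DERIV_nonneg_imp_nondecreasing) (use GR_deriv gR_nonneg in blast)+

lemma GR_nonpos: "s \<le> 0 \<Longrightarrow> GR s = 0"
proof -
  assume s: "s \<le> 0"
  have "0 \<le> GR s"
  proof -
    have "- GR s \<le> - GR 0"
      by (rule DERIV_nonneg_imp_nondecreasing[OF s, of "\<lambda>s. - GR s"])
        (use DERIV_minus[OF GR_deriv] gR_nonpos in fastforce)
    then show ?thesis
      by (simp add: GR_0)
  qed
  moreover have "GR s \<le> 0"
    using GR_mono[OF s] by (simp add: GR_0)
  ultimately show ?thesis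
    by simp
qed

lemma GR_diff_le:
  assumes "r \<le> s"
  shows "GR s - GR r \<le> gR s * (s - r)"
proof (cases "r = s")
  case False
  with assms have rs: "r < s"
    by simp
  have "\<exists>z>r. z < s \<and> GR s - GR r = (s - r) * gR z"
    by (rule MVT2[OF rs]) (rule GR_deriv)
  then obtain z where "z < s" "GR s - GR r = (s - r) * gR z"
    by blast
  then show ?thesis
    using rs gR_mono[of z s] by (simp add: mult.commute mult_left_mono)
qed simp

lemma abs_GR_diff_le: "\<bar>GR r - GR s\<bar> \<le> g R * \<bar>r - s\<bar>"
  by (rule abs_diff_le_if_deriv_bounded[OF GR_deriv]) (use gR_nonneg gR_le in auto)

lemma GR_ge_linear: "R \<le> s \<Longrightarrow> g R * (s - R) \<le> GR s"
proof -
  assume s: "R \<le> s"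
  show ?thesis
  proof (cases "s = R")
    case False
    with s have "R < s"
      by simp
    then have "\<exists>z>R. z < s \<and> GR s - GR R = (s - R) * gR z"
      by (rule MVT2) (rule GR_deriv)
    then obtain z where "R < z" "GR s - GR R = (s - R) * gR z"
      by blast
    moreover from this have "gR z = g R"
      using R_pos by (simp add: gR_def)
    moreover have "0 \<le> GR R"
      using GR_mono[of 0 R] R_pos GR_0 by simp
    ultimately show ?thesis
      by (simp add: mult.commute)
  qed (use GR_mono[of 0 R] R_pos GR_0 in simp)
qed

text \<open>A nonnegative function with Lipschitz constant e dominates on [0, s] the triangle of height g(s)
and slope e, whose area is g(s)^2/(2e). As e tends to zero with s, this makes g^2 small
compared with G near the origin, which is what the mountain pass barrier needs.\<close>

lemma gR_square_le:
  assumes s: "0 \<le> s" "s \<le> R"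
  shows "(gR s)\<^sup>2 \<le> 2 * (p * s powr (p - 1)) * GR s"
proof (cases "s = 0")
  case True
  then show ?thesis
    by (simp add: gR_nonpos)
next
  case False
  with s have spos: "0 < s"
    by simp
  define e where "e = p * s powr (p - 1)"
  have e: "0 < e"
    using spos p_gt_1 by (simp add: e_def)
  have low: "gR s - e * (s - r) \<le> gR r" if "0 \<le> r" "r \<le> s" for r
    using g_lipschitz[of r s s] that s by (simp add: gR_eq e_def algebra_simps)
  \<comment> \<open>The base length of the triangle with height gR s and slope e.\<close>
  define D where "D = gR s / e"
  have D: "0 \<le> D" "D \<le> s"
    using low[of 0] s gR_nonneg[of s] e by (auto simp: D_def gR_nonpos field_simps)
  define q where "q r = gR s * (s - r) - e / 2 * (s - r)\<^sup>2 + GR r" for r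
  have "q (s - D) \<le> q s"
  proof (rule DERIV_nonneg_imp_nondecreasing[of "s - D" s q])
    fix x assume x: "s - D \<le> x" "x \<le> s"
    have "(q has_real_derivative (- gR s + e * (s - x) + gR x)) (at x)"
      unfolding q_def by (rule derivative_eq_intros GR_deriv refl)+ (simp add: field_simps)
    moreover have "0 \<le> - gR s + e * (s - x) + gR x"
      using low[of x] x D by simp
    ultimately show "\<exists>y. (q has_real_derivative y) (at x) \<and> 0 \<le> y"
      by blast
  qed (use D in simp)
  moreover have "0 \<le> GR (s - D)"
    using GR_mono[of 0 "s - D"] D GR_0 by simp
  ultimately have "gR s * D - e / 2 * D\<^sup>2 \<le> GR s"
    by (simp add: q_def)
  moreover have "2 * e * (gR s * D - e / 2 * D\<^sup>2) = (gR s)\<^sup>2"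
    using e by (simp add: D_def power2_eq_square field_simps)
  ultimately have "(gR s)\<^sup>2 \<le> 2 * e * GR s"
    using mult_left_mono[of "gR s * D - e / 2 * D\<^sup>2" "GR s" "2 * e"] e by simp
  then show ?thesis
    by (simp add: e_def)
qed

text \<open>The second summand is the penalty for negative values. It carries no weight a, so it makes the energy
grow when the trajectory tends to -\<infinity>, where the truncated nonlinearity gives nothing.\<close>

definition forcing_term where "forcing_term lam t s = lam * (a t * gR s) + max (- s) 0"

definition potential where "potential lam t s = lam * (a t * GR s) + - (min s 0)\<^sup>2 / 2"

lemma forcing_truncated:
  assumes lam: "0 < lam"
  shows "forcing T (lam * A * ell + 1) (forcing_term lam) (potential lam)"
proof
  show "0 \<le> lam * A * ell + 1"
    using lam A_pos ell_pos by simp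
  show "\<bar>forcing_term lam t s - forcing_term lam t s'\<bar> \<le> (lam * A * ell + 1) * \<bar>s - s'\<bar>" for t s s'
  proof -
    have "\<bar>lam * (a t * gR s) - lam * (a t * gR s')\<bar> = lam * (\<bar>a t\<bar> * \<bar>gR s - gR s'\<bar>)"
      using lam by (simp add: abs_mult right_diff_distrib[symmetric])
    also have "\<dots> \<le> lam * (A * (ell * \<bar>s - s'\<bar>))"
      using lam a_le gR_lipschitz A_pos by (intro mult_left_mono mult_mono) auto
    finally have "\<bar>lam * (a t * gR s) - lam * (a t * gR s')\<bar> \<le> lam * (A * (ell * \<bar>s - s'\<bar>))" .
    moreover have "\<bar>max (- s) 0 - max (- s') 0\<bar> \<le> \<bar>s - s'\<bar>"
      by auto
    moreover have "forcing_term lam t s - forcing_term lam t s' = (lam * (a t * gR s) - lam * (a t * gR s')) + (max (- s) 0 - max (- s') 0)"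
      by (simp add: forcing_term_def)
    moreover have "lam * (A * (ell * \<bar>s - s'\<bar>)) + \<bar>s - s'\<bar> = (lam * A * ell + 1) * \<bar>s - s'\<bar>"
      by (simp add: algebra_simps)
    ultimately show ?thesis
      by linarith
  qed
  show "(potential lam t has_real_derivative forcing_term lam t s) (at s)" for t s
    unfolding potential_def forcing_term_def
    by (rule DERIV_add[OF DERIV_cmult[OF DERIV_cmult[OF GR_deriv]] negative_part_square_deriv])
  show "continuous_on {0..T} (\<lambda>t. forcing_term lam t (u t))" "continuous_on {0..T} (\<lambda>t. potential lam t (u t))"
    if "continuous_on {0..T} u" for u
    unfolding forcing_term_def potential_def using that
    by (auto intro!: continuous_intros continuous_on_gR continuous_on_GR a_cont_on)
qed (use T_pos in \<open>auto simp: forcing_term_def potential_def gR_nonpos GR_0\<close>)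

lemma GR_pos: "0 < s \<Longrightarrow> 0 < GR s"
proof -
  assume s: "0 < s"
  define r where "r = min s R"
  have r: "0 < r" "r \<le> R" "r \<le> s"
    using s R_pos by (auto simp: r_def)
  have "0 < (gR r)\<^sup>2"
    using gR_pos[OF r(1)] by simp
  also have "\<dots> \<le> 2 * (p * r powr (p - 1)) * GR r"
    using r by (intro gR_square_le) auto
  finally have "0 < 2 * (p * r powr (p - 1)) * GR r" .
  moreover have "0 < 2 * (p * r powr (p - 1))"
    using r p_gt_1 by simp
  ultimately have "0 < GR r"
    using zero_less_mult_pos by blast
  with GR_mono[OF r(3)] show ?thesis
    by simp
qed

text \<open>A shifted cosine with slope at most 1 that is positive exactly near a point where a is positive.
It is negative elsewhere, which costs a penalty; but that is independent of the parameter.\<close>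

lemma test_trajectory:
  assumes apos: "\<exists>t. 0 < a t"
  obtains x w \<Lambda> where "continuous_on {0..T} w" "\<And>t. \<bar>w t\<bar> \<le> 1" "integral {0..T} w = 0"
    "\<And>s t. \<bar>w s - w t\<bar> \<le> \<Lambda> * \<bar>s - t\<bar>"
    "0 < integral {0..T} (\<lambda>t. a t * GR (x + integral {0..t} w))"
proof -
  have near: "\<exists>d>0. \<forall>r. \<bar>r - s\<bar> < d \<longrightarrow> 0 < a r" if "0 < a s" for s
  proof -
    have "isCont a s"
      using a_cont by (simp add: continuous_on_eq_continuous_at)
    then have "\<forall>\<^sub>F r in at s. 0 < a r"
      using order_tendstoD(1)[of a "a s" "at s" 0] that by (simp add: isCont_def)
    then obtain d where d: "d > 0" "\<And>r. r \<noteq> s \<Longrightarrow> dist r s < d \<Longrightarrow> 0 < a r"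
      unfolding eventually_at by auto
    then have "0 < a r" if "\<bar>r - s\<bar> < d" for r
      using that \<open>0 < a s\<close> by (cases "r = s") (auto simp: dist_real_def)
    with d(1) show ?thesis
      by blast
  qed
  obtain t where "0 < a t"
    using apos by blast
  moreover obtain n s where s: "t = s + of_int n * T" "0 \<le> s" "s < T"
    by (rule reduce_mod_period[OF T_pos])
  ultimately have "0 < a s"
    using periodic_add_int[of a T s n, OF a_periodic] by simp
  then obtain d where d: "0 < d" "\<And>r. \<bar>r - s\<bar> < d \<Longrightarrow> 0 < a r"
    using near by blast
  define e where "e = min d (T - s)"
  have e: "0 < e" "e \<le> T - s" "e \<le> d"
    using s d by (auto simp: e_def)
  \<comment> \<open>Moved off a possible endpoint, so that a whole neighbourhood of t1 lies in the period interval.\<close>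
  define t1 where "t1 = s + e / 2"
  have t1: "0 < t1" "t1 < T" "0 < a t1"
    using s e d(2)[of t1] by (auto simp: t1_def)
  then obtain d' where d': "0 < d'" "\<And>r. \<bar>r - t1\<bar> < d' \<Longrightarrow> 0 < a r"
    using near by blast
  define \<delta> where "\<delta> = min d' (min t1 (T - t1))"
  have \<delta>: "0 < \<delta>" "\<delta> \<le> t1" "\<delta> \<le> T - t1" "\<And>r. \<bar>r - t1\<bar> < \<delta> \<Longrightarrow> 0 < a r"
    using t1 d' by (auto simp: \<delta>_def)
  define \<kappa> where "\<kappa> = 2 * pi / T"
  have \<kappa>: "0 < \<kappa>" "\<kappa> * T = 2 * pi"
    using T_pos by (auto simp: \<kappa>_def)
  have \<kappa>\<delta>: "0 < \<kappa> * \<delta>" "\<kappa> * \<delta> \<le> pi"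
  proof -
    show "0 < \<kappa> * \<delta>"
      using \<kappa> \<delta> by simp
    have "\<kappa> * (2 * \<delta>) \<le> \<kappa> * T"
      using \<kappa> \<delta> by (intro mult_left_mono) auto
    then show "\<kappa> * \<delta> \<le> pi"
      using \<kappa>(2) by simp
  qed
  define u where "u t = (cos (\<kappa> * (t - t1)) - cos (\<kappa> * \<delta>)) / \<kappa>" for t
  define w where "w t = - sin (\<kappa> * (t - t1))" for t
  have u': "(u has_real_derivative w t) (at t)" for t
    unfolding u_def w_def using \<kappa>(1)
    by (auto intro!: derivative_eq_intros)
  have w': "(w has_real_derivative - \<kappa> * cos (\<kappa> * (t - t1))) (at t)" for t
    unfolding w_def by (auto intro!: derivative_eq_intros)
  have wint: "integral {0..t} w = u t - u 0" if "0 \<le> t" for t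
    using integral_of_derivative[OF that u'] by (simp add: integral_unique)
  have "cos (\<kappa> * (T - t1)) = cos (\<kappa> * (0 - t1))"
  proof -
    have "\<kappa> * (T - t1) = \<kappa> * (0 - t1) + 2 * pi"
      using \<kappa>(2) by (simp add: algebra_simps)
    then show ?thesis
      by (simp only: cos_periodic)
  qed
  then have w0: "integral {0..T} w = 0"
    using wint[of T] T_pos by (simp add: u_def)
  have cu: "continuous_on {0..T} u"
    using u' by (intro DERIV_continuous_on) (auto intro: has_field_derivative_at_within)
  have uneg: "u t \<le> 0" if "t \<in> {0..T}" "\<delta> \<le> \<bar>t - t1\<bar>" for t
  proof -
    define \<theta> where "\<theta> = \<kappa> * \<bar>t - t1\<bar>"
    have "\<bar>t - t1\<bar> \<le> T - \<delta>"
      using that \<delta> by auto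
    then have "\<kappa> * \<delta> \<le> \<theta>" "\<theta> \<le> 2 * pi - \<kappa> * \<delta>"
      using \<kappa> that(2) mult_left_mono[of "\<bar>t - t1\<bar>" "T - \<delta>" \<kappa>] by (auto simp: \<theta>_def right_diff_distrib)
    then have "cos \<theta> \<le> cos (\<kappa> * \<delta>)"
    proof (cases "\<theta> \<le> pi")
      case False
      \<comment> \<open>Beyond pi the cosine increases again; reflecting at pi uses that t stays a distance
        \<delta> away from the next copy of t1, one period further.\<close>
      have "cos (2 * pi - \<theta>) \<le> cos (\<kappa> * \<delta>)"
        using False \<kappa>\<delta> \<open>\<theta> \<le> 2 * pi - \<kappa> * \<delta>\<close> by (intro cos_monotone_0_pi_le) auto
      then show ?thesis
        by (simp add: cos_diff)
    qed (use \<kappa>\<delta> in \<open>auto intro: cos_monotone_0_pi_le\<close>)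
    moreover have "cos (\<kappa> * (t - t1)) = cos \<theta>"
      using \<kappa>(1) cos_abs_real[of "\<kappa> * (t - t1)"] by (simp add: \<theta>_def abs_mult)
    ultimately show ?thesis
      using \<kappa>(1) by (simp add: u_def divide_le_0_iff)
  qed
  have nonneg: "0 \<le> a t * GR (u t)" if "t \<in> {0..T}" for t
  proof (cases "\<delta> \<le> \<bar>t - t1\<bar>")
    case True
    then show ?thesis
      using uneg[OF that] by (simp add: GR_nonpos)
  next
    case False
    then have "0 < a t"
      using \<delta>(4)[of t] by simp
    moreover have "0 \<le> GR (u t)"
      using GR_pos[of "u t"] GR_nonpos[of "u t"] by (cases "0 < u t") auto
    ultimately show ?thesis
      by simp
  qed
  have "0 < u t1"
    using cos_monotone_0_pi[of 0 "\<kappa> * \<delta>"] \<kappa>\<delta> \<kappa>(1) by (simp add: u_def)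
  then have pos1: "0 < a t1 * GR (u t1)"
    using t1(3) GR_pos by simp
  have c: "continuous_on {0..T} (\<lambda>t. a t * GR (u t))"
    using cu by (intro continuous_intros continuous_on_GR a_cont_on)
  have "0 \<le> integral {0..T} (\<lambda>t. a t * GR (u t))"
    by (intro integral_nonneg integrable_continuous_interval c nonneg)
  moreover have "integral {0..T} (\<lambda>t. a t * GR (u t)) \<noteq> 0"
  proof
    assume "integral {0..T} (\<lambda>t. a t * GR (u t)) = 0"
    then have "\<forall>t\<in>{0..T}. a t * GR (u t) = 0"
      using integral_eq_0_iff[OF c T_pos] nonneg by blast
    then have "a t1 * GR (u t1) = 0"
      using t1(1,2) by simp
    with pos1 show False
      by simp
  qed
  ultimately have "0 < integral {0..T} (\<lambda>t. a t * GR (u t))"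
    by simp
  also have "integral {0..T} (\<lambda>t. a t * GR (u t)) = integral {0..T} (\<lambda>t. a t * GR (u 0 + integral {0..t} w))"
    by (rule integral_cong) (simp add: wint)
  finally have gain: "0 < integral {0..T} (\<lambda>t. a t * GR (u 0 + integral {0..t} w))" .
  have "\<bar>w s - w t\<bar> \<le> \<kappa> * \<bar>s - t\<bar>" for s t
    by (rule abs_diff_le_if_deriv_bounded[OF w']) (use \<kappa>(1) in \<open>simp add: abs_mult\<close>)
  then show thesis
    by (intro that[OF _ _ w0 _ gain]) (auto simp: w_def intro!: continuous_intros)
qed

end

section \<open>Energy estimates and large parameters\<close>

locale indefinite_problem_parameter = indefinite_problem +
  fixes lam :: real
  assumes lam_pos: "0 < lam"

sublocale indefinite_problem_parameter \<subseteq> flow: forcing T "lam * A * ell + 1" "forcing_term lam" "potential lam"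
  by (rule forcing_truncated[OF lam_pos])

context indefinite_problem_parameter
begin

lemma energy_eq:
  assumes z: "flow.admissible z"
  shows "flow.energy z = integral {0..T} (\<lambda>t. psi (snd z t)) - lam * integral {0..T} (\<lambda>t. a t * GR (flow.traj z t))
     + integral {0..T} (\<lambda>t. (min (flow.traj z t) 0)\<^sup>2 / 2)"
proof -
  note c = flow.continuous_traj[OF z]
  have "((\<lambda>t. lam * (a t * GR (flow.traj z t)) + - (min (flow.traj z t) 0)\<^sup>2 / 2) has_integral
     (lam * integral {0..T} (\<lambda>t. a t * GR (flow.traj z t)) + integral {0..T} (\<lambda>t. - (min (flow.traj z t) 0)\<^sup>2 / 2))) {0..T}"
    using c by (intro has_integral_add has_integral_mult_right integrable_integral integrable_continuous_interval
      continuous_intros continuous_on_GR a_cont_on) auto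
  then have "integral {0..T} (\<lambda>t. potential lam t (flow.traj z t)) =
     lam * integral {0..T} (\<lambda>t. a t * GR (flow.traj z t)) + integral {0..T} (\<lambda>t. - (min (flow.traj z t) 0)\<^sup>2 / 2)"
    unfolding potential_def by (rule integral_unique)
  then show ?thesis
    by (simp add: flow.energy_def)
qed

text \<open>When G(u) is close to a constant w, the negative mean of the weight turns the potential into a
gain proportional to w. The barrier uses w = G(max u), coercivity w = G(x).\<close>

lemma energy_ge:
  assumes z: "flow.admissible z" and near: "\<And>t. t \<in> {0..T} \<Longrightarrow> \<bar>GR (flow.traj z t) - w\<bar> \<le> e"
  shows "integral {0..T} (\<lambda>t. (snd z t)\<^sup>2) / 2 + lam * (deficit * w - A * T * e) +
     integral {0..T} (\<lambda>t. (min (flow.traj z t) 0)\<^sup>2 / 2) \<le> flow.energy z"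
proof -
  note c = flow.continuous_traj[OF z] and cw = flow.continuous_admissible[OF z]
  have "integral {0..T} (\<lambda>t. (snd z t)\<^sup>2 / 2) \<le> integral {0..T} (\<lambda>t. psi (snd z t))"
    using z cw by (intro integral_le integrable_continuous_interval continuous_on_psi continuous_intros psi_ge_half_square)
      (auto simp: flow.admissible_def)
  moreover have "integral {0..T} (\<lambda>t. a t * GR (flow.traj z t)) \<le> - deficit * w + A * T * e"
    using c by (intro weighted_integral_le near continuous_on_GR)
  then have "lam * integral {0..T} (\<lambda>t. a t * GR (flow.traj z t)) \<le> lam * (- deficit * w + A * T * e)"
    using lam_pos by (intro mult_left_mono) auto
  ultimately show ?thesis
    using energy_eq[OF z] by (simp add: algebra_simps)
qed

lemma penalty_nonneg: "flow.admissible z \<Longrightarrow> 0 \<le> integral {0..T} (\<lambda>t. (min (flow.traj z t) 0)\<^sup>2 / 2)"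
  by (intro integral_nonneg integrable_continuous_interval continuous_intros flow.continuous_traj) auto

lemma kinetic_nonneg: "flow.admissible z \<Longrightarrow> 0 \<le> integral {0..T} (\<lambda>t. (snd z t)\<^sup>2)"
  by (intro integral_nonneg integrable_continuous_interval continuous_intros flow.continuous_admissible) auto

lemma energy_ge_mean:
  assumes z: "flow.admissible z"
  shows "lam * deficit * GR (fst z) - lam * A * T\<^sup>2 * g R \<le> flow.energy z"
proof -
  have gR0: "0 \<le> g R"
    using R_pos by (intro g_nonneg) simp
  have "\<bar>GR (flow.traj z t) - GR (fst z)\<bar> \<le> g R * T" if t: "t \<in> {0..T}" for t
  proof -
    have "\<bar>flow.traj z t - fst z\<bar> \<le> T"
    proof -
      have "norm (integral {0..t} (snd z)) \<le> 1 * (t - 0)"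
        using t z by (intro integral_bound) (auto simp: flow.admissible_def elim: continuous_on_subset)
      then show ?thesis
        using t by (simp add: flow.traj_def)
    qed
    then have "g R * \<bar>flow.traj z t - fst z\<bar> \<le> g R * T"
      using gR0 by (rule mult_left_mono)
    with abs_GR_diff_le[of "flow.traj z t" "fst z"] show ?thesis
      by linarith
  qed
  from energy_ge[OF z this] show ?thesis
    using penalty_nonneg[OF z] kinetic_nonneg[OF z] by (simp add: algebra_simps power2_eq_square)
qed

lemma energy_bounded_below:
  assumes "flow.admissible z"
  shows "- (lam * A * T\<^sup>2 * g R) \<le> flow.energy z"
proof -
  have "0 \<le> GR (fst z)"
    using GR_pos[of "fst z"] GR_nonpos[of "fst z"] by (cases "0 < fst z") auto
  then have "0 \<le> lam * deficit * GR (fst z)"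
    using lam_pos deficit_pos by simp
  with energy_ge_mean[OF assms] show ?thesis
    by linarith
qed

text \<open>For large positive x the linear growth of G and \<integral> a < 0 make the energy grow; for large
negative x the penalty does.\<close>

lemma coercive: flow.coercive
  unfolding flow.coercive_def
proof
  fix C
  define k where "k = lam * deficit * g R"
  have k: "0 < k"
    using lam_pos deficit_pos g_pos[OF R_pos] by (simp add: k_def)
  define B1 where "B1 = R + (\<bar>C\<bar> + lam * A * T\<^sup>2 * g R) / k"
  define B2 where "B2 = T + (2 * \<bar>C\<bar> / T + 1)"
  have gR0: "0 < g R"
    by (rule g_pos[OF R_pos])
  have upper: "fst z \<le> B1" if z: "flow.admissible z" "flow.energy z \<le> C" for z
  proof (cases "R \<le> fst z")
    case True
    have "k * (fst z - R) = lam * deficit * (g R * (fst z - R))"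
      by (simp add: k_def)
    also have "\<dots> \<le> lam * deficit * GR (fst z)"
      using GR_ge_linear[OF True] lam_pos deficit_pos by (intro mult_left_mono) auto
    finally have "k * (fst z - R) \<le> \<bar>C\<bar> + lam * A * T\<^sup>2 * g R"
      using energy_ge_mean[OF z(1)] z(2) by linarith
    then have "fst z - R \<le> (\<bar>C\<bar> + lam * A * T\<^sup>2 * g R) / k"
      by (simp add: pos_le_divide_eq[OF k] mult.commute)
    then show ?thesis
      by (simp add: B1_def)
  next
    case False
    moreover have "0 \<le> (\<bar>C\<bar> + lam * A * T\<^sup>2 * g R) / k"
      using k lam_pos A_pos gR0 by (intro divide_nonneg_pos add_nonneg_nonneg) auto
    ultimately show ?thesis
      by (simp add: B1_def)
  qed
  have lower: "- B2 \<le> fst z" if z: "flow.admissible z" "flow.energy z \<le> C" for z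
  proof (rule ccontr)
    assume "\<not> ?thesis"
    then have x: "fst z + T < - (2 * \<bar>C\<bar> / T + 1)"
      by (simp add: B2_def)
    define s where "s = - (fst z + T)"
    have s: "2 * \<bar>C\<bar> / T + 1 < s" "1 < s"
    proof -
      show "2 * \<bar>C\<bar> / T + 1 < s"
        using x by (simp add: s_def)
      moreover have "0 \<le> 2 * \<bar>C\<bar> / T"
        using T_pos by simp
      ultimately show "1 < s"
        by linarith
    qed
    have tr: "flow.traj z t \<le> - s" if t: "t \<in> {0..T}" for t
    proof -
      have "norm (integral {0..t} (snd z)) \<le> 1 * (t - 0)"
        using t z(1) by (intro integral_bound) (auto simp: flow.admissible_def elim: continuous_on_subset)
      then show ?thesis
        using t by (simp add: flow.traj_def s_def abs_le_iff)
    qed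
    have "integral {0..T} (\<lambda>t. s\<^sup>2 / 2) \<le> integral {0..T} (\<lambda>t. (min (flow.traj z t) 0)\<^sup>2 / 2)"
    proof (rule integral_le)
      fix t assume "t \<in> {0..T}"
      then have "flow.traj z t \<le> - s"
        by (rule tr)
      then have "\<bar>s\<bar> \<le> \<bar>min (flow.traj z t) 0\<bar>"
        using s by auto
      then have "s\<^sup>2 \<le> (min (flow.traj z t) 0)\<^sup>2"
        by (rule abs_le_square_iff[THEN iffD1])
      then show "s\<^sup>2 / 2 \<le> (min (flow.traj z t) 0)\<^sup>2 / 2"
        by simp
    qed (use flow.continuous_traj[OF z(1)] in \<open>auto intro!: integrable_continuous_interval continuous_intros\<close>)
    moreover have "\<bar>GR (flow.traj z t) - 0\<bar> \<le> 0" if "t \<in> {0..T}" for t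
      using tr[OF that] s by (simp add: GR_nonpos)
    from energy_ge[OF z(1) this] have "integral {0..T} (\<lambda>t. (min (flow.traj z t) 0)\<^sup>2 / 2) \<le> C"
      using kinetic_nonneg[OF z(1)] z(2) by simp
    ultimately have "T * s\<^sup>2 \<le> 2 * C"
      using T_pos by simp
    moreover have "2 * C < T * s"
      using s(1) T_pos by (simp add: field_simps abs_le_iff) 
    moreover have "T * s * 1 \<le> T * s * s"
      using s T_pos by (intro mult_left_mono) auto
    ultimately show False
      by (simp add: power2_eq_square)
  qed
  show "\<exists>B. \<forall>z. flow.admissible z \<and> flow.energy z \<le> C \<longrightarrow> \<bar>fst z\<bar> \<le> B"
    using upper lower by (intro exI[of _ "max B1 B2"]) (fastforce simp: abs_le_iff)
qed

lemma energy_nonneg_if_peak_nonpos: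
  assumes z: "flow.admissible z" and peak: "flow.peak z \<le> 0"
  shows "0 \<le> flow.energy z"
proof -
  obtain t1 where "\<And>s. s \<in> {0..T} \<Longrightarrow> flow.traj z s \<le> flow.peak z"
    using z by (rule flow.peak_attained) blast
  then have "\<bar>GR (flow.traj z t) - 0\<bar> \<le> 0" if "t \<in> {0..T}" for t
    using peak that by (force simp: GR_nonpos)
  from energy_ge[OF z this] show ?thesis
    using kinetic_nonneg[OF z] penalty_nonneg[OF z] by simp
qed

text \<open>Let \<rho> be the maximum of u and N = \<integral> w^2. The oscillation of u is at most
d = sqrt(T N), so G(u) lies within g(\<rho>) d of G(\<rho>). The kinetic part is at least
d^2/(2T), and completing the square absorbs the resulting linear term in d at the price of a
multiple of g(\<rho>)^2, which is negligible against G(\<rho>) by \<open>gR_square_le\<close>.\<close>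

lemma energy_barrier:
  assumes z: "flow.admissible z" and peak: "0 < flow.peak z" "flow.peak z \<le> R"
    and small: "2 * lam * A\<^sup>2 * T ^ 3 * (p * flow.peak z powr (p - 1)) \<le> deficit"
  shows "lam * deficit * GR (flow.peak z) / 2 \<le> flow.energy z"
proof -
  define \<rho> where "\<rho> = flow.peak z"
  note c = flow.continuous_admissible[OF z]
  obtain t1 where t1: "t1 \<in> {0..T}" "flow.traj z t1 = \<rho>" "\<And>s. s \<in> {0..T} \<Longrightarrow> flow.traj z s \<le> \<rho>"
    unfolding \<rho>_def using z by (rule flow.peak_attained) blast
  define N where "N = integral {0..T} (\<lambda>t. (snd z t)\<^sup>2)"
  have N: "0 \<le> N"
    unfolding N_def by (rule kinetic_nonneg[OF z])
  define d where "d = sqrt (T * N)"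
  have d: "d\<^sup>2 = T * N"
    using N T_pos by (simp add: d_def)
  have osc: "\<rho> - flow.traj z t \<le> d" if t: "t \<in> {0..T}" for t
  proof -
    have "(flow.traj z s - flow.traj z r)\<^sup>2 \<le> T * N" if "0 \<le> r" "r \<le> s" "s \<le> T" for r s
      using integral_square_le_interval[OF c that] flow.integral_traj_diff[OF z that] by (simp add: N_def)
    from this[of t t1] this[of t1 t] have "(\<rho> - flow.traj z t)\<^sup>2 \<le> T * N"
      using t t1(1,2) by (cases "t \<le> t1") (auto simp: power2_commute)
    then show ?thesis
      unfolding d_def by (rule real_le_rsqrt)
  qed
  define G where "G = gR \<rho>"
  have G: "0 \<le> G"
    by (simp add: G_def gR_nonneg)
  have "\<bar>GR (flow.traj z t) - GR \<rho>\<bar> \<le> G * d" if t: "t \<in> {0..T}" for t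
  proof -
    have "GR \<rho> - GR (flow.traj z t) \<le> G * (\<rho> - flow.traj z t)"
      unfolding G_def by (rule GR_diff_le[OF t1(3)[OF t]])
    also have "\<dots> \<le> G * d"
      using osc[OF t] G by (rule mult_left_mono)
    finally show ?thesis
      using GR_mono[OF t1(3)[OF t]] by simp
  qed
  from energy_ge[OF z this] have "N / 2 + lam * (deficit * GR \<rho> - A * T * (G * d)) \<le> flow.energy z"
    using penalty_nonneg[OF z] by (simp add: N_def)
  moreover have "lam * A * T * G * d \<le> N / 2 + lam\<^sup>2 * A\<^sup>2 * T ^ 3 * G\<^sup>2 / 2"
  proof -
    \<comment> \<open>The square is chosen so that its mixed term is the linear term to be absorbed.\<close>
    have "0 \<le> (d - lam * A * T\<^sup>2 * G)\<^sup>2 / (2 * T)"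
      using T_pos by simp
    also have "\<dots> = N / 2 + lam\<^sup>2 * A\<^sup>2 * T ^ 3 * G\<^sup>2 / 2 - lam * A * T * G * d"
      using T_pos d by (simp add: power2_diff field_simps power2_eq_square power3_eq_cube)
    finally show ?thesis
      by simp
  qed
  moreover have "lam\<^sup>2 * A\<^sup>2 * T ^ 3 * G\<^sup>2 \<le> lam * deficit * GR \<rho>"
  proof -
    have "0 < \<rho>" "\<rho> \<le> R"
      using peak by (auto simp: \<rho>_def)
    then have "G\<^sup>2 \<le> 2 * (p * \<rho> powr (p - 1)) * GR \<rho>"
      unfolding G_def by (intro gR_square_le) auto
    then have "lam\<^sup>2 * A\<^sup>2 * T ^ 3 * G\<^sup>2 \<le> lam\<^sup>2 * A\<^sup>2 * T ^ 3 * (2 * (p * \<rho> powr (p - 1)) * GR \<rho>)"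
      using T_pos by (intro mult_left_mono) auto
    also have "\<dots> = lam * GR \<rho> * (2 * lam * A\<^sup>2 * T ^ 3 * (p * \<rho> powr (p - 1)))"
      by (simp add: power2_eq_square algebra_simps)
    also have "\<dots> \<le> lam * GR \<rho> * deficit"
      using small lam_pos GR_pos[OF \<open>0 < \<rho>\<close>] by (intro mult_left_mono) (auto simp: \<rho>_def)
    finally show ?thesis
      by (simp add: mult_ac)
  qed
  ultimately show ?thesis
    by (simp add: \<rho>_def algebra_simps)
qed

lemma barrier_radius:
  obtains r where "0 < r" "r \<le> R" "\<And>s. 0 < s \<Longrightarrow> s \<le> r \<Longrightarrow> 2 * lam * A\<^sup>2 * T ^ 3 * (p * s powr (p - 1)) \<le> deficit"
proof -
  define k where "k = 2 * lam * A\<^sup>2 * T ^ 3 * p"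
  have k: "0 < k"
    using lam_pos A_pos T_pos p_gt_1 by (simp add: k_def)
  define r where "r = min R ((deficit / k) powr (1 / (p - 1)))"
  show thesis
  proof (rule that[of r])
    show "0 < r" "r \<le> R"
      using R_pos k deficit_pos by (auto simp: r_def)
    fix s :: real assume s: "0 < s" "s \<le> r"
    then have "s powr (p - 1) \<le> ((deficit / k) powr (1 / (p - 1))) powr (p - 1)"
      using p_gt_1 by (intro powr_mono2) (auto simp: r_def)
    also have "\<dots> = deficit / k"
      using p_gt_1 deficit_pos k by (simp add: powr_powr)
    finally have "s powr (p - 1) * k \<le> deficit"
      by (simp only: pos_le_divide_eq[OF k])
    moreover have "2 * lam * A\<^sup>2 * T ^ 3 * (p * s powr (p - 1)) = s powr (p - 1) * k"
      by (simp add: k_def)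
    ultimately show "2 * lam * A\<^sup>2 * T ^ 3 * (p * s powr (p - 1)) \<le> deficit"
      by linarith
  qed
qed

text \<open>Nonzero energy excludes the trivial state. For a positive solution the penalty is inactive, and the a
priori bound keeps it below R, where g has not been truncated.\<close>

lemma stationary_imp_solution:
  assumes z: "flow.admissible z" and st: "flow.stationary z" and nz: "flow.energy z \<noteq> 0"
  obtains v where "positive_periodic_solution T lam a g v"
    "\<And>t. t \<in> {0..T} \<Longrightarrow> v t = flow.traj z t" "\<And>t. t \<in> {0..T} \<Longrightarrow> deriv v t = snd z t"
proof -
  have cF: "continuous_on UNIV (\<lambda>t. forcing_term lam t (u t))" if "continuous_on UNIV u" for u
    unfolding forcing_term_def using that by (intro continuous_intros continuous_on_gR a_cont_on)
  have pF: "forcing_term lam (t + T) s = forcing_term lam t s" for t s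
    by (simp add: forcing_term_def a_periodic)
  obtain v y where v': "\<And>t. (v has_real_derivative phi_inv (y t)) (at t)"
    and y': "\<And>t. (y has_real_derivative - forcing_term lam t (v t)) (at t)"
    and vper: "\<And>t. v (t + T) = v t" and yper: "\<And>t. y (t + T) = y t"
    and vz: "\<And>t. t \<in> {0..T} \<Longrightarrow> v t = flow.traj z t"
    and wz: "\<And>t. t \<in> {0..T} \<Longrightarrow> snd z t = phi_inv (y t)"
    using flow.stationary_imp_periodic_system[OF z st cF pF] by metis
  have dv: "deriv v t = phi_inv (y t)" for t
    by (rule DERIV_imp_deriv[OF v'])
  have vpos: "0 < v t" for t
  proof (rule periodic_system_positive[where v = v and y = y and f = "forcing_term lam" and T = T and K = "lam * A * ell + 1"])
    show "0 < forcing_term lam t s" if "s < 0" for t s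
      using that by (simp add: forcing_term_def gR_nonpos)
    show "\<bar>forcing_term lam t s\<bar> \<le> (lam * A * ell + 1) * \<bar>s\<bar>" for t s
    proof -
      have "\<bar>lam * (a t * gR s)\<bar> = lam * (\<bar>a t\<bar> * gR s)"
        using lam_pos gR_nonneg[of s] by (simp add: abs_mult)
      also have "\<dots> \<le> lam * (A * (ell * \<bar>s\<bar>))"
        using lam_pos a_le A_pos gR_nonneg gR_lipschitz[of s 0] by (intro mult_left_mono mult_mono) (auto simp: gR_nonpos)
      finally have "\<bar>lam * (a t * gR s)\<bar> \<le> lam * (A * (ell * \<bar>s\<bar>))" .
      moreover have "\<bar>max (- s) 0\<bar> \<le> \<bar>s\<bar>"
        by auto
      moreover have "lam * (A * (ell * \<bar>s\<bar>)) + \<bar>s\<bar> = (lam * A * ell + 1) * \<bar>s\<bar>"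
        by (simp add: algebra_simps)
      ultimately show ?thesis
        unfolding forcing_term_def using abs_triangle_ineq[of "lam * (a t * gR s)" "max (- s) 0"] by linarith
    qed
    show "\<exists>t. v t \<noteq> 0"
    proof (rule ccontr)
      assume "\<nexists>t. v t \<noteq> 0"
      then have v0: "v = (\<lambda>t. 0)"
        by auto
      then have w0: "snd z t = 0" if "t \<in> {0..T}" for t
        using wz[OF that] dv[of t] by simp
      have "integral {0..T} (\<lambda>t. psi (snd z t)) = integral {0..T} (\<lambda>t. 0)"
        by (rule integral_cong) (simp add: w0)
      moreover have "integral {0..T} (\<lambda>t. potential lam t (flow.traj z t)) = integral {0..T} (\<lambda>t. 0)"
        by (rule integral_cong) (simp add: vz[symmetric] v0 potential_def GR_0)
      ultimately have "flow.energy z = 0"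
        by (simp add: flow.energy_def)
      with nz show False
        by simp
    qed
  qed (use T_pos v' y' vper in auto)
  have Fv: "forcing_term lam t (v t) = lam * (a t * gR (v t))" for t
    using vpos[of t] by (simp add: forcing_term_def)
  have cv: "continuous_on UNIV v"
    using v' by (intro DERIV_continuous_on) (auto intro: has_field_derivative_at_within)
  obtain t0 where t0: "t0 \<in> {0..T}" "\<And>t. v t0 \<le> v t"
    using periodic_attains_min[OF T_pos cv vper] by metis
  have vT: "v t \<le> v t0 + T" for t
  proof -
    obtain n s where s: "t - t0 = s + of_int n * T" "0 \<le> s" "s < T"
      by (rule reduce_mod_period[OF T_pos])
    then have "t = (t0 + s) + of_int n * T"
      by simp
    then have "v t = v (t0 + s)"
      using periodic_add_int[of v T "t0 + s" n, OF vper] by simp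
    moreover have "\<bar>v (t0 + s) - v t0\<bar> \<le> 1 * \<bar>(t0 + s) - t0\<bar>"
      by (rule abs_diff_le_if_deriv_bounded[OF v']) (simp add: abs_phi_inv_less_1 less_imp_le)
    ultimately show ?thesis
      using s by simp
  qed
  have "((\<lambda>t. - forcing_term lam t (v t)) has_integral (y T - y 0)) {0..T}"
    using integral_of_derivative[OF _ y'] T_pos by simp
  moreover have "y T = y 0"
    using yper[of 0] by simp
  moreover have "(\<lambda>t. - forcing_term lam t (v t)) = (\<lambda>t. (- lam) * (a t * gR (v t)))"
    by (simp add: Fv)
  ultimately have "((\<lambda>t. (- lam) * (a t * gR (v t))) has_integral 0) {0..T}"
    by simp
  from integral_unique[OF this] have "(- lam) * integral {0..T} (\<lambda>t. a t * gR (v t)) = 0"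
    by (simp only: integral_mult_right)
  then have int0: "integral {0..T} (\<lambda>t. a t * gR (v t)) = 0"
    using lam_pos by simp
  have "v t0 < threshold"
  proof (rule min_below_threshold[of gR])
    show "\<And>t. t \<in> {0..T} \<Longrightarrow> v t0 \<le> v t \<and> v t \<le> v t0 + T"
      using t0(2) vT by blast
    show "continuous_on {0..T} (\<lambda>t. gR (v t))"
      using cv by (intro continuous_on_gR) (auto elim: continuous_on_subset)
  qed (use int0 gR_mono gR_pos[OF vpos] gR_slow_growth in auto)
  then have vR: "v t \<le> R" for t
    using vT[of t] by (simp add: R_def)
  then have gv: "gR (v t) = g (v t)" for t
    using vpos[of t] by (simp add: gR_eq)
  have "is_solution lam a g v"
  proof (rule system_imp_solution[OF v'])
    show "(y has_real_derivative - (lam * a t * g (v t))) (at t)" for t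
      using y'[of t] by (simp add: Fv gv mult.assoc)
    show "\<bar>lam * a t * g (v t)\<bar> \<le> lam * A * g R" for t
    proof -
      have "\<bar>lam * a t * g (v t)\<bar> = lam * \<bar>a t\<bar> * g (v t)"
        using lam_pos g_nonneg[of "v t"] vpos[of t] by (simp add: abs_mult)
      also have "\<dots> \<le> lam * A * g R"
        using lam_pos a_le A_pos vR vpos g_nonneg[of "v t"] by (intro mult_mono g_mono) (auto simp: less_imp_le)
      finally show ?thesis .
    qed
  qed
  with vper vpos have "positive_periodic_solution T lam a g v"
    by (simp add: positive_periodic_solution_def)
  with vz wz dv that show thesis
    by metis
qed

text \<open>The state \<open>z\<close> of negative energy serves twice: its orbit descends to a solution of negative
energy, and it is the far end of a mountain pass that yields a solution of positive energy.\<close>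

lemma two_solutions:
  assumes z: "flow.admissible z" and lip: "flow.slope_lipschitz \<Lambda> z" and neg: "flow.energy z < 0"
  shows "\<exists>u v. u \<noteq> v \<and> positive_periodic_solution T lam a g u \<and> positive_periodic_solution T lam a g v"
proof -
  obtain z1 where z1: "flow.admissible z1" "flow.stationary z1" "flow.energy z1 < 0"
    using flow.orbit_limit[OF coercive z lip energy_bounded_below[OF flow.admissible_orbit[OF z]]] neg
    by (metis le_less_trans)
  obtain r where r: "0 < r" "r \<le> R"
    "\<And>s. 0 < s \<Longrightarrow> s \<le> r \<Longrightarrow> 2 * lam * A\<^sup>2 * T ^ 3 * (p * s powr (p - 1)) \<le> deficit"
    using barrier_radius by metis
  define c where "c = lam * deficit * GR r / 2"
  have c: "0 < c"
    using lam_pos deficit_pos GR_pos[OF r(1)] by (simp add: c_def)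
  have low: "0 \<le> flow.energy x" if x: "flow.admissible x" "flow.peak x \<le> r" for x
  proof (cases "flow.peak x \<le> 0")
    case True
    with x(1) show ?thesis
      by (rule energy_nonneg_if_peak_nonpos)
  next
    case False
    then have pos: "0 < flow.peak x"
      by simp
    have "lam * deficit * GR (flow.peak x) / 2 \<le> flow.energy x"
      using x r pos by (intro energy_barrier) auto
    moreover have "0 < lam * deficit * GR (flow.peak x) / 2"
      using lam_pos deficit_pos GR_pos[OF pos] by simp
    ultimately show ?thesis
      by linarith
  qed
  have barrier: "c \<le> flow.energy x" if x: "flow.admissible x" "flow.peak x = r" for x
    using energy_barrier[OF x(1)] x(2) r by (simp add: c_def)
  obtain z2 where z2: "flow.admissible z2" "flow.stationary z2" "c \<le> flow.energy z2"
    using flow.mountain_pass[OF coercive z lip neg r(1) low barrier] by metis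
  obtain u where u: "positive_periodic_solution T lam a g u"
    "\<And>t. t \<in> {0..T} \<Longrightarrow> u t = flow.traj z1 t" "\<And>t. t \<in> {0..T} \<Longrightarrow> deriv u t = snd z1 t"
    using stationary_imp_solution[OF z1(1,2)] z1(3) by (metis less_irrefl)
  obtain v where v: "positive_periodic_solution T lam a g v"
    "\<And>t. t \<in> {0..T} \<Longrightarrow> v t = flow.traj z2 t" "\<And>t. t \<in> {0..T} \<Longrightarrow> deriv v t = snd z2 t"
    using stationary_imp_solution[OF z2(1,2)] z2(3) c by (metis less_le_not_le)
  have "u \<noteq> v"
  proof
    assume "u = v"
    then have "flow.traj z1 t = flow.traj z2 t" "snd z1 t = snd z2 t" if "t \<in> {0..T}" for t
      using u(2,3)[OF that] v(2,3)[OF that] by simp_all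
    then have "flow.energy z1 = flow.energy z2"
      unfolding flow.energy_def by (intro arg_cong2[of _ _ _ _ "(-)"] integral_cong) auto
    with z1(3) z2(3) c show False
      by simp
  qed
  with u v show ?thesis
    by blast
qed

end

lemma (in indefinite_problem) two_solutions_large_parameter:
  assumes apos: "\<exists>t. 0 < a t"
  obtains lam_up where "\<And>lam. 0 < lam \<Longrightarrow> lam_up < lam \<Longrightarrow>
    \<exists>u v. u \<noteq> v \<and> positive_periodic_solution T lam a g u \<and> positive_periodic_solution T lam a g v"
proof -
  obtain x w \<Lambda> where w: "continuous_on {0..T} w" "\<And>t. \<bar>w t\<bar> \<le> 1" "integral {0..T} w = 0"
    "\<And>s t. \<bar>w s - w t\<bar> \<le> \<Lambda> * \<bar>s - t\<bar>"
    and gain: "0 < integral {0..T} (\<lambda>t. a t * GR (x + integral {0..t} w))"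
    using apos by (rule test_trajectory) blast
  define gain where "gain = integral {0..T} (\<lambda>t. a t * GR (x + integral {0..t} w))"
  define cost where "cost = integral {0..T} (\<lambda>t. psi (w t)) + integral {0..T} (\<lambda>t. (min (x + integral {0..t} w) 0)\<^sup>2 / 2)"
  show thesis
  proof (rule that[of "cost / gain"])
    fix lam :: real
    assume lam: "0 < lam" "cost / gain < lam"
    interpret indefinite_problem_parameter T p a g lam
      by unfold_locales (rule lam(1))
    have z: "flow.admissible (x, w)"
      using w by (simp add: flow.admissible_def)
    have "flow.slope_lipschitz \<Lambda> (x, w)"
      using w(4) by (simp add: flow.slope_lipschitz_def)
    moreover have "flow.energy (x, w) = cost - lam * gain"
      using energy_eq[OF z] by (simp add: cost_def gain_def flow.traj_def)
    then have "flow.energy (x, w) < 0"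
      using lam(2) gain by (simp add: gain_def field_simps)
    ultimately show "\<exists>u v. u \<noteq> v \<and> positive_periodic_solution T lam a g u \<and> positive_periodic_solution T lam a g v"
      using two_solutions[OF z] by blast
  qed
qed

section \<open>The two model nonlinearities\<close>

lemma (in indefinite_problem) parameter_thresholds:
  assumes apos: "\<exists>t. 0 < a t"
  shows "\<exists>low>0. \<exists>up.
    (\<forall>lam. 0 < lam \<and> lam < low \<longrightarrow> \<not> (\<exists>u. positive_periodic_solution T lam a g u)) \<and>
    (\<forall>lam. 0 < lam \<and> up < lam \<longrightarrow>
      (\<exists>u v. u \<noteq> v \<and> positive_periodic_solution T lam a g u \<and> positive_periodic_solution T lam a g v))"
proof -
  obtain up where up: "\<And>lam. 0 < lam \<Longrightarrow> up < lam \<Longrightarrow>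
      \<exists>u v. u \<noteq> v \<and> positive_periodic_solution T lam a g u \<and> positive_periodic_solution T lam a g v"
    by (rule two_solutions_large_parameter[OF apos]) (rule that)
  define low where "low = deficit / (ell * A\<^sup>2 * T ^ 3)"
  have low: "0 < low"
    unfolding low_def using deficit_pos ell_pos A_pos T_pos by simp
  show ?thesis
  proof (rule exI[of _ low], intro conjI low, rule exI[of _ up], intro conjI allI impI; elim conjE)
    show "\<not> (\<exists>u. positive_periodic_solution T lam a g u)" if "0 < lam" "lam < low" for lam
      using no_solution_small_parameter[of lam] that unfolding low_def by blast
  qed (rule up)
qed

theorem theorem1p1:
  fixes T p q :: real and a :: "real \<Rightarrow> real"
  assumes "T > 0" and "p > 1" and "0 \<le> q" and "q < 1"
    and "\<exists>t. a t > 0" and "\<exists>t. a t < 0"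
    and "continuous_on UNIV a"
    and "\<forall>t. a (t + T) = a t"
    and "finite {t \<in> {0..T}. a t = 0}"
    and "integral {0..T} a < 0"
  shows "\<exists>lam_low lam_up. 0 < lam_low \<and> lam_low \<le> lam_up \<and>
    (\<forall>g \<in> {\<lambda>s::real. s powr p, \<lambda>s::real. s powr p / (1 + s powr (p - q))}.
       (\<forall>lam. 0 < lam \<and> lam < lam_low \<longrightarrow>
          \<not> (\<exists>u. positive_periodic_solution T lam a g u)) \<and>
       (\<forall>lam. lam > lam_up \<longrightarrow>
          (\<exists>u v. u \<noteq> v \<and>
             positive_periodic_solution T lam a g u \<and>
             positive_periodic_solution T lam a g v)))"
proof -
  let ?g1 = "\<lambda>s::real. s powr p" and ?g2 = "\<lambda>s::real. s powr p / (1 + s powr (p - q))"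
  have pq: "0 \<le> p - q"
    using assms by simp
  have den: "0 < 1 + s powr (p - q)" for s :: real
    by (simp add: add_pos_nonneg)
  interpret P1: indefinite_problem T p a ?g1
  proof
    show "r powr p \<le> s powr p" if "0 \<le> r" "r \<le> s" for r s :: real
      using that assms(2) by (intro powr_mono2) auto
  qed (use assms in auto)
  interpret P2: indefinite_problem T p a ?g2
  proof
    show "r powr p / (1 + r powr (p - q)) \<le> s powr p / (1 + s powr (p - q))" if "0 \<le> r" "r \<le> s" for r s :: real
    proof (cases "r = 0")
      case True
      then show ?thesis
        using den[of s] by simp
    next
      case False
      with that have rs: "0 < r" "0 < s"
        by auto
      \<comment> \<open>In this form the quotient is visibly nondecreasing, because p and q are nonnegative.\<close>
      have eq: "x powr p / (1 + x powr (p - q)) = 1 / (x powr (- p) + x powr (- q))" if "0 < x" for x :: real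
      proof -
        have "x powr p * (x powr (- p) + x powr (- q)) = 1 + x powr (p - q)"
          using that by (simp add: distrib_left powr_add[symmetric])
        moreover have "0 < x powr (- p) + x powr (- q)"
          using that by (simp add: add_pos_pos)
        ultimately show ?thesis
          using den[of x] by (simp add: field_simps)
      qed
      have "s powr (- p) + s powr (- q) \<le> r powr (- p) + r powr (- q)"
        using rs that assms by (intro add_mono powr_mono2') auto
      moreover have "0 < s powr (- p) + s powr (- q)"
        using rs by (simp add: add_pos_pos)
      ultimately show ?thesis
        unfolding eq[OF rs(1)] eq[OF rs(2)] by (intro divide_left_mono) auto
    qed
    show "s powr p / (1 + s powr (p - q)) \<le> s powr p" if "0 < s" for s :: real
      using den[of s] by (simp add: divide_le_eq mult_le_cancel_left1)
    show "s powr p / (1 + s powr (p - q)) / s powr p \<le> r powr p / (1 + r powr (p - q)) / r powr p"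
      if "0 < r" "r \<le> s" for r s :: real
    proof -
      have "r powr (p - q) \<le> s powr (p - q)"
        using that pq by (intro powr_mono2) auto
      then have "1 / (1 + s powr (p - q)) \<le> 1 / (1 + r powr (p - q))"
        using den[of r] by (intro divide_left_mono) (auto simp: den)
      then show ?thesis
        using that by simp
    qed
  qed (use assms den in auto)
  define none where "none g lam \<longleftrightarrow> \<not> (\<exists>u. positive_periodic_solution T lam a g u)" for g lam
  define two where "two g lam \<longleftrightarrow> (\<exists>u v. u \<noteq> v \<and> positive_periodic_solution T lam a g u \<and>
    positive_periodic_solution T lam a g v)" for g lam
  obtain low1 up1 where 1: "0 < low1" "\<And>lam. 0 < lam \<Longrightarrow> lam < low1 \<Longrightarrow> none ?g1 lam"
    "\<And>lam. 0 < lam \<Longrightarrow> up1 < lam \<Longrightarrow> two ?g1 lam"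
    using P1.parameter_thresholds[OF assms(5), folded none_def two_def] by metis
  obtain low2 up2 where 2: "0 < low2" "\<And>lam. 0 < lam \<Longrightarrow> lam < low2 \<Longrightarrow> none ?g2 lam"
    "\<And>lam. 0 < lam \<Longrightarrow> up2 < lam \<Longrightarrow> two ?g2 lam"
    using P2.parameter_thresholds[OF assms(5), folded none_def two_def] by metis
  define low up where "low = min low1 low2" and "up = max low (max up1 up2)"
  have low: "0 < low" "low \<le> up"
    using 1(1) 2(1) by (auto simp: low_def up_def)
  have "none ?g1 lam \<and> none ?g2 lam" if "0 < lam" "lam < low" for lam
    using that 1(2)[of lam] 2(2)[of lam] by (simp add: low_def)
  moreover have "two ?g1 lam \<and> two ?g2 lam" if "up < lam" for lam
  proof -
    have "0 < lam" "up1 < lam" "up2 < lam"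
      using that low by (auto simp: up_def)
    with 1(3)[of lam] 2(3)[of lam] show ?thesis
      by simp
  qed
  ultimately show ?thesis
    unfolding none_def[symmetric] two_def[symmetric]
    using low by (intro exI[of _ low] exI[of _ up]) simp
qed

end
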